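(* Suppose that every $n$-vertex undirected weighted graph (nonnegative weights) admits an interactive $\alpha$-spanner with query time $q$ and size $h(n)$. Then for every real $t\geq1$, every $n$-vertex undirected weighted graph $G$ also admits an interactive $O(\alpha\cdot t)$-spanner with query time $O(q+t)$ and size $n+O(h(\frac{n}{t}))$.
   Context: An interactive $\alpha$-spanner of $G=(V,E,w)$ is a pair $(S,D)$ with $S\subseteq E$ and $D$ an oracle that answers every query $(u,v)\in V^2$ with a $u$–$v$ path $P\subseteq S$ satisfying $d_G(u,v)\leq w(P)\leq\alpha\, d_G(u,v)$. Its size is $\max\{|S|,|D|\}$ where $|D|$ is the storage of $D$ in words; query time $q$ means each query is answered in time $O(q+|P|)$. *)

theory Defs
  imports Complex_Main
begin

section \<open>Weighted graphs, paths and distances\<close>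

text \<open>
  An \<open>n\<close>-vertex weighted graph has vertex set \<open>{..<n}\<close> (so that vertices are machine words), a set \<open>E\<close>
  of two-element edges, and a weight function \<open>w\<close> that is relevant only on \<open>E\<close>.
  Graphs need not be connected.
\<close>

definition weighted_graph :: "nat \<Rightarrow> nat set set \<Rightarrow> (nat set \<Rightarrow> real) \<Rightarrow> bool" where
  "weighted_graph n E w \<longleftrightarrow>
     E \<subseteq> {{x, y} | x y. x < n \<and> y < n \<and> x \<noteq> y} \<and> (\<forall>e\<in>E. 0 \<le> w e)"

definition path_edges :: "nat list \<Rightarrow> nat set list" where
  "path_edges P = map2 (\<lambda>x y. {x, y}) P (tl P)"

definition is_path :: "nat set set \<Rightarrow> nat \<Rightarrow> nat \<Rightarrow> nat list \<Rightarrow> bool" where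
  "is_path E u v P \<longleftrightarrow>
     P \<noteq> [] \<and> hd P = u \<and> last P = v \<and> distinct P \<and> set (path_edges P) \<subseteq> E"

definition path_weight :: "(nat set \<Rightarrow> real) \<Rightarrow> nat list \<Rightarrow> real" where
  "path_weight w P = sum_list (map w (path_edges P))"

text \<open>Meaningful only if \<open>u\<close> and \<open>v\<close> are joined by some path; otherwise the infimum is over the empty set.\<close>

definition graph_dist :: "nat set set \<Rightarrow> (nat set \<Rightarrow> real) \<Rightarrow> nat \<Rightarrow> nat \<Rightarrow> real" where
  "graph_dist E w u v = (INF P\<in>{P. is_path E u v P}. path_weight w P)"


section \<open>A word RAM for query algorithms\<close>

text \<open>
  Query algorithms are finite structured programs over finitely many registers. They have read-only
  access to the stored words \<open>D\<close> (\<open>Probe\<close>) and read/write access to a scratch memory that is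
  zero at the start of every query (\<open>Load\<close>, \<open>Store\<close>). The answer is reported word by word by \<open>Emit\<close>.
  Registers are numbered; the first argument of an instruction is its target register
  (for \<open>Store\<close>, the register holding the address).
\<close>

datatype arith =
  Add | Sub | Mul | Div | Mod | And | Or | Xor | Shl | Shr | Less | Equal

fun arith_val :: "arith \<Rightarrow> nat \<Rightarrow> nat \<Rightarrow> nat" where
  "arith_val Add x y = x + y"
| "arith_val Sub x y = x - y"
| "arith_val Mul x y = x * y"
| "arith_val Div x y = x div y"
| "arith_val Mod x y = x mod y"
| "arith_val And x y = and x y"
| "arith_val Or x y = or x y"
| "arith_val Xor x y = xor x y"
| "arith_val Shl x y = push_bit y x"
| "arith_val Shr x y = drop_bit y x"
| "arith_val Less x y = of_bool (x < y)"
| "arith_val Equal x y = of_bool (x = y)"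

datatype prog =
    Skip
  | Const nat nat
  | Arith arith nat nat nat
  | Probe nat nat
  | Load nat nat
  | Store nat nat
  | Emit nat
  | Seq prog prog
  | If_Nonzero nat prog prog
  | While_Nonzero nat prog

record machine =
  reg :: "nat \<Rightarrow> nat"
  scratch :: "nat \<Rightarrow> nat"
  reported :: "nat list"

text \<open>
  \<open>exec W D p s k s'\<close>: on stored data \<open>D\<close>, program \<open>p\<close> takes state \<open>s\<close> to \<open>s'\<close> in time \<open>k\<close>.
  Words are the numbers below \<open>W\<close>. A step that would produce a larger number, or that probes
  outside \<open>D\<close>, has no successor state, so that a run exists only if it does neither.
\<close>

inductive exec :: "nat \<Rightarrow> nat list \<Rightarrow> prog \<Rightarrow> machine \<Rightarrow> nat \<Rightarrow> machine \<Rightarrow> bool"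
  for W :: nat and D :: "nat list" where
  skip: "exec W D Skip s 1 s"
| const: "a < W \<Longrightarrow> exec W D (Const r a) s 1 (s\<lparr>reg := (reg s)(r := a)\<rparr>)"
| arith: "arith_val f (reg s i) (reg s j) < W \<Longrightarrow>
    exec W D (Arith f r i j) s 1 (s\<lparr>reg := (reg s)(r := arith_val f (reg s i) (reg s j))\<rparr>)"
| probe: "reg s i < length D \<Longrightarrow>
    exec W D (Probe r i) s 1 (s\<lparr>reg := (reg s)(r := D ! reg s i)\<rparr>)"
| load: "exec W D (Load r i) s 1 (s\<lparr>reg := (reg s)(r := scratch s (reg s i))\<rparr>)"
| store: "exec W D (Store i j) s 1 (s\<lparr>scratch := (scratch s)(reg s i := reg s j)\<rparr>)"
| emit: "exec W D (Emit i) s 1 (s\<lparr>reported := reported s @ [reg s i]\<rparr>)"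
| seq: "exec W D p1 s k1 s1 \<Longrightarrow> exec W D p2 s1 k2 s2 \<Longrightarrow> exec W D (Seq p1 p2) s (k1 + k2) s2"
| if_true: "reg s i \<noteq> 0 \<Longrightarrow> exec W D p1 s k s1 \<Longrightarrow>
    exec W D (If_Nonzero i p1 p2) s (1 + k) s1"
| if_false: "reg s i = 0 \<Longrightarrow> exec W D p2 s k s1 \<Longrightarrow>
    exec W D (If_Nonzero i p1 p2) s (1 + k) s1"
| while_stop: "reg s i = 0 \<Longrightarrow> exec W D (While_Nonzero i p) s 1 s"
| while_step: "reg s i \<noteq> 0 \<Longrightarrow> exec W D p s k1 s1 \<Longrightarrow> exec W D (While_Nonzero i p) s1 k2 s2 \<Longrightarrow>
    exec W D (While_Nonzero i p) s (1 + k1 + k2) s2"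

text \<open>Words have \<open>b * log 2 (n + 2)\<close> bits, for a constant \<open>b\<close> that belongs to the query algorithm.\<close>

definition word_bound :: "nat \<Rightarrow> nat \<Rightarrow> nat" where
  "word_bound b n = (n + 2) ^ b"

definition query_state :: "nat \<Rightarrow> nat \<Rightarrow> nat \<Rightarrow> machine" where
  "query_state n u v =
     \<lparr>reg = (\<lambda>_. 0)(0 := n, 1 := u, 2 := v), scratch = (\<lambda>_. 0), reported = []\<rparr>"

definition answers_in :: "prog \<Rightarrow> nat \<Rightarrow> nat \<Rightarrow> nat list \<Rightarrow> nat \<Rightarrow> nat \<Rightarrow> nat list \<Rightarrow> nat \<Rightarrow> bool" where
  "answers_in p b n D u v P k \<longleftrightarrow>
     (\<exists>s. exec (word_bound b n) D p (query_state n u v) k s \<and> reported s = P)"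


section \<open>Interactive spanners\<close>

text \<open>
  The oracle consists of the stored words \<open>D\<close> and a query algorithm \<open>(p, b)\<close>; the latter is a
  parameter because it must not depend on the graph (otherwise storage could be hidden in it).
  The constant implicit in the query time is \<open>c\<close>. A pair of vertices in different components has no
  answer, so that nothing is required for it.
\<close>

definition interactive_spanner ::
  "prog \<Rightarrow> nat \<Rightarrow> real \<Rightarrow> nat \<Rightarrow> nat set set \<Rightarrow> (nat set \<Rightarrow> real) \<Rightarrow> real \<Rightarrow> real \<Rightarrow>
   nat set set \<Rightarrow> nat list \<Rightarrow> bool" where
  "interactive_spanner p b c n E w \<alpha> q S D \<longleftrightarrow>
     S \<subseteq> E \<and> (\<forall>x\<in>set D. x < word_bound b n) \<and>
     (\<forall>u<n. \<forall>v<n. (\<exists>P. is_path E u v P) \<longrightarrow>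
        (\<exists>P k. answers_in p b n D u v P k \<and> is_path S u v P \<and>
           graph_dist E w u v \<le> path_weight w P \<and>
           path_weight w P \<le> \<alpha> * graph_dist E w u v \<and>
           real k \<le> c * (q + real (length (path_edges P)))))"

definition spanner_size :: "nat set set \<Rightarrow> nat list \<Rightarrow> nat" where
  "spanner_size S D = max (card S) (length D)"

end

theory Submission imports Defs begin

text \<open>
  Every component with at least \<open>t\<close> vertices is partitioned into clusters of at least \<open>t\<close> vertices and
  hop radius \<open>O(t)\<close>, spanned by rooted trees: as long as some cluster with fewer than \<open>t\<close> vertices has
  its lightest exit edge into another such cluster, the two are joined by that edge; in the end each
  remaining small cluster is hung onto the large cluster that its lightest exit edge leads to. This
  keeps two properties. The tree path between two vertices of a cluster uses no edge heavier than
  the bottleneck between them in \<open>G\<close>, and the tree path from a vertex to the root of its cluster uses no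
  edge heavier than any edge by which the vertex leaves the cluster. Hence tree detours inside the
  clusters along a path of total weight \<open>d\<close> cost \<open>O(t d)\<close>.

  The given spanner is applied to the quotient graph on \<open>\<lfloor>n / t\<rfloor>\<close> vertices. One word per vertex stores
  its parent, depth and cluster; a perfect hash table of size linear in the given spanner maps each
  of its edges to an edge of \<open>G\<close>; the given data is appended unchanged. A query runs the given algorithm
  on the clusters of its two ends, buffers the answer, and expands it.
\<close>

section \<open>Perfect hashing\<close>

text \<open>The radius of a cluster is bounded in hops, not in weight, so a detour must be paid for
  by the edges of \<open>G\<close> through which the route enters and leaves the cluster. The two
  vertices concerned are unrelated, but each reaches the root by tree edges no heavier than its own
  crossing edge; the tree path between them has at most \<open>6 * t\<close> edges, none heavier
  than the sum of the two crossing weights. Each crossing is charged twice. Small parts are hung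
  directly on a core because a core can receive arbitrarily many of them: the tree grows in size,
  but its depth stays below \<open>3 * t\<close>.

  The storage bound has leading term exactly \<open>n\<close>, and \<open>h\<close> may be 0 for the
  empty quotient graph. No separate header word can be afforded, so the global parameters are
  repeated as digits in the word of every vertex, at the price of a larger constant in the word
  length. A route may cross many clusters, so no crossing may cost time of order \<open>t\<close> by
  itself: tree paths are walked from the deeper end, and edges are found in worst-case constant
  time.\<close>

definition hash :: "nat \<Rightarrow> nat \<Rightarrow> nat \<Rightarrow> nat \<Rightarrow> nat" where
  "hash m L a x = (a * x mod (m * L)) div L"

lemma hash_less: "0 < m \<Longrightarrow> 0 < L \<Longrightarrow> hash m L a x < m"
  unfolding hash_def by (simp add: less_mult_imp_div_less)

text \<open>The products \<open>a * d\<close> are spaced \<open>d\<close> apart and lie in an open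
  window of length \<open>2 * L\<close> around \<open>z\<close>.\<close>

lemma card_near_multiples:
  fixes d L z :: nat
  assumes "0 < d"
  shows "finite {a. z < a * d + L \<and> a * d < z + L}"
    and "card {a. z < a * d + L \<and> a * d < z + L} \<le> 2 * L div d + 1"
proof -
  let ?S = "{a. z < a * d + L \<and> a * d < z + L}"
  have "?S \<subseteq> {..z + L}"
  proof
    fix a assume "a \<in> ?S"
    moreover have "a \<le> a * d" using assms by simp
    ultimately show "a \<in> {..z + L}" unfolding mem_Collect_eq atMost_iff by linarith
  qed
  then show fin: "finite ?S" by (rule finite_subset) simp
  show "card ?S \<le> 2 * L div d + 1"
  proof (cases "?S = {}")
    case False
    define a0 where "a0 = Min ?S"
    have a0: "a0 \<in> ?S" unfolding a0_def by (rule Min_in[OF fin False])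
    have "?S \<subseteq> {a0..a0 + 2 * L div d}"
    proof
      fix a assume a: "a \<in> ?S"
      have le: "a0 \<le> a" unfolding a0_def by (rule Min_le[OF fin a])
      have "a * d - a0 * d \<le> 2 * L" using a a0 by simp linarith
      then have "(a - a0) * d \<le> 2 * L" by (simp add: diff_mult_distrib)
      then have "a - a0 \<le> 2 * L div d"
        using assms by (simp add: less_eq_div_iff_mult_less_eq)
      then show "a \<in> {a0..a0 + 2 * L div d}" using le by simp
    qed
    then have "card ?S \<le> card {a0..a0 + 2 * L div d}" by (intro card_mono) auto
    then show ?thesis by simp
  qed (metis card.empty le0)
qed

text \<open>
  The modulus need not be prime: if \<open>a\<close> makes \<open>x\<close> and \<open>y\<close> collide, then \<open>a * (x - y)\<close> is within
  \<open>L\<close> of one of at most \<open>x - y + 1\<close> multiples of \<open>m * L\<close>.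
\<close>

lemma card_collisions_le:
  assumes "y < x" "x < L" "0 < m"
  shows "card {a. a < m * L \<and> hash m L a x = hash m L a y} \<le> 6 * L"
proof -
  define d where "d = x - y"
  define p where "p = m * L"
  have d: "0 < d" "d \<le> L" "x = y + d" using assms by (auto simp: d_def)
  have p: "0 < p" using assms by (simp add: p_def)
  let ?T = "\<lambda>k. {a. k * p < a * d + L \<and> a * d < k * p + L}"
  have "{a. a < m * L \<and> hash m L a x = hash m L a y} \<subseteq> (\<Union>k\<le>d. ?T k)"
  proof
    fix a assume a: "a \<in> {a. a < m * L \<and> hash m L a x = hash m L a y}"
    define u v where "u = a * x" and "v = a * y"
    have eq: "(u mod p) div L = (v mod p) div L"
      using a by (simp add: hash_def p_def u_def v_def)
    have L: "0 < L" using assms by simp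
    have n1: "u mod p < v mod p + L"
    proof -
      have "u mod p < (u mod p) div L * L + L" using L by (metis add.commute dividend_less_div_times)
      also have "\<dots> \<le> v mod p + L" unfolding eq by simp
      finally show ?thesis .
    qed
    have n2: "v mod p < u mod p + L"
    proof -
      have "v mod p < (v mod p) div L * L + L" using L by (metis add.commute dividend_less_div_times)
      also have "\<dots> \<le> u mod p + L" unfolding eq[symmetric] by simp
      finally show ?thesis .
    qed
    define i j where "i = u div p" and "j = v div p"
    have u: "u = i * p + u mod p" and v: "v = j * p + v mod p" by (simp_all add: i_def j_def)
    have uv: "u = v + a * d" using d by (simp add: u_def v_def algebra_simps)
    have ji: "j \<le> i" unfolding i_def j_def uv by (intro div_le_mono) simp
    have id: "i \<le> j + d"
    proof -
      have "a * d \<le> p * d" using a by (simp add: p_def)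
      then have "u \<le> v + d * p" by (simp add: uv mult.commute)
      then have "i \<le> (v + d * p) div p" unfolding i_def by (rule div_le_mono)
      also have "\<dots> = j + d" using p by (simp add: j_def)
      finally show ?thesis .
    qed
    \<comment> \<open>The multiple of \<open>p\<close> near \<open>a * d\<close> is given by the
      difference of the two quotients, because residues in the same block of length \<open>L\<close>
      differ by less than \<open>L\<close>.\<close>
    define k where "k = i - j"
    have "i * p = j * p + k * p" using ji by (simp add: k_def diff_mult_distrib)
    then have "a * d + v mod p = k * p + u mod p" using u v uv by linarith
    then have "k * p < a * d + L" "a * d < k * p + L" using n1 n2 by linarith+
    moreover have "k \<le> d" using id by (simp add: k_def)
    ultimately show "a \<in> (\<Union>k\<le>d. ?T k)" by auto
  qed
  then have "card {a. a < m * L \<and> hash m L a x = hash m L a y} \<le> card (\<Union>k\<le>d. ?T k)"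
    by (intro card_mono) (auto intro: card_near_multiples(1)[OF d(1)])
  also have "\<dots> \<le> (\<Sum>k\<le>d. card (?T k))" by (rule card_UN_le) simp
  also have "\<dots> \<le> (\<Sum>k\<le>d. 2 * L div d + 1)"
    by (intro sum_mono card_near_multiples(2)[OF d(1)])
  also have "\<dots> = (d + 1) * (2 * L div d + 1)" by simp
  \<comment> \<open>From \<open>1 \<le> d\<close> and \<open>d \<le> L\<close>, the product is at
    most \<open>4 * L + 2 * L\<close>; this is the origin of the factor 6 in all later bounds on
    collisions and table sizes.\<close>
  also have "\<dots> \<le> (2 * d) * (2 * L div d + 1)" using d by (intro mult_right_mono) auto
  also have "\<dots> = 2 * (2 * L div d * d) + 2 * d" by (simp add: algebra_simps)
  also have "\<dots> \<le> 2 * (2 * L) + 2 * L"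
    using d by (intro add_mono mult_left_mono) (auto simp: div_times_less_eq_dividend)
  finally show ?thesis by simp
qed

text \<open>Averaging over the multipliers: each ordered pair of distinct keys collides under at
  most \<open>6 * L\<close> of the \<open>m * L\<close> values of \<open>a\<close>, so some
  \<open>a\<close> has at most \<open>6 / m\<close> collisions per pair.\<close>

lemma few_collisions:
  assumes "finite X" "X \<subseteq> {..<L}" "0 < m" "0 < L"
  shows "\<exists>a<m * L. m * card {(x, y). x \<in> X \<and> y \<in> X \<and> x \<noteq> y \<and> hash m L a x = hash m L a y}
           \<le> 6 * (card X * (card X - 1))"
proof (rule ccontr)
  let ?C = "\<lambda>a. {(x, y). x \<in> X \<and> y \<in> X \<and> x \<noteq> y \<and> hash m L a x = hash m L a y}"
  let ?Q = "{(x, y). x \<in> X \<and> y \<in> X \<and> x \<noteq> y}"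
  let ?B = "6 * (card X * (card X - 1))"
  let ?p = "m * L"
  assume "\<not> ?thesis"
  then have gt: "?B < m * card (?C a)" if "a < ?p" for a using that by (meson not_le)
  have finQ: "finite ?Q" by (rule finite_subset[of _ "X \<times> X"]) (use assms in auto)
  have cardQ: "card ?Q = card X * (card X - 1)"
  proof -
    have "?Q = (SIGMA x:X. X - {x})" by auto
    then show ?thesis using assms(1) by simp
  qed
  have "(\<Sum>a<?p. card (?C a)) = (\<Sum>a<?p. \<Sum>q\<in>?Q. if hash m L a (fst q) = hash m L a (snd q) then 1 else 0)"
  proof (rule sum.cong[OF refl])
    fix a
    have "?C a = {q\<in>?Q. hash m L a (fst q) = hash m L a (snd q)}" by auto
    then show "card (?C a) = (\<Sum>q\<in>?Q. if hash m L a (fst q) = hash m L a (snd q) then 1 else 0)"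
      using finQ by (simp add: sum.If_cases Int_def)
  qed
  also have "\<dots> = (\<Sum>q\<in>?Q. \<Sum>a<?p. if hash m L a (fst q) = hash m L a (snd q) then 1 else 0)"
    by (rule sum.swap)
  also have "\<dots> = (\<Sum>q\<in>?Q. card {a. a < ?p \<and> hash m L a (fst q) = hash m L a (snd q)})"
    by (rule sum.cong) (auto simp: sum.If_cases Int_def)
  also have "\<dots> \<le> (\<Sum>q\<in>?Q. 6 * L)"
  proof (rule sum_mono)
    fix q assume "q \<in> ?Q"
    then obtain x y where q: "q = (x, y)" "x \<in> X" "y \<in> X" "x \<noteq> y" by auto
    then have "x < L" "y < L" using assms by auto
    then show "card {a. a < ?p \<and> hash m L a (fst q) = hash m L a (snd q)} \<le> 6 * L"
      using card_collisions_le[of x y L m] card_collisions_le[of y x L m] q assms(3)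
      by (cases "x < y") (auto simp: eq_commute)
  qed
  also have "\<dots> = ?B * L" by (simp add: cardQ)
  finally have "m * (\<Sum>a<?p. card (?C a)) \<le> m * (?B * L)" by simp
  moreover have "(\<Sum>a<?p. ?B) < (\<Sum>a<?p. m * card (?C a))"
    by (rule sum_strict_mono) (use assms gt in \<open>auto simp: lessThan_empty_iff\<close>)
  ultimately show False by (simp add: sum_distrib_left[symmetric] algebra_simps)
qed

text \<open>With \<open>6 * (card X)\<^sup>2\<close> cells the bound of
  \<open>few_collisions\<close> drops below one collision, so the multiplier found there has
  none.\<close>

lemma injective_hash:
  assumes "finite X" "X \<subseteq> {..<L}" "0 < L" "X \<noteq> {}"
  shows "\<exists>a<6 * (card X)\<^sup>2 * L. inj_on (hash (6 * (card X)\<^sup>2) L a) X"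
proof -
  let ?m = "6 * (card X)\<^sup>2"
  have k: "0 < card X" using assms by (simp add: card_gt_0_iff)
  then obtain a where a: "a < ?m * L"
    "?m * card {(x, y). x \<in> X \<and> y \<in> X \<and> x \<noteq> y \<and> hash ?m L a x = hash ?m L a y}
       \<le> 6 * (card X * (card X - 1))" (is "_ * card ?C \<le> _")
    using few_collisions[OF assms(1,2), of ?m] assms by auto
  have "6 * (card X * (card X - 1)) < ?m" using k by (simp add: power2_eq_square)
  then have "card ?C = 0" using a(2)
    by (metis (no_types, lifting) le_trans linorder_not_less mult_0_right mult_le_mono2 nat_mult_1_right less_one)
  moreover have "finite ?C" by (rule finite_subset[of _ "X \<times> X"]) (use assms in auto)
  ultimately have "?C = {}" by simp
  then show ?thesis using a(1) by (auto simp: inj_on_def)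
qed

text \<open>The two-level scheme of Fredman, Komlos and Szemeredi: \<open>k\<close> buckets, each
  with its own injective hash function into a table of six times the square of its size. The bounds
  on multipliers, ranges and offsets let each of these numbers fit into a digit later; they are not
  strict so that an empty \<open>X\<close> and empty buckets are covered.\<close>

lemma perfect_hash_table:
  fixes X :: "nat set" and val :: "nat \<Rightarrow> nat"
  assumes X': "finite X" "X \<subseteq> {..<L}" and k: "k = card X"
  shows "\<exists>a a2 m2 o2 tb. a \<le> k * L \<and> length tb \<le> 42 * k \<and> set tb \<subseteq> insert 0 (val ` X) \<and>
     (\<forall>g. a2 g \<le> 6 * k\<^sup>2 * L \<and> m2 g \<le> 6 * k\<^sup>2) \<and> (\<forall>g<k. o2 g \<le> 42 * k) \<and>
     (\<forall>x\<in>X. hash k L a x < k \<and> (let g = hash k L a x; j = o2 g + hash (m2 g) L (a2 g) x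
        in j < length tb \<and> tb ! j = val x))"
proof (cases "k = 0")
  case True
  then have "X = {}" using X' k by simp
  then show ?thesis using True
    by (intro exI[of _ 0] exI[of _ "\<lambda>_. 0"] exI[of _ "[]"]) auto
next
  case False
  then have k0: "0 < k" by simp
  have "X \<noteq> {}" using k0 k by auto
  then have X: "finite X" "X \<subseteq> {..<L}" "0 < L" using X' by auto
  obtain a where a: "a < k * L"
    "k * card {(x, y). x \<in> X \<and> y \<in> X \<and> x \<noteq> y \<and> hash k L a x = hash k L a y} \<le> 6 * (k * (k - 1))"
    (is "_ * card ?C \<le> _")
    using few_collisions[OF X(1,2) k0 X(3)] k by auto
  have "card ?C \<le> 6 * k"
  proof -
    have "6 * (k * (k - 1)) \<le> k * (6 * k)" by simp
    then have "k * card ?C \<le> k * (6 * k)" using a(2) by (rule le_trans[rotated])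
    then show ?thesis using k0 by simp
  qed
  define B where "B g = {x\<in>X. hash k L a x = g}" for g
  define m2 where "m2 g = 6 * (card (B g))\<^sup>2" for g
  have finB: "finite (B g)" for g using X by (simp add: B_def)
  have "\<exists>c. c \<le> m2 g * L \<and> inj_on (hash (m2 g) L c) (B g)" for g
  proof (cases "B g = {}")
    case False
    have "B g \<subseteq> {..<L}" using X by (auto simp: B_def)
    from injective_hash[OF finB this X(3) False] show ?thesis
      unfolding m2_def by (auto intro: less_imp_le)
  qed (simp add: m2_def)
  then obtain a2 where a2: "a2 g \<le> m2 g * L" "inj_on (hash (m2 g) L (a2 g)) (B g)" for g by metis
  define o2 where "o2 g = (\<Sum>i<g. m2 i)" for g
  have cB: "card (B g) \<le> k" for g unfolding k by (rule card_mono) (use X in \<open>auto simp: B_def\<close>)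
  then have m2_le: "m2 g \<le> 6 * k\<^sup>2" for g by (simp add: m2_def power_mono)
  have tot: "o2 k \<le> 42 * k"
  proof -
    \<comment> \<open>The squares of the bucket sizes count the ordered pairs in a common bucket:
      \<open>k\<close> diagonal ones and at most \<open>6 * k\<close> collisions. Six cells per pair
      give \<open>42 * k\<close>.\<close>
    have "(\<Sum>g<k. (card (B g))\<^sup>2) = card (SIGMA g:{..<k}. B g \<times> B g)"
      using finB by (subst card_SigmaI) (auto simp: card_cartesian_product power2_eq_square)
    also have "\<dots> = card ((\<lambda>(g, q). q) ` (SIGMA g:{..<k}. B g \<times> B g))"
      by (rule card_image[symmetric]) (auto simp: inj_on_def B_def)
    also have "\<dots> \<le> card (Id_on X \<union> ?C)"
    proof (rule card_mono)
      have "?C \<subseteq> X \<times> X" by auto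
      then show "finite (Id_on X \<union> ?C)" using X by (auto intro: finite_subset simp: Id_on_def)
    qed (auto simp: B_def Id_on_iff)
    also have "\<dots> \<le> card (Id_on X) + card ?C" by (rule card_Un_le)
    also have "card (Id_on X) = k"
    proof -
      have "Id_on X = (\<lambda>x. (x, x)) ` X" by auto
      then show ?thesis unfolding k by (simp add: card_image inj_on_def)
    qed
    finally have "(\<Sum>g<k. (card (B g))\<^sup>2) \<le> 7 * k" using \<open>card ?C \<le> 6 * k\<close> by linarith
    then show ?thesis by (simp add: o2_def m2_def sum_distrib_left[symmetric])
  qed
  have o2_step: "o2 g + m2 g \<le> o2 g'" if "g < g'" for g g'
  proof -
    have "o2 g + m2 g = o2 (Suc g)" by (simp add: o2_def)
    also have "\<dots> \<le> o2 g'" unfolding o2_def by (rule sum_mono2) (use that in auto)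
    finally show ?thesis .
  qed
  define g where "g x = hash k L a x" for x
  define pos where "pos x = o2 (g x) + hash (m2 (g x)) L (a2 (g x)) x" for x
  have h2: "hash (m2 (g x)) L (a2 (g x)) x < m2 (g x)" if "x \<in> X" for x
  proof (rule hash_less)
    have "x \<in> B (g x)" using that by (simp add: B_def g_def)
    then show "0 < m2 (g x)" using finB[of "g x"] by (auto simp: m2_def card_gt_0_iff)
  qed (use X in auto)
  have gk: "g x < k" for x unfolding g_def using hash_less k0 X(3) by blast
  have pos_less: "pos x < o2 k" if "x \<in> X" for x
    using h2[OF that] o2_step[OF gk[of x]] by (simp add: pos_def)
  have inj: "inj_on pos X"
  proof (rule inj_onI)
    fix x y assume xy: "x \<in> X" "y \<in> X" "pos x = pos y"
    have "g x = g y"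
    proof (rule ccontr)
      assume "g x \<noteq> g y"
      then consider "g x < g y" | "g y < g x" by linarith
      then show False
        using o2_step[of "g x" "g y"] o2_step[of "g y" "g x"] h2[OF xy(1)] h2[OF xy(2)] xy(3)
        by cases (auto simp: pos_def)
    qed
    then have "hash (m2 (g x)) L (a2 (g x)) x = hash (m2 (g x)) L (a2 (g x)) y"
      "x \<in> B (g x)" "y \<in> B (g x)"
      using xy by (auto simp: pos_def B_def g_def)
    then show "x = y" using a2(2)[of "g x"] by (auto dest: inj_onD)
  qed
  define tb where "tb = map (\<lambda>j. if j \<in> pos ` X then val (inv_into X pos j) else 0) [0..<o2 k]"
  have "a2 j \<le> 6 * k\<^sup>2 * L" for j using a2(1)[of j] m2_le[of j] by (meson le_trans mult_le_mono1)
  moreover have "o2 j \<le> 42 * k" if "j < k" for j using o2_step[OF that] tot by linarith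
  moreover have "set tb \<subseteq> insert 0 (val ` X)"
    by (auto simp: tb_def inv_into_into)
  moreover have "pos x < length tb \<and> tb ! pos x = val x" if "x \<in> X" for x
    using pos_less[OF that] that inj by (simp add: tb_def)
  moreover have "length tb \<le> 42 * k" using tot by (simp add: tb_def)
  ultimately show ?thesis
    using a(1) gk m2_le
    by (intro exI[of _ a] exI[of _ a2] exI[of _ m2] exI[of _ o2] exI[of _ tb])
       (auto simp: Let_def pos_def g_def)
qed

section \<open>Clustering\<close>

text \<open>Membership says that the bottleneck distance is at most \<open>l\<close>. One relation
  per threshold avoids choosing paths; gluing and reversing walks become properties of a reflexive
  transitive closure.\<close>

definition conn :: "nat set set \<Rightarrow> (nat set \<Rightarrow> real) \<Rightarrow> real \<Rightarrow> (nat \<times> nat) set" where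
  "conn E w l = {(x, y). {x, y} \<in> E \<and> w {x, y} \<le> l}\<^sup>*"

lemma conn_refl [simp]: "(x, x) \<in> conn E w l"
  by (simp add: conn_def)

lemma conn_sym: "(x, y) \<in> conn E w l \<Longrightarrow> (y, x) \<in> conn E w l"
proof -
  have "sym {(x, y). {x, y} \<in> E \<and> w {x, y} \<le> l}" by (rule symI) (simp add: insert_commute)
  then show "(x, y) \<in> conn E w l \<Longrightarrow> (y, x) \<in> conn E w l"
    unfolding conn_def by (rule symD[OF sym_rtrancl])
qed

lemma conn_trans: "(x, y) \<in> conn E w l \<Longrightarrow> (y, z) \<in> conn E w l \<Longrightarrow> (x, z) \<in> conn E w l"
  unfolding conn_def by (rule rtrancl_trans)

lemma conn_edge: "{x, y} \<in> E \<Longrightarrow> w {x, y} \<le> l \<Longrightarrow> (x, y) \<in> conn E w l"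
  unfolding conn_def by auto

lemma conn_mono: "(x, y) \<in> conn E w l \<Longrightarrow> E \<subseteq> F \<Longrightarrow> (x, y) \<in> conn F w l"
  unfolding conn_def by (erule rtrancl_mono[THEN subsetD, rotated]) auto

lemma conn_exit:
  assumes "(u, v) \<in> conn E w l" "u \<in> C" "v \<notin> C"
  obtains x z where "x \<in> C" "z \<notin> C" "(u, x) \<in> conn E w l" "{x, z} \<in> E" "w {x, z} \<le> l"
proof -
  have "\<exists>x z. x \<in> C \<and> z \<notin> C \<and> (u, x) \<in> conn E w l \<and> {x, z} \<in> E \<and> w {x, z} \<le> l"
    using assms(1)[unfolded conn_def] assms(2)
  proof (induction rule: converse_rtrancl_induct)
    case base
    then show ?case using assms(3) by simp
  next
    case (step y z)
    then have yz: "{y, z} \<in> E" "w {y, z} \<le> l" by auto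
    show ?case
    proof (cases "z \<in> C")
      case True
      then show ?thesis using step.IH conn_trans[OF conn_edge[where w = w, OF yz]] by metis
    next
      case False
      then show ?thesis using yz step.prems by (metis conn_refl)
    qed
  qed
  then show thesis using that by blast
qed

text \<open>The two properties kept by the clustering. The walk in \<open>E\<close> of the first
  clause may leave \<open>C\<close>, so bottlenecks are those of the whole graph; the second clause
  speaks of single exit edges and is extended to walks in \<open>bottleneck_leave\<close>.\<close>

definition bottleneck :: "nat set set \<Rightarrow> (nat set \<Rightarrow> real) \<Rightarrow> nat set set \<Rightarrow> nat set \<Rightarrow> nat \<Rightarrow> bool" where
  "bottleneck E w F C r \<longleftrightarrow>
     (\<forall>l u v. u \<in> C \<longrightarrow> v \<in> C \<longrightarrow> (u, v) \<in> conn E w l \<longrightarrow> (u, v) \<in> conn F w l) \<and>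
     (\<forall>x z. x \<in> C \<longrightarrow> z \<notin> C \<longrightarrow> {x, z} \<in> E \<longrightarrow> (x, r) \<in> conn F w (w {x, z}))"

lemma conn_weaken: "(x, y) \<in> conn E w l \<Longrightarrow> l \<le> l' \<Longrightarrow> (x, y) \<in> conn E w l'"
  unfolding conn_def by (erule rtrancl_mono[THEN subsetD, rotated]) auto

lemma bottleneck_inside:
  "bottleneck E w F C r \<Longrightarrow> u \<in> C \<Longrightarrow> v \<in> C \<Longrightarrow> (u, v) \<in> conn E w l \<Longrightarrow> (u, v) \<in> conn F w l"
  by (simp add: bottleneck_def)

lemma bottleneck_exit:
  "bottleneck E w F C r \<Longrightarrow> x \<in> C \<Longrightarrow> z \<notin> C \<Longrightarrow> {x, z} \<in> E \<Longrightarrow> w {x, z} \<le> l \<Longrightarrow> (x, r) \<in> conn F w l"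
  by (metis bottleneck_def conn_weaken)

lemma bottleneck_leave:
  assumes "bottleneck E w F C r" "(u, v) \<in> conn E w l" "u \<in> C" "v \<notin> C"
  shows "(u, r) \<in> conn F w l"
proof -
  obtain x z where "x \<in> C" "z \<notin> C" "(u, x) \<in> conn E w l" "{x, z} \<in> E" "w {x, z} \<le> l"
    using conn_exit[OF assms(2-)] by metis
  then show ?thesis
    using bottleneck_inside[OF assms(1,3)] bottleneck_exit[OF assms(1)] conn_trans by metis
qed

lemma bottleneck_mono: "bottleneck E w F C r \<Longrightarrow> F \<subseteq> F' \<Longrightarrow> bottleneck E w F' C r"
  unfolding bottleneck_def by (intro conjI allI impI; rule conn_mono) auto

definition lightest_exit :: "nat set set \<Rightarrow> (nat set \<Rightarrow> real) \<Rightarrow> nat set \<Rightarrow> nat \<Rightarrow> nat \<Rightarrow> bool" where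
  "lightest_exit E w A x y \<longleftrightarrow> x \<in> A \<and> y \<notin> A \<and> {x, y} \<in> E \<and>
     (\<forall>x' y'. x' \<in> A \<longrightarrow> y' \<notin> A \<longrightarrow> {x', y'} \<in> E \<longrightarrow> w {x, y} \<le> w {x', y'})"

lemma lightest_exit_le:
  assumes "lightest_exit E w A x y" "(u, v) \<in> conn E w l" "u \<in> A" "v \<notin> A"
  shows "w {x, y} \<le> l"
proof -
  obtain x' z where "x' \<in> A" "z \<notin> A" "{x', z} \<in> E" "w {x', z} \<le> l"
    using conn_exit[OF assms(2-)] by metis
  then show ?thesis using assms(1) unfolding lightest_exit_def by fastforce
qed

text \<open>
  A vertex that escapes from \<open>A\<close> through edges of weight at most \<open>l\<close> reaches the centre of \<open>B\<close>
  through such forest edges: the exit edge of \<open>A\<close> also leaves \<open>B\<close>.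
\<close>

lemma bottleneck_pass:
  assumes A: "bottleneck E w F A s" and B: "bottleneck E w F B r"
    and e: "lightest_exit E w A x y" and y: "y \<in> B" and disj: "A \<inter> B = {}"
    and F': "F \<subseteq> F'" "{x, y} \<in> F'"
    and u: "u \<in> A" "v \<notin> A" "(u, v) \<in> conn E w l"
  shows "(u, r) \<in> conn F' w l"
proof -
  have xy: "x \<in> A" "y \<notin> A" "{x, y} \<in> E" using e by (auto simp: lightest_exit_def)
  have le: "w {x, y} \<le> l" by (rule lightest_exit_le[OF e u(3,1,2)])
  have "(u, s) \<in> conn F' w l"
    by (rule conn_mono[OF bottleneck_leave[OF A u(3,1,2)] F'(1)])
  moreover have "(s, x) \<in> conn F' w l"
    by (rule conn_sym[OF conn_mono[OF bottleneck_exit[OF A xy le] F'(1)]])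
  moreover have "(x, y) \<in> conn F' w l" by (rule conn_edge[where w = w, OF F'(2) le])
  moreover have "(y, r) \<in> conn F' w l"
  proof (rule conn_mono[OF bottleneck_exit[OF B y] F'(1)])
    show "x \<notin> B" using xy disj by auto
  qed (use xy le in \<open>auto simp: insert_commute\<close>)
  ultimately show ?thesis by (metis conn_trans)
qed

text \<open>The centre of \<open>B\<close> serves the union. A vertex with a light walk out of
  \<open>A\<close> reaches it by \<open>bottleneck_pass\<close>; a vertex of \<open>B\<close> with a
  light walk to \<open>A\<close> leaves \<open>B\<close> and reaches it by the invariant of
  \<open>B\<close>. So two ends on different sides meet at \<open>r\<close>.\<close>

lemma bottleneck_merge:
  assumes A: "bottleneck E w F A s" and B: "bottleneck E w F B r"
    and e: "lightest_exit E w A x y" and y: "y \<in> B" and disj: "A \<inter> B = {}"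
  shows "bottleneck E w (insert {x, y} F) (A \<union> B) r"
proof -
  let ?F = "insert {x, y} F"
  have sub: "F \<subseteq> ?F" by auto
  note pass = bottleneck_pass[OF A B e y disj sub insertI1]
  show ?thesis unfolding bottleneck_def
  proof (intro conjI allI impI)
    fix l u v assume uv: "u \<in> A \<union> B" "v \<in> A \<union> B" "(u, v) \<in> conn E w l"
    have *: "(a, b) \<in> conn ?F w l" if ab: "a \<in> A" "b \<in> B" "(a, b) \<in> conn E w l" for a b
    proof -
      have n: "a \<notin> B" "b \<notin> A" using ab disj by auto
      have "(b, r) \<in> conn ?F w l"
        using bottleneck_leave[OF B conn_sym[OF ab(3)] ab(2) n(1)] conn_mono sub by metis
      then show ?thesis using pass[OF ab(1) n(2) ab(3)] conn_sym conn_trans by metis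
    qed
    consider "u \<in> A" "v \<in> A" | "u \<in> B" "v \<in> B" | "u \<in> A" "v \<in> B" | "u \<in> B" "v \<in> A" using uv by auto
    then show "(u, v) \<in> conn ?F w l"
    proof cases
      case 1 then show ?thesis using bottleneck_inside[OF A _ _ uv(3)] conn_mono sub by metis
    next
      case 2 then show ?thesis using bottleneck_inside[OF B _ _ uv(3)] conn_mono sub by metis
    next
      case 3 then show ?thesis using * uv(3) by simp
    next
      case 4 then show ?thesis using * uv(3) conn_sym by metis
    qed
  next
    fix u z assume uz: "u \<in> A \<union> B" "z \<notin> A \<union> B" "{u, z} \<in> E"
    show "(u, r) \<in> conn ?F w (w {u, z})"
    proof (cases "u \<in> A")
      case True
      show ?thesis by (rule pass[OF True _ conn_edge]) (use uz in auto)
    next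
      case False
      then show ?thesis
        by (intro conn_mono[OF bottleneck_exit[OF B _ _ uz(3)] sub]) (use uz in auto)
    qed
  qed
qed

section \<open>Rooted spanning trees of the parts\<close>

definition rooted :: "nat set set \<Rightarrow> nat set \<Rightarrow> nat \<Rightarrow> (nat \<Rightarrow> nat) \<Rightarrow> (nat \<Rightarrow> nat) \<Rightarrow> bool" where
  "rooted F C r par dep \<longleftrightarrow> r \<in> C \<and> dep r = 0 \<and> (\<forall>v\<in>C. dep v < card C) \<and>
     (\<forall>v\<in>C. v \<noteq> r \<longrightarrow> par v \<in> C \<and> {v, par v} \<in> F \<and> dep v = Suc (dep (par v))) \<and>
     (\<forall>e\<in>F. e \<subseteq> C \<longrightarrow> (\<exists>v\<in>C. v \<noteq> r \<and> e = {v, par v}))"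

text \<open>All roots are allowed because joining two parts re-roots one of them at its end of the
  new edge, and the final root is chosen only after all merging.\<close>

definition rootable :: "nat set set \<Rightarrow> nat set \<Rightarrow> bool" where
  "rootable F C \<longleftrightarrow> (\<forall>r\<in>C. \<exists>par dep. rooted F C r par dep)"

text \<open>\<open>B\<close> hangs below \<open>x\<close>, so its depths grow by
  \<open>da x + 1 \<le> card A\<close>, which is exactly the room that the larger cardinality
  gives.\<close>

lemma rooted_join:
  assumes A: "rooted F A r pa da" and B: "rooted F B y pb db"
    and x: "x \<in> A" and disj: "A \<inter> B = {}" and fin: "finite A" "finite B"
    and F: "\<And>e. e \<in> F \<Longrightarrow> e \<subseteq> A \<union> B \<Longrightarrow> e \<subseteq> A \<or> e \<subseteq> B"
  shows "rooted (insert {y, x} F) (A \<union> B) r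
     (\<lambda>v. if v \<in> A then pa v else if v = y then x else pb v)
     (\<lambda>v. if v \<in> A then da v else db v + Suc (da x))"
proof -
  have r: "r \<in> A" "y \<in> B" "da r = 0" "db y = 0" using A B by (auto simp: rooted_def)
  have c: "card (A \<union> B) = card A + card B" using fin disj by (rule card_Un_disjoint)
  have da: "da v < card A" if "v \<in> A" for v using A that by (auto simp: rooted_def)
  have db: "db v < card B" if "v \<in> B" for v using B that by (auto simp: rooted_def)
  have pa: "pa v \<in> A \<and> {v, pa v} \<in> F \<and> da v = Suc (da (pa v))" if "v \<in> A" "v \<noteq> r" for v
    using A that by (auto simp: rooted_def)
  have pb: "pb v \<in> B \<and> {v, pb v} \<in> F \<and> db v = Suc (db (pb v))" if "v \<in> B" "v \<noteq> y" for v
    using B that by (auto simp: rooted_def)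
  have nA: "v \<notin> A" if "v \<in> B" for v using that disj by auto
  show ?thesis unfolding rooted_def
  proof (intro conjI ballI impI)
    fix v assume v: "v \<in> A \<union> B"
    show "(if v \<in> A then da v else db v + Suc (da x)) < card (A \<union> B)"
      using v c da[of v] db[of v] da[OF x] by auto
  next
    fix e assume e: "e \<in> insert {y, x} F" "e \<subseteq> A \<union> B"
    show "\<exists>v\<in>A \<union> B. v \<noteq> r \<and> e = {v, if v \<in> A then pa v else if v = y then x else pb v}"
    proof (cases "e = {y, x}")
      case True
      then show ?thesis using r nA by (intro bexI[of _ y]) auto
    next
      case False
      then consider "e \<in> F" "e \<subseteq> A" | "e \<in> F" "e \<subseteq> B" using e F by auto
      then show ?thesis
      proof cases
        case 1
        then obtain v where "v \<in> A" "v \<noteq> r" "e = {v, pa v}" using A by (auto simp: rooted_def)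
        then show ?thesis by (intro bexI[of _ v]) auto
      next
        case 2
        then obtain v where "v \<in> B" "v \<noteq> y" "e = {v, pb v}" using B by (auto simp: rooted_def)
        then show ?thesis using nA r by (intro bexI[of _ v]) auto
      qed
    qed
  qed (use r pa pb nA x in auto)
qed

lemma rootable_join:
  assumes "rootable F A" "rootable F B" "x \<in> A" "y \<in> B" "A \<inter> B = {}" "finite A" "finite B"
    and "\<And>e. e \<in> F \<Longrightarrow> e \<subseteq> A \<union> B \<Longrightarrow> e \<subseteq> A \<or> e \<subseteq> B"
  shows "rootable (insert {x, y} F) (A \<union> B)"
  unfolding rootable_def
proof
  fix r assume "r \<in> A \<union> B"
  then consider "r \<in> A" | "r \<in> B" by auto
  then show "\<exists>par dep. rooted (insert {x, y} F) (A \<union> B) r par dep"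
  proof cases
    case 1
    then obtain pa da pb db where "rooted F A r pa da" "rooted F B y pb db"
      using assms(1,2,4) unfolding rootable_def by metis
    from rooted_join[OF this assms(3,5-8)] show ?thesis by (metis insert_commute)
  next
    case 2
    then obtain pa da pb db where "rooted F A x pa da" "rooted F B r pb db"
      using assms(1-3) unfolding rootable_def by metis
    from rooted_join[OF this(2,1) assms(4)] assms show ?thesis by (metis Int_commute Un_commute)
  qed
qed

lemma rootable_insert:
  assumes "rootable F C" "\<not> e \<subseteq> C"
  shows "rootable (insert e F) C"
  unfolding rootable_def
proof
  fix r assume "r \<in> C"
  then obtain par dep where "rooted F C r par dep" using assms(1) unfolding rootable_def by metis
  then have "rooted (insert e F) C r par dep" using assms(2) unfolding rooted_def by auto
  then show "\<exists>par dep. rooted (insert e F) C r par dep" by blast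
qed

section \<open>Merging parts along lightest exit edges\<close>

definition clustered ::
  "nat \<Rightarrow> nat set set \<Rightarrow> (nat set \<Rightarrow> real) \<Rightarrow> real \<Rightarrow> nat set set \<Rightarrow> nat set set \<Rightarrow> bool" where
  "clustered n E w t F P \<longleftrightarrow> F \<subseteq> E \<and> \<Union> P = {..<n} \<and> {} \<notin> P \<and> pairwise disjnt P \<and>
     (\<forall>e\<in>F. \<exists>C\<in>P. e \<subseteq> C) \<and>
     (\<forall>C\<in>P. rootable F C \<and> (\<exists>r\<in>C. bottleneck E w F C r) \<and> real (card C) < 2 * t)"

lemma clustered_finite:
  assumes "clustered n E w t F P"
  shows "finite P" "C \<in> P \<Longrightarrow> finite C"
proof -
  have *: "C \<subseteq> {..<n}" if "C \<in> P" for C using assms that unfolding clustered_def by auto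
  then have "P \<subseteq> Pow {..<n}" by auto
  then show "finite P" by (rule finite_subset) simp
  show "C \<in> P \<Longrightarrow> finite C" using * finite_subset by blast
qed

lemma clustered_singletons:
  assumes g: "weighted_graph n E w" and t: "t \<ge> 1"
  shows "clustered n E w t {} ((\<lambda>v. {v}) ` {..<n})"
proof -
  have "rootable {} {v}" for v
    unfolding rootable_def rooted_def by (auto intro!: exI[of _ "\<lambda>_. 0"])
  moreover have "bottleneck E w {} {v} v" for v
    unfolding bottleneck_def by auto
  ultimately show ?thesis using t unfolding clustered_def pairwise_def disjnt_def by auto
qed

lemma clustered_merge:
  assumes c: "clustered n E w t F P" and AB: "A \<in> P" "B \<in> P"
    and e: "lightest_exit E w A x y" and y: "y \<in> B"
    and size: "real (card A) + real (card B) < 2 * t"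
  shows "\<exists>P'. clustered n E w t (insert {x, y} F) P' \<and> card P' < card P"
proof -
  let ?F = "insert {x, y} F" and ?P = "insert (A \<union> B) (P - {A, B})"
  have xy: "x \<in> A" "y \<notin> A" "{x, y} \<in> E" using e by (auto simp: lightest_exit_def)
  then have ne: "A \<noteq> B" using y by auto
  have pw: "C \<inter> D = {}" if "C \<in> P" "D \<in> P" "C \<noteq> D" for C D
    using c that unfolding clustered_def pairwise_def disjnt_def by auto
  have disj: "A \<inter> B = {}" using pw AB ne by simp
  have fin: "finite P" "finite A" "finite B" using clustered_finite[OF c] AB by auto
  have lift: "rootable F C" "\<exists>r\<in>C. bottleneck E w F C r" "real (card C) < 2 * t" if "C \<in> P" for C
    using c that unfolding clustered_def by auto
  have one: "e' \<subseteq> A \<or> e' \<subseteq> B" if e': "e' \<in> F" "e' \<subseteq> A \<union> B" for e'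
  proof -
    obtain C where C: "C \<in> P" "e' \<subseteq> C" using c e' unfolding clustered_def by auto
    then have "C = A \<or> C = B \<or> e' = {}" using pw[of C A] pw[of C B] AB e'(2) by blast
    then show ?thesis using C by auto
  qed
  have "clustered n E w t ?F ?P" unfolding clustered_def
  proof (intro conjI ballI)
    show "?F \<subseteq> E" using c xy by (auto simp: clustered_def)
    have U: "\<Union> P = {..<n}" "{} \<notin> P" using c unfolding clustered_def by auto
    have "\<Union> ?P = \<Union> P" using AB by blast
    then show "\<Union> ?P = {..<n}" using U by simp
    show "{} \<notin> ?P" using U(2) xy by auto
    show "pairwise disjnt ?P"
    proof (rule pairwiseI)
      fix C D assume CD: "C \<in> ?P" "D \<in> ?P" "C \<noteq> D"
      have "X \<inter> (A \<union> B) = {}" if "X \<in> P - {A, B}" for X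
        using pw[of X A] pw[of X B] AB that by auto
      then show "disjnt C D" unfolding disjnt_def
        using CD pw[of C D] by (cases "C = A \<union> B"; cases "D = A \<union> B") (auto simp: Int_commute)
    qed
  next
    fix e' assume "e' \<in> ?F"
    then consider "e' = {x, y}" | "e' \<in> F" by auto
    then show "\<exists>C\<in>?P. e' \<subseteq> C"
    proof cases
      case 2
      then obtain C where "C \<in> P" "e' \<subseteq> C" using c unfolding clustered_def by auto
      then show ?thesis by (cases "C = A \<or> C = B") auto
    qed (use xy y in auto)
  next
    fix C assume C: "C \<in> ?P"
    have "rootable ?F C \<and> (\<exists>r\<in>C. bottleneck E w ?F C r) \<and> real (card C) < 2 * t"
    proof (cases "C = A \<union> B")
      case True
      obtain s r where "bottleneck E w F A s" "r \<in> B" "bottleneck E w F B r" using lift AB by metis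
      moreover have "rootable ?F C" unfolding True
        by (rule rootable_join[OF lift(1)[OF AB(1)] lift(1)[OF AB(2)] xy(1) y disj fin(2,3) one])
      moreover have "real (card C) < 2 * t"
        unfolding True card_Un_disjoint[OF fin(2,3) disj] using size by simp
      ultimately show ?thesis using bottleneck_merge[OF _ _ e y disj] True by auto
    next
      case False
      then have CP: "C \<in> P" "C \<noteq> A" using C by auto
      then have "x \<notin> C" using pw[of C A] AB xy by auto
      then show ?thesis
        using lift[OF CP(1)] rootable_insert bottleneck_mono[OF _ subset_insertI] by (metis insert_subset)
    qed
    then show "rootable ?F C" "\<exists>r\<in>C. bottleneck E w ?F C r" "real (card C) < 2 * t" by auto
  qed
  moreover have "card ?P < card P"
  proof -
    have "card ?P \<le> Suc (card (P - {A, B}))" by (rule card_insert_le_m1) (auto simp: fin)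
    moreover have "card (P - {A, B}) = card P - 2" using AB ne fin by (simp add: card_Diff_subset)
    moreover have "2 \<le> card P" using card_mono[OF fin(1), of "{A, B}"] AB ne by simp
    ultimately show ?thesis by linarith
  qed
  ultimately show ?thesis by blast
qed

lemma weighted_graph_edge:
  assumes "weighted_graph n E w" "{x, y} \<in> E"
  shows "x < n \<and> y < n \<and> x \<noteq> y"
proof -
  have "{x, y} \<in> {{x, y} | x y. x < n \<and> y < n \<and> x \<noteq> y}"
    using assms unfolding weighted_graph_def by (auto simp only:)
  then show ?thesis by (auto simp: doubleton_eq_iff)
qed

lemma lightest_exit_exists:
  assumes g: "weighted_graph n E w" and "x \<in> A" "y \<notin> A" "{x, y} \<in> E"
  shows "\<exists>x y. lightest_exit E w A x y"
proof -
  let ?X = "{(x, y). x \<in> A \<and> y \<notin> A \<and> {x, y} \<in> E}"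
  have "?X \<subseteq> {..<n} \<times> {..<n}"
    using weighted_graph_edge[OF g] by auto
  then have fin: "finite ?X" by (rule finite_subset) simp
  have ne: "?X \<noteq> {}" using assms by auto
  define p where "p = arg_min_on (\<lambda>(x, y). w {x, y}) ?X"
  have "p \<in> ?X" unfolding p_def by (rule arg_min_if_finite(1)[OF fin ne])
  moreover have "(case p of (x, y) \<Rightarrow> w {x, y}) \<le> w {x', y'}" if "x' \<in> A" "y' \<notin> A" "{x', y'} \<in> E" for x' y'
    using arg_min_least[OF fin ne, of "(x', y')" "\<lambda>(x, y). w {x, y}"] that by (simp add: p_def)
  ultimately show ?thesis unfolding lightest_exit_def
    by (intro exI[of _ "fst p"] exI[of _ "snd p"]) (auto simp: case_prod_unfold)
qed

text \<open>A clustering with the fewest parts takes the place of a terminating loop. Two parts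
  below \<open>t\<close> together stay below \<open>2 * t\<close>, so a lightest exit edge between
  them would allow a merge and contradict minimality.\<close>

lemma clustered_maximal:
  assumes g: "weighted_graph n E w" and t: "t \<ge> 1"
  obtains F P where "clustered n E w t F P"
    "\<And>A B x y. A \<in> P \<Longrightarrow> B \<in> P \<Longrightarrow> lightest_exit E w A x y \<Longrightarrow> y \<in> B \<Longrightarrow>
       real (card A) < t \<Longrightarrow> t \<le> real (card B)"
proof -
  obtain q where q: "clustered n E w t (fst q) (snd q)"
    "\<And>q'. clustered n E w t (fst q') (snd q') \<Longrightarrow> card (snd q) \<le> card (snd q')"
    using ex_has_least_nat[of "\<lambda>q. clustered n E w t (fst q) (snd q)" "({}, (\<lambda>v. {v}) ` {..<n})"
        "\<lambda>q. card (snd q)"] clustered_singletons[OF assms] by auto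
  show thesis
  proof (rule that[OF q(1)], rule ccontr)
    fix A B x y assume *: "A \<in> snd q" "B \<in> snd q" "lightest_exit E w A x y" "y \<in> B"
      "real (card A) < t" "\<not> t \<le> real (card B)"
    then obtain P' where "clustered n E w t (insert {x, y} (fst q)) P'" "card P' < card (snd q)"
      using clustered_merge[OF q(1) *(1-4)] by auto
    then show False using q(2)[of "(insert {x, y} (fst q), P')"] by simp
  qed
qed

section \<open>The final clusters with labels, parents and depths\<close>

definition rooted_forest :: "nat \<Rightarrow> (nat \<Rightarrow> nat) \<Rightarrow> (nat \<Rightarrow> nat) \<Rightarrow> (nat \<Rightarrow> nat) \<Rightarrow> bool" where
  "rooted_forest n cl par dep \<longleftrightarrow>
     (\<forall>v<n. par v < n \<and> cl (par v) = cl v \<and> (dep v \<noteq> 0 \<longrightarrow> dep v = Suc (dep (par v)))) \<and>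
     (\<forall>u<n. \<forall>v<n. dep u = 0 \<longrightarrow> dep v = 0 \<longrightarrow> cl u = cl v \<longrightarrow> u = v)"

definition forest_edges :: "nat \<Rightarrow> (nat \<Rightarrow> nat) \<Rightarrow> (nat \<Rightarrow> nat) \<Rightarrow> nat set set" where
  "forest_edges n par dep = {{v, par v} | v. v < n \<and> dep v \<noteq> 0}"

lemma card_large_parts:
  assumes "finite P" "\<Union> P = {..<n}" "pairwise disjnt P" "t > 0"
  shows "card {C\<in>P. t \<le> real (card C)} \<le> nat \<lfloor>real n / t\<rfloor>"
proof -
  let ?B = "{C\<in>P. t \<le> real (card C)}"
  have "real (card ?B) * t = (\<Sum>C\<in>?B. t)" by simp
  also have "\<dots> \<le> (\<Sum>C\<in>?B. real (card C))" by (rule sum_mono) simp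
  also have "\<dots> \<le> (\<Sum>C\<in>P. real (card C))" by (rule sum_mono2) (use assms in auto)
  also have "\<dots> = real (\<Sum>C\<in>P. card C)" by simp
  also have "(\<Sum>C\<in>P. card C) = card (\<Union> P)"
  proof (rule card_Union_disjoint[symmetric])
    fix C assume "C \<in> P"
    then have "C \<subseteq> {..<n}" using assms by auto
    then show "finite C" by (rule finite_subset) simp
  qed (use assms in simp)
  finally have "real (card ?B) \<le> real n / t" using assms by (simp add: pos_le_divide_eq)
  then show ?thesis by (simp add: le_nat_floor)
qed

text \<open>
  Parts of size at least \<open>t\<close> are the cores of the clusters. A smaller part hangs off the core that
  its lightest exit edge leads to; if it has no exit edge, then it is a whole component.
\<close>

theorem clustering:
  assumes g: "weighted_graph n E w" and t: "t \<ge> 1"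
  obtains cl par dep where
    "rooted_forest n cl par dep"
    "forest_edges n par dep \<subseteq> E"
    "\<And>v. v < n \<Longrightarrow> real (dep v) \<le> 3 * t"
    "\<And>v. v < n \<Longrightarrow> cl v < 2 * n"
    "\<And>v z. v < n \<Longrightarrow> z < n \<Longrightarrow> {v, z} \<in> E \<Longrightarrow> cl z \<noteq> cl v \<Longrightarrow> cl v < nat \<lfloor>real n / t\<rfloor>"
    "\<And>l u v. u < n \<Longrightarrow> v < n \<Longrightarrow> (u, v) \<in> conn E w l \<Longrightarrow> cl u = cl v \<Longrightarrow>
       (u, v) \<in> conn (forest_edges n par dep) w l"
    "\<And>l u v. u < n \<Longrightarrow> v < n \<Longrightarrow> (u, v) \<in> conn E w l \<Longrightarrow> cl u \<noteq> cl v \<Longrightarrow>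
       \<exists>r<n. cl r = cl u \<and> dep r = 0 \<and> (u, r) \<in> conn (forest_edges n par dep) w l"
proof -
  obtain F P where c: "clustered n E w t F P" and max:
    "\<And>A B x y. A \<in> P \<Longrightarrow> B \<in> P \<Longrightarrow> lightest_exit E w A x y \<Longrightarrow> y \<in> B \<Longrightarrow>
       real (card A) < t \<Longrightarrow> t \<le> real (card B)"
    using clustered_maximal[OF g t] by metis
  have FE: "F \<subseteq> E" and U: "\<Union> P = {..<n}" and ne: "{} \<notin> P" and pw: "pairwise disjnt P"
    and FP: "\<And>e. e \<in> F \<Longrightarrow> \<exists>C\<in>P. e \<subseteq> C"
    and P: "\<And>C. C \<in> P \<Longrightarrow> rootable F C" "\<And>C. C \<in> P \<Longrightarrow> \<exists>r\<in>C. bottleneck E w F C r"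
      "\<And>C. C \<in> P \<Longrightarrow> real (card C) < 2 * t"
    using c unfolding clustered_def by auto
  have finP: "finite P" using clustered_finite[OF c] by simp
  define N where "N = nat \<lfloor>real n / t\<rfloor>"
  have eqP: "C = D" if "C \<in> P" "D \<in> P" "v \<in> C" "v \<in> D" for C D v
    using pw that unfolding pairwise_def disjnt_def by auto
  have subn: "v < n" if "C \<in> P" "v \<in> C" for C v using U that by auto
  have En: "x < n \<and> y < n" if "{x, y} \<in> E" for x y
    using weighted_graph_edge[OF g that] by simp

  define part where "part v = (THE C. C \<in> P \<and> v \<in> C)" for v
  have part_eq: "part v = C" if "C \<in> P" "v \<in> C" for C v
    unfolding part_def using that eqP by (intro the_equality) auto
  have part: "part v \<in> P" "v \<in> part v" if v: "v < n" for v
  proof -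
    obtain C where C: "C \<in> P" "v \<in> C" using U v by (metis UnionE lessThan_iff)
    then show "part v \<in> P" "v \<in> part v" using part_eq by auto
  qed

  obtain \<rho> where \<rho>: "\<And>C. C \<in> P \<Longrightarrow> \<rho> C \<in> C" "\<And>C. C \<in> P \<Longrightarrow> bottleneck E w F C (\<rho> C)"
    using P(2) by metis
  define big where "big C \<longleftrightarrow> t \<le> real (card C)" for C :: "nat set"
  define att where "att C \<longleftrightarrow> \<not> big C \<and> (\<exists>x y. lightest_exit E w C x y)" for C
  have "\<exists>x y. att C \<longrightarrow> lightest_exit E w C x y" for C unfolding att_def by auto
  then obtain X Y where XY: "\<And>C. att C \<Longrightarrow> lightest_exit E w C (X C) (Y C)" by metis
  have XY': "X C \<in> C" "Y C \<notin> C" "{X C, Y C} \<in> E" "Y C < n" if "att C" for C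
    using XY[OF that] En[of "X C" "Y C"] unfolding lightest_exit_def by auto
  define B where "B C = part (Y C)" for C
  have B: "B C \<in> P" "Y C \<in> B C" "big (B C)" "\<not> att (B C)" if "C \<in> P" "att C" for C
  proof -
    show *: "B C \<in> P" "Y C \<in> B C" using part XY'(4)[OF that(2)] unfolding B_def by auto
    show "big (B C)" using max[OF that(1) *(1) XY[OF that(2)] *(2)] that unfolding big_def att_def by auto
    then show "\<not> att (B C)" by (simp add: att_def)
  qed
  define core where "core C = (if att C then B C else C)" for C
  have core: "core C \<in> P" "\<not> att (core C)" "core (core C) = core C" if "C \<in> P" for C
    using B that unfolding core_def by auto
  \<comment> \<open>An attached part is rooted at its end of the exit edge and hangs below the other
    end; every other part is rooted at its centre, the vertex to which \<open>bottleneck\<close>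
    refers.\<close>
  define top where "top C = (if att C then X C else \<rho> C)" for C
  have top: "top C \<in> C" if "C \<in> P" for C unfolding top_def using XY' \<rho> that by auto
  have "\<exists>p d. rooted F C (top C) p d" if "C \<in> P" for C
    using P(1)[OF that] top[OF that] unfolding rootable_def by auto
  then obtain p d where pd: "\<And>C. C \<in> P \<Longrightarrow> rooted F C (top C) (p C) (d C)" by metis
  have d0: "d C (top C) = 0" if "C \<in> P" for C using pd[OF that] unfolding rooted_def by auto
  have dless: "d C v < card C" if "C \<in> P" "v \<in> C" for C v using pd[OF that(1)] that(2) unfolding rooted_def by auto
  have p: "p C v \<in> C" "{v, p C v} \<in> F" "d C v = Suc (d C (p C v))" if "C \<in> P" "v \<in> C" "v \<noteq> top C" for C v
    using pd[OF that(1)] that(2,3) unfolding rooted_def by auto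
  define par where "par v = (let C = part v in if v \<noteq> top C then p C v else if att C then Y C else v)" for v
  define dep where "dep v = (let C = part v in d C v + (if att C then Suc (d (B C) (Y C)) else 0))" for v
  define T where "T = forest_edges n par dep"

  have par_core: "par v < n \<and> core (part (par v)) = core (part v) \<and> (dep v \<noteq> 0 \<longrightarrow> dep v = Suc (dep (par v)))"
    if v: "v < n" for v
  proof -
    define C where "C = part v"
    have C: "C \<in> P" "v \<in> C" using part[OF v] by (auto simp: C_def)
    have par_v: "par v = (if v \<noteq> top C then p C v else if att C then Y C else v)"
      and dep_v: "dep v = d C v + (if att C then Suc (d (B C) (Y C)) else 0)"
      by (simp_all only: par_def dep_def Let_def C_def)
    have dC: "dep u = d C u + (if att C then Suc (d (B C) (Y C)) else 0)" if "part u = C" for u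
      by (simp only: dep_def Let_def that)
    consider "v \<noteq> top C" | "v = top C" "att C" | "v = top C" "\<not> att C" by auto
    then show ?thesis
    proof cases
      case 1
      then have "par v = p C v" unfolding par_v by simp
      moreover have "part (p C v) = C" using part_eq[OF C(1) p(1)[OF C 1]] .
      ultimately show ?thesis using subn[OF C(1) p(1)[OF C 1]] p(3)[OF C 1]
        by (simp add: dep_v dC C_def)
    next
      case 2
      then have pY: "par v = Y C" unfolding par_v by simp
      have "part (Y C) = B C" by (simp add: B_def)
      then have "dep (Y C) = d (B C) (Y C)" "core (part (Y C)) = B C"
        using B(4)[OF C(1) 2(2)] by (simp_all add: dep_def core_def)
      moreover have "dep v = Suc (d (B C) (Y C))" unfolding dep_v using 2 d0[OF C(1)] by simp
      moreover have "core (part v) = B C" using 2(2) by (simp add: core_def C_def)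
      ultimately show ?thesis using XY'(4)[OF 2(2)] pY by simp
    next
      case 3
      then have "par v = v" "dep v = 0" unfolding par_v dep_v using d0[OF C(1)] by simp_all
      then show ?thesis using v by simp
    qed
  qed
  have dep0: "v = \<rho> (core (part v))" if "v < n" "dep v = 0" for v
  proof -
    have C: "part v \<in> P" "v \<in> part v" using part that by auto
    have *: "\<not> att (part v)" "d (part v) v = 0" using that by (auto simp: dep_def Let_def split: if_splits)
    then have "v = top (part v)" using p(3)[OF C] by force
    then show ?thesis using * by (simp add: top_def core_def)
  qed
  have FT: "F \<subseteq> T"
  proof
    fix e assume e: "e \<in> F"
    then obtain C where C: "C \<in> P" "e \<subseteq> C" using FP by auto
    then obtain v where v: "v \<in> C" "v \<noteq> top C" "e = {v, p C v}"
      using pd[OF C(1)] e unfolding rooted_def by auto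
    have "part v = C" "v < n" using part_eq[OF C(1) v(1)] subn[OF C(1) v(1)] .
    then have "par v = p C v" "dep v \<noteq> 0" "v < n"
      using v p(3)[OF C(1) v(1,2)] by (simp_all add: par_def dep_def Let_def)
    then show "e \<in> T" unfolding T_def forest_edges_def using v by auto
  qed
  have XT: "{X C, Y C} \<in> T" if "C \<in> P" "att C" for C
  proof -
    have "X C \<in> C" "part (X C) = C" "X C < n"
      using XY' that part_eq subn by blast+
    then have "par (X C) = Y C" "dep (X C) \<noteq> 0" using that by (auto simp: par_def dep_def top_def)
    then show ?thesis unfolding T_def forest_edges_def using \<open>X C < n\<close> by force
  qed
  have TE: "T \<subseteq> E"
  proof
    fix e assume "e \<in> T"
    then obtain v where v: "v < n" "dep v \<noteq> 0" "e = {v, par v}" unfolding T_def forest_edges_def by auto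
    have C: "part v \<in> P" "v \<in> part v" using part v by auto
    show "e \<in> E"
    proof (cases "v = top (part v)")
      case True
      then have "att (part v)" using v d0[OF C(1)] by (auto simp: dep_def Let_def split: if_splits)
      then have "par v = Y (part v)" "X (part v) = v"
        using True by (simp_all add: par_def top_def Let_def)
      then show ?thesis using XY'(3)[OF \<open>att (part v)\<close>] v(3) by simp
    next
      case False
      then show ?thesis using p(2)[OF C False] FE v by (auto simp: par_def)
    qed
  qed
  \<comment> \<open>The way to the root runs through at most one attached part, with fewer than
    \<open>t\<close> vertices, and one core, with fewer than \<open>2 * t\<close>.\<close>
  have depth: "real (dep v) \<le> 3 * t" if v: "v < n" for v
  proof -
    define C where "C = part v"
    have C: "C \<in> P" "v \<in> C" using part[OF v] by (auto simp: C_def)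
    show ?thesis
    proof (cases "att C")
      case True
      have "dep v + 1 \<le> card C + card (B C)"
        using True dless[OF C] dless[OF B(1,2)[OF C(1) True]] by (simp add: dep_def C_def[symmetric])
      then have "real (dep v) + 1 \<le> real (card C) + real (card (B C))"
        by (metis of_nat_1 of_nat_add of_nat_le_iff)
      moreover have "real (card C) < t" using True by (simp add: att_def big_def)
      ultimately show ?thesis using P(3)[OF B(1)[OF C(1) True]] by simp
    next
      case False
      then have "dep v < card C" using dless[OF C] by (simp add: dep_def C_def[symmetric])
      then show ?thesis using P(3)[OF C(1)] t by simp
    qed
  qed
  have root_dep: "\<rho> (core (part v)) < n \<and> core (part (\<rho> (core (part v)))) = core (part v) \<and> dep (\<rho> (core (part v))) = 0"
    if "v < n" for v
  proof -
    define H where "H = core (part v)"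
    have H: "H \<in> P" "\<not> att H" "core H = H" using core part that by (auto simp: H_def)
    have "part (\<rho> H) = H" "\<rho> H < n" using part_eq \<rho>(1) H(1) subn by blast+
    moreover have "d H (\<rho> H) = 0" using d0[OF H(1)] H(2) by (simp add: top_def)
    ultimately show ?thesis using H by (simp add: H_def[symmetric] dep_def)
  qed
  have pass: "(u, \<rho> (core (part u))) \<in> conn T w l"
    if u: "u < n" "v < n" "(u, v) \<in> conn E w l" "part u \<noteq> part v" for u v l
  proof -
    define C where "C = part u"
    have C: "C \<in> P" "u \<in> C" using part[OF u(1)] by (auto simp: C_def)
    have v: "v \<notin> C" using part_eq[OF C(1)] u(4) by (auto simp: C_def)
    show ?thesis
    proof (cases "att C")
      case False
      then show ?thesis
        using conn_mono[OF bottleneck_leave[OF \<rho>(2)[OF C(1)] u(3) C(2) v] FT] by (simp add: core_def C_def)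
    next
      case True
      note B' = B[OF C(1) True]
      have "C \<noteq> B C" using B'(4) True by metis
      then have "C \<inter> B C = {}" using eqP[OF C(1) B'(1)] by blast
      from bottleneck_pass[OF \<rho>(2)[OF C(1)] \<rho>(2)[OF B'(1)] XY[OF True] B'(2) this FT XT[OF C(1) True] C(2) v u(3)]
      show ?thesis using True by (simp add: core_def C_def[symmetric])
    qed
  qed
  have inside: "(u, v) \<in> conn T w l"
    if uv: "u < n" "v < n" "(u, v) \<in> conn E w l" "core (part u) = core (part v)" for u v l
  proof (cases "part u = part v")
    case True
    then show ?thesis
      using bottleneck_inside[OF \<rho>(2)[OF part(1)[OF uv(1)]] part(2)[OF uv(1)] _ uv(3)] part(2)[OF uv(2)]
        conn_mono[OF _ FT] by auto
  next
    case False
    \<comment> \<open>For parts that share a core no invariant of their union is required: both ends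
      leave their own part and meet at the centre of the core.\<close>
    have "(u, \<rho> (core (part u))) \<in> conn T w l" by (rule pass[OF uv(1-3) False])
    moreover have "(v, \<rho> (core (part v))) \<in> conn T w l"
      by (rule pass[OF uv(2,1) conn_sym[OF uv(3)]]) (use False in auto)
    ultimately show ?thesis unfolding uv(4) by (rule conn_trans[OF _ conn_sym])
  qed

  obtain idx where idx: "bij_betw idx {C\<in>P. big C} {..<card {C\<in>P. big C}}"
    using ex_bij_betw_finite_nat[of "{C\<in>P. big C}"] finP by (auto simp: atLeast0LessThan)
  have NB: "card {C\<in>P. big C} \<le> N"
    unfolding big_def N_def by (rule card_large_parts[OF finP U pw]) (use t in simp)
  have Nn: "N \<le> n"
  proof -
    have "real n / t \<le> real n" using t by (simp add: divide_le_eq mult_le_cancel_left1)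
    then show ?thesis unfolding N_def by linarith
  qed
  \<comment> \<open>Labels below \<open>N\<close> are reserved for large cores, the cores of all
    clusters that an edge can leave. A component smaller than \<open>t\<close> is labelled from
    \<open>n\<close> upwards, which avoids clashes since \<open>N \<le> n\<close> and stays below
    \<open>2 * n\<close>.\<close>
  define lab where "lab C = (if big C then idx C else n + \<rho> C)" for C
  have lab_big: "lab C < N" if "C \<in> P" "big C" for C
  proof -
    have "idx C \<in> {..<card {C\<in>P. big C}}" using that bij_betw_apply[OF idx, of C] by simp
    then show ?thesis using NB that by (simp add: lab_def)
  qed
  have lab_inj: "C = D" if CD: "C \<in> P" "D \<in> P" "lab C = lab D" for C D
  proof (cases "big C \<and> big D")
    case True
    then show ?thesis using CD inj_onD[OF bij_betw_imp_inj_on[OF idx], of C D] by (simp add: lab_def)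
  next
    case False
    then have "\<not> big C \<and> \<not> big D"
      using lab_big[of C] lab_big[of D] CD Nn by (auto simp: lab_def)
    then have "\<rho> C = \<rho> D" using CD by (simp add: lab_def)
    then show ?thesis using eqP[OF CD(1,2) \<rho>(1)[OF CD(1)]] \<rho>(1)[OF CD(2)] by simp
  qed
  define cl where "cl v = lab (core (part v))" for v
  have cl_eq: "cl u = cl v \<longleftrightarrow> core (part u) = core (part v)" if "u < n" "v < n" for u v
    using lab_inj[OF core(1)[OF part(1)[OF that(1)]] core(1)[OF part(1)[OF that(2)]]] by (auto simp: cl_def)

  show thesis
  proof (rule that[of cl par dep])
    show "rooted_forest n cl par dep"
      unfolding rooted_forest_def
    proof (intro conjI allI impI)
      fix u v assume "u < n" "v < n" "dep u = 0" "dep v = 0" "cl u = cl v"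
      then show "u = v" using cl_eq dep0 by metis
    qed (use par_core in \<open>simp_all add: cl_def\<close>)
    show "forest_edges n par dep \<subseteq> E" using TE by (simp add: T_def)
    show "cl v < 2 * n" if "v < n" for v
    proof -
      have "core (part v) \<in> P" using core part that by auto
      then show ?thesis using lab_big[of "core (part v)"] Nn subn[OF _ \<rho>(1), of "core (part v)"]
        by (cases "big (core (part v))") (auto simp: cl_def lab_def)
    qed
    show "cl v < nat \<lfloor>real n / t\<rfloor>" if vz: "v < n" "z < n" "{v, z} \<in> E" "cl z \<noteq> cl v" for v z
    proof -
      \<comment> \<open>An edge out of the cluster is an exit edge of the part of \<open>v\<close>,
        so this part is large or attached to a large one.\<close>
      have "part z \<noteq> part v" using vz(4) by (auto simp: cl_def)
      then have "z \<notin> part v" using part_eq part vz by metis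
      then have "\<exists>x y. lightest_exit E w (part v) x y"
        using lightest_exit_exists[OF g part(2)[OF vz(1)] _ vz(3)] by simp
      then have "big (core (part v))"
        using B(3)[OF part(1)[OF vz(1)]] by (auto simp: core_def att_def)
      then show ?thesis
        using lab_big[OF core(1)[OF part(1)[OF vz(1)]]] by (simp add: cl_def N_def)
    qed
    show "\<exists>r<n. cl r = cl u \<and> dep r = 0 \<and> (u, r) \<in> conn (forest_edges n par dep) w l"
      if "u < n" "v < n" "(u, v) \<in> conn E w l" "cl u \<noteq> cl v" for u v l
    proof -
      have "part u \<noteq> part v" using that(4) by (auto simp: cl_def)
      then show ?thesis using pass[OF that(1-3)] root_dep[OF that(1)]
        by (intro exI[of _ "\<rho> (core (part u))"]) (simp add: cl_def T_def)
    qed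
  qed (use depth inside cl_eq in \<open>auto simp: T_def\<close>)
qed

section \<open>Paths through the clusters\<close>

lemma path_edges_simps [simp]:
  "path_edges [] = []" "path_edges [x] = []" "path_edges (x # y # P) = {x, y} # path_edges (y # P)"
  by (simp_all add: path_edges_def)

lemma length_path_edges [simp]: "length (path_edges P) = length P - 1"
  by (simp add: path_edges_def)

lemma path_edges_append:
  "P \<noteq> [] \<Longrightarrow> Q \<noteq> [] \<Longrightarrow> path_edges (P @ Q) = path_edges P @ {last P, hd Q} # path_edges Q"
proof (induction P rule: induct_list012)
  case (2 x)
  then show ?case by (cases Q) auto
qed auto

lemma path_edges_Cons: "Q \<noteq> [] \<Longrightarrow> path_edges (x # Q) = {x, hd Q} # path_edges Q"
  using path_edges_append[of "[x]" Q] by simp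

lemma path_edges_rev: "path_edges (rev P) = rev (path_edges P)"
proof (induction P rule: induct_list012)
  case (3 x y P)
  have "path_edges (rev (x # y # P)) = path_edges (rev (y # P) @ [x])" by simp
  also have "\<dots> = path_edges (rev (y # P)) @ [{y, x}]"
    by (subst path_edges_append) (auto simp: last_rev)
  finally show ?case using 3 by (simp add: insert_commute)
qed auto

lemma path_weight_append:
  "P \<noteq> [] \<Longrightarrow> Q \<noteq> [] \<Longrightarrow> path_weight w (P @ Q) = path_weight w P + w {last P, hd Q} + path_weight w Q"
  by (simp add: path_weight_def path_edges_append)

lemma path_weight_rev: "path_weight w (rev P) = path_weight w P"
  by (simp add: path_weight_def path_edges_rev rev_map[symmetric] sum_list_rev)

lemma is_path_rev: "is_path E u v P \<Longrightarrow> is_path E v u (rev P)"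
  unfolding is_path_def by (auto simp: path_edges_rev hd_rev last_rev)

lemma path_weight_nonneg: "\<forall>e\<in>E. 0 \<le> w e \<Longrightarrow> set (path_edges P) \<subseteq> E \<Longrightarrow> 0 \<le> path_weight w P"
  unfolding path_weight_def by (intro sum_list_nonneg) auto

lemma path_weight_le:
  assumes "\<forall>e\<in>set (path_edges P). w e \<le> l"
  shows "path_weight w P \<le> real (length P - 1) * l"
proof -
  have "sum_list (map w xs) \<le> real (length xs) * l" if "\<forall>e\<in>set xs. w e \<le> l" for xs
    using that by (induction xs) (auto simp: algebra_simps)
  from this[OF assms] show ?thesis by (simp add: path_weight_def)
qed

lemma path_conn:
  assumes "\<forall>e\<in>E. 0 \<le> w e" "set (path_edges P) \<subseteq> E" "P \<noteq> []"
  shows "(hd P, last P) \<in> conn E w (path_weight w P)"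
  using assms(2,3)
proof (induction P rule: induct_list012)
  case (3 x y P)
  have e: "{x, y} \<in> E" "set (path_edges (y # P)) \<subseteq> E" using 3(3) by auto
  have "path_weight w (x # y # P) = w {x, y} + path_weight w (y # P)" by (simp add: path_weight_def)
  moreover have "0 \<le> w {x, y}" "0 \<le> path_weight w (y # P)"
    using assms(1) e path_weight_nonneg by auto
  ultimately have le: "w {x, y} \<le> path_weight w (x # y # P)"
    "path_weight w (y # P) \<le> path_weight w (x # y # P)" by auto
  have "(y, last (y # P)) \<in> conn E w (path_weight w (x # y # P))"
    using conn_weaken[OF 3(2)[OF e(2)] le(2)] by simp
  then show ?case using conn_trans[OF conn_edge[where w = w, OF e(1) le(1)]] by simp
qed auto

lemma path_vertices:
  assumes "weighted_graph n E w" "set (path_edges P) \<subseteq> E" "hd P < n" "P \<noteq> []"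
  shows "set P \<subseteq> {..<n}"
  using assms(2-)
proof (induction P rule: induct_list012)
  case (3 x y P)
  then show ?case using weighted_graph_edge[OF assms(1), of x y] by auto
qed auto

lemma graph_dist_le:
  assumes g: "weighted_graph n E w" and P: "is_path E u v P"
  shows "graph_dist E w u v \<le> path_weight w P"
  unfolding graph_dist_def
proof (rule cINF_lower)
  show "bdd_below (path_weight w ` {P. is_path E u v P})"
    using g path_weight_nonneg[of E w] by (intro bdd_belowI[of _ 0]) (auto simp: is_path_def weighted_graph_def)
qed (use P in simp)

lemma graph_dist_attained:
  assumes g: "weighted_graph n E w" and P: "is_path E u v P" and u: "u < n"
  obtains Q where "is_path E u v Q" "path_weight w Q = graph_dist E w u v"
proof -
  let ?S = "{P. is_path E u v P}"
  have "?S \<subseteq> {xs. set xs \<subseteq> {..<n} \<and> distinct xs}"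
    using path_vertices[OF g] u by (auto simp: is_path_def)
  then have fin: "finite ?S" by (rule finite_subset) (simp add: finite_subset_distinct)
  then have "Inf (path_weight w ` ?S) \<in> path_weight w ` ?S"
    using P by (subst cInf_eq_Min) (auto intro!: Min_in)
  then show thesis using that unfolding graph_dist_def by auto
qed

text \<open>Follows the query loop \<open>ascend_body\<close> step for step: the deeper end moves
  up, and at equal depth the first one. The program can then be verified by induction on this
  relation, without lowest common ancestors.\<close>

inductive tree_path :: "(nat \<Rightarrow> nat) \<Rightarrow> (nat \<Rightarrow> nat) \<Rightarrow> nat \<Rightarrow> nat \<Rightarrow> nat list \<Rightarrow> bool"
  for par dep where
  meet: "tree_path par dep a a [a]"
| down: "dep a < dep b \<Longrightarrow> tree_path par dep a (par b) P \<Longrightarrow> tree_path par dep a b (P @ [b])"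
| up: "a \<noteq> b \<Longrightarrow> \<not> dep a < dep b \<Longrightarrow> tree_path par dep (par a) b P \<Longrightarrow> tree_path par dep a b (a # P)"

lemma rooted_forest_par:
  "rooted_forest n cl par dep \<Longrightarrow> v < n \<Longrightarrow> par v < n \<and> cl (par v) = cl v"
  "rooted_forest n cl par dep \<Longrightarrow> v < n \<Longrightarrow> dep v \<noteq> 0 \<Longrightarrow> dep v = Suc (dep (par v))"
  by (auto simp: rooted_forest_def)

lemma rooted_forest_root:
  "rooted_forest n cl par dep \<Longrightarrow> u < n \<Longrightarrow> v < n \<Longrightarrow> dep u = 0 \<Longrightarrow> dep v = 0 \<Longrightarrow> cl u = cl v \<Longrightarrow> u = v"
  by (auto simp: rooted_forest_def)

lemma tree_path_exists:
  assumes r: "rooted_forest n cl par dep"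
  shows "a < n \<Longrightarrow> b < n \<Longrightarrow> cl a = cl b \<Longrightarrow> \<exists>P. tree_path par dep a b P"
proof (induction "dep a + dep b" arbitrary: a b rule: less_induct)
  case less
  consider "a = b" | "dep a < dep b" | "a \<noteq> b" "\<not> dep a < dep b" by auto
  then show ?case
  proof cases
    case 1 then show ?thesis by (auto intro: tree_path.meet)
  next
    case 2
    then show ?thesis using less rooted_forest_par[OF r, of b] tree_path.down[where dep = dep, OF 2] by fastforce
  next
    case 3
    then have "dep a \<noteq> 0" using rooted_forest_root[OF r less(2,3)] less(4) by auto
    then show ?thesis using less rooted_forest_par[OF r, of a] tree_path.up[where dep = dep, OF 3] by fastforce
  qed
qed

text \<open>The last conjunct yields distinctness: every vertex of the path is one of the ends or
  less deep than one of them. The end that moves up is at least as deep as the other, so it cannot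
  recur on the rest of the path.\<close>

lemma tree_path_props:
  assumes r: "rooted_forest n cl par dep"
  shows "tree_path par dep a b P \<Longrightarrow> a < n \<Longrightarrow> b < n \<Longrightarrow> cl a = cl b \<Longrightarrow>
     P \<noteq> [] \<and> hd P = a \<and> last P = b \<and> distinct P \<and> length P \<le> dep a + dep b + 1 \<and>
     set (path_edges P) \<subseteq> forest_edges n par dep \<and>
     (\<forall>z\<in>set P. z < n \<and> cl z = cl a \<and> (z = a \<or> dep z < dep a \<or> z = b \<or> dep z < dep b))"
proof (induction rule: tree_path.induct)
  case (meet a)
  then show ?case by simp
next
  case (down a b P)
  have b: "par b < n" "cl (par b) = cl b" "dep b = Suc (dep (par b))"
    using rooted_forest_par[OF r down.prems(2)] down.hyps(1) by auto
  have "cl a = cl (par b)" using down.prems(3) b(2) by simp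
  note IH = down.IH[OF down.prems(1) b(1) this]
  have "{b, par b} \<in> forest_edges n par dep" unfolding forest_edges_def using down.prems(2) b(3) by auto
  moreover have "b \<notin> set P"
  proof
    assume "b \<in> set P"
    then have "b = a \<or> dep b < dep a \<or> b = par b \<or> dep b < dep (par b)" using IH by simp
    moreover have "b \<noteq> a" "b \<noteq> par b" using down.hyps(1) b(3) by (metis nat_neq_iff, metis n_not_Suc_n)
    ultimately show False using down.hyps(1) b(3) by linarith
  qed
  moreover have "set (path_edges (P @ [b])) = insert {b, par b} (set (path_edges P))"
    using IH by (simp add: path_edges_append insert_commute)
  moreover have "z = a \<or> dep z < dep a \<or> z = b \<or> dep z < dep b" if "z \<in> set (P @ [b])" for z
    using that IH b(3) by (metis Un_iff empty_iff empty_set less_Suc_eq set_ConsD set_append)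
  ultimately show ?case using IH down.prems b(3)
    by (intro conjI ballI) (auto simp del: b(3))
next
  case (up a b P)
  have "dep a \<noteq> 0" using rooted_forest_root[OF r up.prems(1,2)] up.prems(3) up.hyps by auto
  then have a: "par a < n" "cl (par a) = cl a" "dep a = Suc (dep (par a))"
    using rooted_forest_par[OF r up.prems(1)] by auto
  have "cl (par a) = cl b" using up.prems(3) a(2) by simp
  note IH = up.IH[OF a(1) up.prems(2) this]
  have "{a, par a} \<in> forest_edges n par dep" unfolding forest_edges_def using up.prems(1) a(3) by auto
  moreover have "a \<notin> set P"
  proof
    assume "a \<in> set P"
    then have "a = par a \<or> dep a < dep (par a) \<or> a = b \<or> dep a < dep b" using IH by simp
    moreover have "a \<noteq> par a" using a(3) by (metis n_not_Suc_n)
    ultimately show False using up.hyps(1,2) a(3) by linarith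
  qed
  moreover have "set (path_edges (a # P)) = insert {a, par a} (set (path_edges P))"
    using IH by (simp add: path_edges_Cons)
  moreover have "z = a \<or> dep z < dep a \<or> z = b \<or> dep z < dep b" if "z \<in> set (a # P)" for z
    using that IH a(3) by (metis less_Suc_eq set_ConsD)
  ultimately show ?case using IH up.prems a(2,3)
    by (intro conjI ballI) (auto simp del: a(3))
qed

text \<open>With \<open>k = dep v\<close> this is the topmost ancestor that \<open>v\<close> reaches
  by parent edges of weight at most \<open>l\<close>: a canonical representative of its component in
  the light part of the forest. Comparing representatives replaces uniqueness of paths in
  trees.\<close>

primrec climb :: "(nat set \<Rightarrow> real) \<Rightarrow> real \<Rightarrow> (nat \<Rightarrow> nat) \<Rightarrow> nat \<Rightarrow> nat \<Rightarrow> nat" where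
  "climb w l par 0 v = v"
| "climb w l par (Suc k) v = (if w {v, par v} \<le> l then climb w l par k (par v) else v)"

lemma climb_conn:
  assumes r: "rooted_forest n cl par dep"
    and "(u, v) \<in> conn (forest_edges n par dep) w l"
  shows "climb w l par (dep u) u = climb w l par (dep v) v"
  using assms(2) unfolding conn_def
proof (induction rule: rtrancl_induct)
  case (step y z)
  have *: "climb w l par (dep v) v = climb w l par (dep (par v)) (par v)"
    if "v < n" "dep v \<noteq> 0" "w {v, par v} \<le> l" for v
    using rooted_forest_par(2)[OF r that(1,2)] that(3) by simp
  from step(2) have yz: "{y, z} \<in> forest_edges n par dep" "w {y, z} \<le> l" by auto
  then obtain v where v: "{y, z} = {v, par v}" "v < n" "dep v \<noteq> 0"
    unfolding forest_edges_def by (elim CollectE exE conjE)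
  have "w {v, par v} \<le> l" using yz(2) unfolding v(1) .
  note * = *[OF v(2,3) this]
  from v(1) consider "y = v" "z = par v" | "y = par v" "z = v" unfolding doubleton_eq_iff by blast
  then show ?case using step(3) * by cases (simp_all only:)
qed simp

lemma climb_dep:
  assumes r: "rooted_forest n cl par dep"
  shows "v < n \<Longrightarrow> dep (climb w l par (dep v) v) < dep v \<or> climb w l par (dep v) v = v"
proof (induction "dep v" arbitrary: v)
  case (Suc k)
  have p: "par v < n" "dep v = Suc (dep (par v))" using rooted_forest_par[OF r Suc.prems] Suc(2) by auto
  then have "dep (climb w l par (dep (par v)) (par v)) < dep v"
    using Suc(1)[OF _ p(1)] Suc(2) by fastforce
  then show ?case using p(2) by simp
qed (metis climb.simps(1))

text \<open>If the parent edge of the end that moves up were heavier than \<open>l\<close>, this end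
  would be its own representative. The representative of the other end is that end itself or less
  deep, so the two could not agree.\<close>

lemma tree_path_light:
  assumes r: "rooted_forest n cl par dep"
  shows "tree_path par dep a b P \<Longrightarrow> a < n \<Longrightarrow> b < n \<Longrightarrow> cl a = cl b \<Longrightarrow>
     climb w l par (dep a) a = climb w l par (dep b) b \<Longrightarrow> \<forall>e\<in>set (path_edges P). w e \<le> l"
proof (induction rule: tree_path.induct)
  case (down a b P)
  have b: "par b < n" "cl (par b) = cl b" "dep b = Suc (dep (par b))"
    using rooted_forest_par[OF r down.prems(2)] down.hyps(1) by auto
  have l: "w {b, par b} \<le> l"
  proof (rule ccontr)
    assume "\<not> ?thesis"
    then have "climb w l par (dep b) b = b" using b(3) by simp
    then have "climb w l par (dep a) a = b" using down.prems(4) by simp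
    then show False using climb_dep[OF r down.prems(1), of w l] down.hyps(1) by auto
  qed
  then have "climb w l par (dep b) b = climb w l par (dep (par b)) (par b)" using b(3) by simp
  then have "\<forall>e\<in>set (path_edges P). w e \<le> l"
    using down.IH[OF down.prems(1) b(1)] down.prems(3,4) b(2) by simp
  moreover have "P \<noteq> []" "last P = par b"
    using tree_path_props[OF r down.hyps(2) down.prems(1) b(1)] down.prems(3) b(2) by simp_all
  ultimately show ?case using l by (auto simp: path_edges_append insert_commute)
next
  case (up a b P)
  have "dep a \<noteq> 0" using rooted_forest_root[OF r up.prems(1,2)] up.prems(3) up.hyps by auto
  then have a: "par a < n" "cl (par a) = cl a" "dep a = Suc (dep (par a))"
    using rooted_forest_par[OF r up.prems(1)] by auto
  have l: "w {a, par a} \<le> l"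
  proof (rule ccontr)
    assume "\<not> ?thesis"
    then have "climb w l par (dep a) a = a" using a(3) by simp
    then have "climb w l par (dep b) b = a" using up.prems(4) by simp
    then show False using climb_dep[OF r up.prems(2), of w l] up.hyps(1,2) by auto
  qed
  then have "climb w l par (dep a) a = climb w l par (dep (par a)) (par a)" using a(3) by simp
  then have "\<forall>e\<in>set (path_edges P). w e \<le> l"
    using up.IH[OF a(1) up.prems(2)] up.prems(3,4) a(2) by simp
  moreover have "P \<noteq> []" "hd P = par a"
    using tree_path_props[OF r up.hyps(3) a(1) up.prems(2)] up.prems(3) a(2) by simp_all
  ultimately show ?case using l by (auto simp: path_edges_Cons)
qed simp

lemma tree_path_weight:
  assumes r: "rooted_forest n cl par dep" and P: "tree_path par dep a b P"
    and ab: "a < n" "b < n" "cl a = cl b" and depth: "\<And>v. v < n \<Longrightarrow> real (dep v) \<le> D"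
    and c: "(a, b) \<in> conn (forest_edges n par dep) w l" and l: "0 \<le> l"
  shows "path_weight w P \<le> 2 * D * l"
proof -
  have "\<forall>e\<in>set (path_edges P). w e \<le> l" by (rule tree_path_light[OF r P ab climb_conn[OF r c]])
  then have "path_weight w P \<le> real (length P - 1) * l" by (rule path_weight_le)
  moreover have "length P - 1 \<le> dep a + dep b" using tree_path_props[OF r P ab] by auto
  then have "real (length P - 1) \<le> 2 * D" using depth[OF ab(1)] depth[OF ab(2)] by linarith
  ultimately show ?thesis using mult_right_mono[OF _ l] by fastforce
qed

section \<open>The quotient graph\<close>

definition quotient_edges :: "nat set set \<Rightarrow> (nat \<Rightarrow> nat) \<Rightarrow> nat set set" where
  "quotient_edges E cl = {{cl x, cl y} | x y. {x, y} \<in> E \<and> cl x \<noteq> cl y}"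

definition quotient_weight :: "nat set set \<Rightarrow> (nat set \<Rightarrow> real) \<Rightarrow> (nat \<Rightarrow> nat) \<Rightarrow> nat set \<Rightarrow> real" where
  "quotient_weight E w cl e = Min (w ` {f \<in> E. cl ` f = e})"

lemma weighted_graph_finite: "weighted_graph n E w \<Longrightarrow> finite E"
proof -
  assume "weighted_graph n E w"
  then have "E \<subseteq> Pow {..<n}" unfolding weighted_graph_def by fastforce
  then show "finite E" by (rule finite_subset) simp
qed

lemma quotient_weight_le:
  assumes "weighted_graph n E w" "{x, y} \<in> E"
  shows "quotient_weight E w cl {cl x, cl y} \<le> w {x, y}"
  unfolding quotient_weight_def using weighted_graph_finite[OF assms(1)] assms(2)
  by (intro Min_le) (auto intro!: imageI)

lemma quotient_weight_attained:
  assumes g: "weighted_graph n E w" and e: "{i, j} \<in> quotient_edges E cl"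
  shows "\<exists>x y. {x, y} \<in> E \<and> cl x = i \<and> cl y = j \<and> w {x, y} = quotient_weight E w cl {i, j}"
proof -
  let ?F = "{f \<in> E. cl ` f = {i, j}}"
  obtain x y where xy: "{x, y} \<in> E" "{i, j} = {cl x, cl y}" using e unfolding quotient_edges_def by auto
  then have "{x, y} \<in> ?F" by auto
  then have "quotient_weight E w cl {i, j} \<in> w ` ?F"
    unfolding quotient_weight_def using weighted_graph_finite[OF g] by (intro Min_in) auto
  then obtain f where f: "f \<in> E" "cl ` f = {i, j}" "w f = quotient_weight E w cl {i, j}" by auto
  then obtain a b where ab: "f = {a, b}" using g unfolding weighted_graph_def by blast
  then have "cl a = i \<and> cl b = j \<or> cl a = j \<and> cl b = i" using f(2) by (auto simp: doubleton_eq_iff)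
  then show ?thesis
  proof
    assume "cl a = j \<and> cl b = i"
    then show ?thesis using f ab by (intro exI[of _ b] exI[of _ a]) (simp add: insert_commute)
  qed (use f ab in auto)
qed

lemma quotient_graph:
  assumes g: "weighted_graph n E w"
    and N: "\<And>v z. {v, z} \<in> E \<Longrightarrow> cl z \<noteq> cl v \<Longrightarrow> cl v < N"
  shows "weighted_graph N (quotient_edges E cl) (quotient_weight E w cl)"
  unfolding weighted_graph_def
proof (intro conjI ballI subsetI)
  fix e assume e: "e \<in> quotient_edges E cl"
  then obtain x y where xy: "{x, y} \<in> E" "e = {cl x, cl y}" "cl x \<noteq> cl y"
    unfolding quotient_edges_def by auto
  have "cl x < N" by (rule N[OF xy(1)]) (use xy in auto)
  moreover have "cl y < N" by (rule N[of y x]) (use xy in \<open>auto simp: insert_commute\<close>)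
  ultimately show "e \<in> {{x, y} |x y. x < N \<and> y < N \<and> x \<noteq> y}" using xy by auto
  have "\<exists>x' y'. {x', y'} \<in> E \<and> cl x' = cl x \<and> cl y' = cl y \<and> w {x', y'} = quotient_weight E w cl e"
    using quotient_weight_attained[OF g, of "cl x" "cl y"] e xy by simp
  then show "0 \<le> quotient_weight E w cl e" using g unfolding weighted_graph_def by metis
qed

text \<open>The image of a path may revisit a cluster, while \<open>is_path\<close> demands distinct
  vertices. When the cluster put in front already occurs in \<open>Q\<close>, the part of
  \<open>Q\<close> before it is cut off, which only drops nonnegative weights. An edge inside a
  cluster is a case where nothing is lost.\<close>

lemma quotient_path:
  assumes g: "weighted_graph n E w"
    and N: "\<And>v z. {v, z} \<in> E \<Longrightarrow> cl z \<noteq> cl v \<Longrightarrow> cl v < N"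
  shows "P \<noteq> [] \<Longrightarrow> set (path_edges P) \<subseteq> E \<Longrightarrow>
     \<exists>Q. is_path (quotient_edges E cl) (cl (hd P)) (cl (last P)) Q \<and>
         path_weight (quotient_weight E w cl) Q \<le> path_weight w P"
proof (induction P rule: induct_list012)
  case (2 x)
  then show ?case by (intro exI[of _ "[cl x]"]) (auto simp: is_path_def path_weight_def)
next
  case (3 x y P)
  let ?w = "quotient_weight E w cl" and ?E = "quotient_edges E cl"
  have xy: "{x, y} \<in> E" using 3 by simp
  have w0: "0 \<le> w {x, y}" using g xy unfolding weighted_graph_def by auto
  obtain Q where Q: "is_path ?E (cl y) (cl (last (y # P))) Q" "path_weight ?w Q \<le> path_weight w (y # P)"
    using 3 by auto
  have pw: "path_weight w (x # y # P) = w {x, y} + path_weight w (y # P)" by (simp add: path_weight_def)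
  show ?case
  proof (cases "cl x \<in> set Q")
    case True
    then obtain Q1 Q2 where Q12: "Q = Q1 @ cl x # Q2" by (metis split_list)
    have sub: "set (path_edges (cl x # Q2)) \<subseteq> set (path_edges Q)"
      unfolding Q12 by (cases "Q1 = []") (auto simp: path_edges_append)
    have p: "is_path ?E (cl x) (cl (last (y # P))) (cl x # Q2)"
      using Q(1) sub unfolding is_path_def Q12 by auto
    have "path_weight ?w (cl x # Q2) \<le> path_weight ?w Q"
    proof (cases "Q1 = []")
      case False
      have pos: "\<forall>e\<in>?E. 0 \<le> ?w e" using quotient_graph[OF g N] unfolding weighted_graph_def by auto
      have "set (path_edges Q1) \<subseteq> ?E" "{last Q1, cl x} \<in> ?E"
        using Q(1) False unfolding is_path_def Q12 by (auto simp: path_edges_append)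
      then show ?thesis unfolding Q12 path_weight_append[OF False list.distinct(2)]
        using path_weight_nonneg[OF pos] pos by fastforce
    qed (simp add: Q12)
    then show ?thesis using p Q(2) pw w0 by (intro exI[of _ "cl x # Q2"]) auto
  next
    case False
    have Qne: "Q \<noteq> []" "hd Q = cl y" using Q(1) by (auto simp: is_path_def)
    then have "cl x \<noteq> cl y" using False hd_in_set by metis
    then have "{cl x, cl y} \<in> ?E" using xy unfolding quotient_edges_def by auto
    then have "is_path ?E (cl x) (cl (last (y # P))) (cl x # Q)"
      using Q(1) False Qne by (auto simp: is_path_def path_edges_Cons)
    moreover have "path_weight ?w (cl x # Q) = ?w {cl x, cl y} + path_weight ?w Q"
      using Qne by (simp add: path_weight_def path_edges_Cons)
    ultimately show ?thesis using Q(2) pw quotient_weight_le[OF g xy, of cl]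
      by (intro exI[of _ "cl x # Q"]) auto
  qed
qed simp

text \<open>\<open>X c d\<close> and \<open>Y c d\<close> stand for the ends in \<open>c\<close> and
  in \<open>d\<close> of the edge of \<open>G\<close> that realises the step from cluster
  \<open>c\<close> to cluster \<open>d\<close>. The rules follow the main loop of the query.\<close>

inductive cluster_route ::
  "(nat \<Rightarrow> nat) \<Rightarrow> (nat \<Rightarrow> nat) \<Rightarrow> (nat \<Rightarrow> nat \<Rightarrow> nat) \<Rightarrow> (nat \<Rightarrow> nat \<Rightarrow> nat) \<Rightarrow> nat \<Rightarrow> nat list \<Rightarrow> nat \<Rightarrow> nat list \<Rightarrow> bool"
  for par dep X Y v where
  last: "tree_path par dep a v P \<Longrightarrow> cluster_route par dep X Y v [c] a P"
| cross: "tree_path par dep a (X c d) P \<Longrightarrow> cluster_route par dep X Y v (d # cs) (Y c d) P' \<Longrightarrow>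
    cluster_route par dep X Y v (c # d # cs) a (P @ P')"

definition anchored ::
  "nat \<Rightarrow> (nat \<Rightarrow> nat) \<Rightarrow> (nat \<Rightarrow> nat) \<Rightarrow> (nat \<Rightarrow> nat) \<Rightarrow> (nat set \<Rightarrow> real) \<Rightarrow> real \<Rightarrow> nat \<Rightarrow> bool" where
  "anchored n cl par dep w l a \<longleftrightarrow>
     (\<exists>r<n. cl r = cl a \<and> dep r = 0 \<and> (a, r) \<in> conn (forest_edges n par dep) w l)"

text \<open>Both vertices reach the root, which is unique in a cluster. The sum \<open>l + m\<close>
  stands in place of the maximum so that the costs of detours add up along a route.\<close>

lemma anchored_conn:
  assumes r: "rooted_forest n cl par dep" and "cl a = cl b" "0 \<le> l" "0 \<le> m"
    and a: "anchored n cl par dep w l a" and b: "anchored n cl par dep w m b"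
  shows "(a, b) \<in> conn (forest_edges n par dep) w (l + m)"
proof -
  obtain s s' where s: "s < n" "cl s = cl a" "dep s = 0" "(a, s) \<in> conn (forest_edges n par dep) w l"
    and s': "s' < n" "cl s' = cl b" "dep s' = 0" "(b, s') \<in> conn (forest_edges n par dep) w m"
    using a b unfolding anchored_def by auto
  have "s = s'" using rooted_forest_root[OF r s(1) s'(1)] s s' assms(2) by simp
  moreover have "(a, s) \<in> conn (forest_edges n par dep) w (l + m)"
    "(b, s') \<in> conn (forest_edges n par dep) w (l + m)"
    using conn_weaken[OF s(4)] conn_weaken[OF s'(4)] assms by auto
  ultimately show ?thesis using conn_sym conn_trans by metis
qed

text \<open>A detour costs at most \<open>2 * D\<close> times the sum of the weights by which its
  two ends are anchored. The ends of the route contribute \<open>la\<close> and \<open>lv\<close>; a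
  crossing edge anchors the end of the detour before it and the start of the one after it, hence the
  factor 2 on the path weight. The clause on \<open>cl z\<close> makes the pieces disjoint; the one
  on lengths later charges the time of the given oracle to the new answer.\<close>

lemma cluster_route_exists:
  assumes g: "weighted_graph n E w" and r: "rooted_forest n cl par dep"
    and depth: "\<And>v. v < n \<Longrightarrow> real (dep v) \<le> D"
    and anc: "\<And>x y. {x, y} \<in> E \<Longrightarrow> cl x \<noteq> cl y \<Longrightarrow> anchored n cl par dep w (w {x, y}) x"
    and S: "S \<subseteq> quotient_edges E cl"
    and XY: "\<And>i j. {i, j} \<in> S \<Longrightarrow> {X i j, Y i j} \<in> E \<and> cl (X i j) = i \<and> cl (Y i j) = j \<and>
       w {X i j, Y i j} = quotient_weight E w cl {i, j}"
    and v: "v < n" "anchored n cl par dep w lv v" "0 \<le> lv"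
  shows "is_path S c (cl v) Q \<Longrightarrow> a < n \<Longrightarrow> cl a = c \<Longrightarrow> anchored n cl par dep w la a \<Longrightarrow> 0 \<le> la \<Longrightarrow>
     \<exists>P. cluster_route par dep X Y v Q a P \<and>
       is_path (forest_edges n par dep \<union> {{X i j, Y i j} | i j. {i, j} \<in> S}) a v P \<and>
       (\<forall>z\<in>set P. cl z \<in> set Q) \<and> length Q \<le> length P \<and>
       path_weight w P \<le> path_weight (quotient_weight E w cl) Q +
         2 * D * (la + lv + 2 * path_weight (quotient_weight E w cl) Q)"
proof (induction Q arbitrary: a c la)
  case Nil
  then show ?case by (simp add: is_path_def)
next
  case (Cons c' Q)
  let ?w = "quotient_weight E w cl"
  let ?S = "forest_edges n par dep \<union> {{X i j, Y i j} | i j. {i, j} \<in> S}"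
  have D: "0 \<le> D" using depth[OF v(1)] by linarith
  have c': "c' = c" using Cons.prems(1) by (simp add: is_path_def)
  show ?case
  proof (cases Q)
    case Nil
    then have clv: "cl a = cl v" using Cons.prems by (simp add: is_path_def)
    obtain P where P: "tree_path par dep a v P" using tree_path_exists[OF r Cons.prems(2) v(1) clv] ..
    note pr = tree_path_props[OF r P Cons.prems(2) v(1) clv]
    have "path_weight w P \<le> 2 * D * (la + lv)"
      by (rule tree_path_weight[OF r P Cons.prems(2) v(1) clv depth anchored_conn[OF r clv]])
        (use Cons.prems v in auto)
    moreover have "length (c' # Q) \<le> length P" unfolding Nil using pr by (simp add: Suc_le_eq)
    moreover have "is_path ?S a v P" using pr unfolding is_path_def by blast
    moreover have "\<forall>z\<in>set P. cl z \<in> set (c' # Q)" using pr Cons.prems(3) c' by simp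
    moreover have "path_weight ?w (c' # Q) = 0" by (simp add: Nil path_weight_def)
    moreover have "cluster_route par dep X Y v (c' # Q) a P"
      unfolding Nil by (rule cluster_route.last[OF P])
    ultimately show ?thesis by (intro exI[of _ P]) simp
  next
    case (Cons d cs)
    define x y where "x = X c d" and "y = Y c d"
    have cdS: "{c, d} \<in> S" and c_notin: "c \<notin> set Q" and pathQ: "is_path S d (cl v) Q"
      using Cons.prems(1) c' unfolding Cons is_path_def by auto
    have xy: "{x, y} \<in> E" "cl x = c" "cl y = d" "w {x, y} = ?w {c, d}"
      using XY[OF cdS] by (auto simp: x_def y_def)
    have n: "x < n" "y < n" using weighted_graph_edge[OF g xy(1)] by auto
    have cd: "c \<noteq> d" using c_notin Cons by auto
    have w0: "0 \<le> w {x, y}" using g xy(1) unfolding weighted_graph_def by auto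
    have ax: "anchored n cl par dep w (w {x, y}) x" using anc[OF xy(1)] xy cd by simp
    have ay: "anchored n cl par dep w (w {x, y}) y"
      using anc[of y x] xy cd by (simp add: insert_commute)
    obtain P' where P': "cluster_route par dep X Y v Q y P'" "is_path ?S y v P'"
      "\<forall>z\<in>set P'. cl z \<in> set Q" "length Q \<le> length P'"
      "path_weight w P' \<le> path_weight ?w Q + 2 * D * (w {x, y} + lv + 2 * path_weight ?w Q)"
      using Cons.IH[OF pathQ n(2) xy(3) ay w0] by auto
    have clx: "cl a = cl x" using Cons.prems xy by simp
    obtain P where P: "tree_path par dep a x P" using tree_path_exists[OF r Cons.prems(2) n(1) clx] ..
    note pr = tree_path_props[OF r P Cons.prems(2) n(1) clx]
    have wP: "path_weight w P \<le> 2 * D * (la + w {x, y})"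
      by (rule tree_path_weight[OF r P Cons.prems(2) n(1) clx depth anchored_conn[OF r clx]])
        (use Cons.prems ax w0 in auto)
    have P'ne: "P' \<noteq> []" "hd P' = y" using P'(2) by (auto simp: is_path_def)
    have route: "cluster_route par dep X Y v (c # Q) a (P @ P')"
      unfolding Cons by (rule cluster_route.cross) (use P P'(1) in \<open>auto simp: x_def y_def Cons\<close>)
    have "is_path ?S a v (P @ P')"
      unfolding is_path_def
    proof (intro conjI)
      have "z \<notin> set P'" if "z \<in> set P" for z
      proof -
        have "cl z = c" using pr that Cons.prems(3) by metis
        then show ?thesis using P'(3) c_notin by metis
      qed
      then show "distinct (P @ P')" using pr P'(2) unfolding is_path_def by (metis disjoint_iff distinct_append)
      have "{x, y} \<in> ?S" using cdS by (auto simp: x_def y_def)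
      then show "set (path_edges (P @ P')) \<subseteq> ?S"
        using pr P'(2) P'ne unfolding is_path_def by (simp add: path_edges_append) blast
    qed (use pr P'(2) in \<open>simp_all add: is_path_def\<close>)
    moreover have "\<forall>z\<in>set (P @ P'). cl z \<in> set (c # Q)" using pr P'(3) Cons.prems(3) by (simp add: ball_Un)
    moreover have "length (c # Q) \<le> length (P @ P')"
    proof -
      have "0 < length P" using pr by simp
      then show ?thesis using P'(4) unfolding length_append list.size by linarith
    qed
    moreover have "path_weight w (P @ P') \<le> path_weight ?w (c # Q) + 2 * D * (la + lv + 2 * path_weight ?w (c # Q))"
    proof -
      have "path_weight w (P @ P') = path_weight w P + w {x, y} + path_weight w P'"
        using pr P'ne by (subst path_weight_append) simp_all
      moreover have "path_weight ?w (c # Q) = w {x, y} + path_weight ?w Q"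
        unfolding Cons by (simp add: path_weight_def xy)
      ultimately show ?thesis using wP P'(5) by (simp add: algebra_simps)
    qed
    ultimately show ?thesis using route c' by blast
  qed
qed

section \<open>Programs\<close>

text \<open>The weakest-precondition form of \<open>exec\<close>, with the time as an argument of
  the postcondition: straight-line code is evaluated by \<open>simp\<close> with
  \<open>runs_simps\<close>.\<close>

definition runs ::
  "nat \<Rightarrow> nat list \<Rightarrow> prog \<Rightarrow> machine \<Rightarrow> (nat \<Rightarrow> machine \<Rightarrow> bool) \<Rightarrow> bool" where
  "runs W D p s Q \<longleftrightarrow> (\<exists>k s'. exec W D p s k s' \<and> Q k s')"

lemma runs_mono: "runs W D p s Q \<Longrightarrow> (\<And>k s'. Q k s' \<Longrightarrow> R k s') \<Longrightarrow> runs W D p s R"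
  unfolding runs_def by blast

inductive_cases exec_elims:
  "exec W D Skip s k s'" "exec W D (Const r a) s k s'" "exec W D (Arith f r i j) s k s'"
  "exec W D (Probe r i) s k s'" "exec W D (Load r i) s k s'" "exec W D (Store i j) s k s'"
  "exec W D (Emit i) s k s'" "exec W D (Seq p q) s k s'" "exec W D (If_Nonzero i p q) s k s'"

lemma runs_simps [simp]:
  "runs W D Skip s Q \<longleftrightarrow> Q 1 s"
  "runs W D (Const r a) s Q \<longleftrightarrow> a < W \<and> Q 1 (s\<lparr>reg := (reg s)(r := a)\<rparr>)"
  "runs W D (Arith f r i j) s Q \<longleftrightarrow> arith_val f (reg s i) (reg s j) < W \<and>
     Q 1 (s\<lparr>reg := (reg s)(r := arith_val f (reg s i) (reg s j))\<rparr>)"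
  "runs W D (Probe r i) s Q \<longleftrightarrow> reg s i < length D \<and> Q 1 (s\<lparr>reg := (reg s)(r := D ! reg s i)\<rparr>)"
  "runs W D (Load r i) s Q \<longleftrightarrow> Q 1 (s\<lparr>reg := (reg s)(r := scratch s (reg s i))\<rparr>)"
  "runs W D (Store i j) s Q \<longleftrightarrow> Q 1 (s\<lparr>scratch := (scratch s)(reg s i := reg s j)\<rparr>)"
  "runs W D (Emit i) s Q \<longleftrightarrow> Q 1 (s\<lparr>reported := reported s @ [reg s i]\<rparr>)"
  "runs W D (Seq p1 p2) s Q \<longleftrightarrow> runs W D p1 s (\<lambda>k s1. runs W D p2 s1 (\<lambda>k' s2. Q (k + k') s2))"
  "runs W D (If_Nonzero i p1 p2) s Q \<longleftrightarrow> runs W D (if reg s i \<noteq> 0 then p1 else p2) s (\<lambda>k. Q (1 + k))"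
  unfolding runs_def by (auto elim!: exec_elims) (blast intro: exec.intros[simplified])+

lemma runs_while_stop: "reg s i = 0 \<Longrightarrow> Q 1 s \<Longrightarrow> runs W D (While_Nonzero i p) s Q"
  unfolding runs_def by (blast intro: exec.intros)

lemma runs_while_step:
  "reg s i \<noteq> 0 \<Longrightarrow> runs W D p s (\<lambda>k s1. runs W D (While_Nonzero i p) s1 (\<lambda>k' s2. Q (1 + k + k') s2)) \<Longrightarrow>
     runs W D (While_Nonzero i p) s Q"
  unfolding runs_def by (blast intro: exec.intros)

abbreviation seq :: "prog \<Rightarrow> prog \<Rightarrow> prog" (infixr ";;" 60) where
  "p ;; q \<equiv> Seq p q"

text \<open>
  Registers are shifted by 30 and scratch addresses doubled. The vertices that the given algorithm
  reports go to the odd scratch addresses, used as a stack with pointer register 5. Register 4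
  holds 2, register 6 the position of the given algorithm's data, register 7 is auxiliary.
\<close>

primrec embed :: "prog \<Rightarrow> prog" where
  "embed Skip = Skip"
| "embed (Const r a) = Const (r + 30) a"
| "embed (Arith f r i j) = Arith f (r + 30) (i + 30) (j + 30)"
| "embed (Probe r i) = Arith Add 7 (i + 30) 6 ;; Probe (r + 30) 7"
| "embed (Load r i) = Arith Add 7 (i + 30) (i + 30) ;; Load (r + 30) 7"
| "embed (Store i j) = Arith Add 7 (i + 30) (i + 30) ;; Store 7 (j + 30)"
| "embed (Emit i) = Store 5 (i + 30) ;; Arith Add 5 5 4"
| "embed (Seq p q) = embed p ;; embed q"
| "embed (If_Nonzero i p q) = If_Nonzero (i + 30) (embed p) (embed q)"
| "embed (While_Nonzero i p) = While_Nonzero (i + 30) (embed p)"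

definition simulates :: "nat \<Rightarrow> machine \<Rightarrow> machine \<Rightarrow> bool" where
  "simulates off s m \<longleftrightarrow> (\<forall>r. reg m (r + 30) = reg s r) \<and> (\<forall>a. scratch m (2 * a) = scratch s a) \<and>
     (\<forall>i<length (reported s). scratch m (2 * i + 1) = reported s ! i) \<and>
     reg m 5 = 2 * length (reported s) + 1 \<and> reg m 4 = 2 \<and> reg m 6 = off"

text \<open>Keeps the doubled scratch addresses and shifted probe positions of the simulation within
  the word bound.\<close>

definition bounded_by :: "nat \<Rightarrow> machine \<Rightarrow> bool" where
  "bounded_by B s \<longleftrightarrow> (\<forall>r. reg s r < B) \<and> (\<forall>a. scratch s a < B)"

lemma exec_bounded:
  "exec W D p s k s' \<Longrightarrow> W \<le> B \<Longrightarrow> \<forall>x\<in>set D. x < B \<Longrightarrow> bounded_by B s \<Longrightarrow> bounded_by B s'"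
  by (induction rule: exec.induct) (auto simp: bounded_by_def)

lemma exec_reported: "exec W D p s k s' \<Longrightarrow> length (reported s) \<le> length (reported s')"
  by (induction rule: exec.induct) auto

text \<open>Every simulated instruction becomes at most two. \<open>B\<close> bounds all words of
  the simulated run, including its initial registers: \<open>2 * B\<close> pays for doubled
  addresses and \<open>off + B\<close> for shifted probes. The bound on the final output covers the
  stack pointer at all times, because output only grows.\<close>

lemma embed_exec:
  assumes "exec W' D' p s k s'"
    and "W' \<le> B" "2 * B \<le> W" "off + B \<le> W" "\<forall>x\<in>set D'. x < B"
    and "off + length D' \<le> length D" "\<And>i. i < length D' \<Longrightarrow> D ! (off + i) = D' ! i"
    and "simulates off s m" "bounded_by B s" "2 * length (reported s') + 1 < W"
  shows "runs W D (embed p) m (\<lambda>k2 m'. k2 \<le> 2 * k \<and> simulates off s' m' \<and>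
     reported m' = reported m \<and> (\<forall>r<30. r \<noteq> 5 \<and> r \<noteq> 7 \<longrightarrow> reg m' r = reg m r))"
  using assms(1,8-)
proof (induction arbitrary: m rule: exec.induct)
  case (skip s)
  then show ?case by simp
next
  case (const a r s)
  then show ?case using assms(2,3) by (auto simp: simulates_def)
next
  case (arith f s i j r)
  then show ?case using assms(2,3) by (auto simp: simulates_def)
next
  case (probe s i r)
  have "reg s i < B" using probe(3) by (simp add: bounded_by_def)
  then show ?case using probe assms(4,6,7) by (auto simp: simulates_def add.commute)
next
  case (load r i s)
  have "reg s i < B" using load(2) by (simp add: bounded_by_def)
  then show ?case using load assms(3) by (auto simp: simulates_def mult_2[symmetric])
next
  case (store i j s)
  have "reg s i < B" using store(2) by (simp add: bounded_by_def)
  moreover have "2 * x \<noteq> Suc (2 * y)" "Suc (2 * y) \<noteq> 2 * x" for x y :: nat by presburger+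
  ultimately show ?case using store assms(3) by (auto simp: simulates_def mult_2[symmetric])
next
  case (emit i s)
  have "2 * x \<noteq> Suc (2 * y)" "Suc (2 * y) \<noteq> 2 * x" for x y :: nat by presburger+
  then show ?case using emit
    by (auto simp: simulates_def nth_append less_Suc_eq)
next
  case (seq p1 s k1 s1 p2 k2 s2)
  have "2 * length (reported s1) + 1 < W" using exec_reported[OF seq(2)] seq.prems(3) by linarith
  from seq.IH(1)[OF seq.prems(1,2) this]
  show ?case unfolding embed.simps runs_simps
  proof (rule runs_mono, elim conjE)
    fix k m1 assume 1: "k \<le> 2 * k1" "simulates off s1 m1" "reported m1 = reported m"
      "\<forall>r<30. r \<noteq> 5 \<and> r \<noteq> 7 \<longrightarrow> reg m1 r = reg m r"
    have "bounded_by B s1" by (rule exec_bounded[OF seq(1) assms(2,5) seq.prems(2)])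
    from seq.IH(2)[OF 1(2) this seq.prems(3)]
    show "runs W D (embed p2) m1 (\<lambda>k' m'. k + k' \<le> 2 * (k1 + k2) \<and> simulates off s2 m' \<and>
      reported m' = reported m \<and> (\<forall>r<30. r \<noteq> 5 \<and> r \<noteq> 7 \<longrightarrow> reg m' r = reg m r))"
      by (rule runs_mono) (use 1 in auto)
  qed
next
  case (if_true s i p1 k s1 p2)
  have "reg m (i + 30) \<noteq> 0" using if_true by (simp add: simulates_def)
  then show ?case using if_true.IH[OF if_true.prems] by (auto elim: runs_mono)
next
  case (if_false s i p2 k s1 p1)
  have "reg m (i + 30) = 0" using if_false by (simp add: simulates_def)
  then show ?case using if_false.IH[OF if_false.prems] by (auto elim: runs_mono)
next
  case (while_stop s i p)
  then show ?case by (auto simp: simulates_def intro!: runs_while_stop)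
next
  case (while_step s i p k1 s1 k2 s2)
  have nz: "reg m (i + 30) \<noteq> 0" using while_step by (simp add: simulates_def)
  have "2 * length (reported s1) + 1 < W" using exec_reported[OF while_step(3)] while_step.prems(3) by linarith
  from while_step.IH(1)[OF while_step.prems(1,2) this]
  show ?case unfolding embed.simps
  proof (intro runs_while_step[OF nz], rule runs_mono, elim conjE)
    fix k m1 assume 1: "k \<le> 2 * k1" "simulates off s1 m1" "reported m1 = reported m"
      "\<forall>r<30. r \<noteq> 5 \<and> r \<noteq> 7 \<longrightarrow> reg m1 r = reg m r"
    have "bounded_by B s1" by (rule exec_bounded[OF while_step(2) assms(2,5) while_step.prems(2)])
    from while_step.IH(2)[OF 1(2) this while_step.prems(3)]
    show "runs W D (While_Nonzero (i + 30) (embed p)) m1 (\<lambda>k' m'. 1 + k + k' \<le> 2 * (1 + k1 + k2) \<and>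
      simulates off s2 m' \<and> reported m' = reported m \<and> (\<forall>r<30. r \<noteq> 5 \<and> r \<noteq> 7 \<longrightarrow> reg m' r = reg m r))"
      unfolding embed.simps[symmetric] by (rule runs_mono) (use 1 in auto)
  qed
qed

lemma runs_Seq:
  "runs W D p s R \<Longrightarrow> (\<And>k s1. R k s1 \<Longrightarrow> runs W D q s1 (\<lambda>k' s2. Q (k + k') s2)) \<Longrightarrow>
     runs W D (p ;; q) s Q"
  unfolding runs_simps by (rule runs_mono)

text \<open>
  A word packs several numbers below \<open>M\<close>, in base \<open>M\<close>. Register 3 holds \<open>M\<close> and register 19 holds 0.
\<close>

primrec unpack :: "nat \<Rightarrow> nat \<Rightarrow> nat \<Rightarrow> prog" where
  "unpack d s 0 = Arith Mod d s 3"
| "unpack d s (Suc j) = Arith Div d s 3 ;; unpack d d j"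

definition digit :: "nat \<Rightarrow> nat \<Rightarrow> nat \<Rightarrow> nat" where
  "digit M x j = (x div M ^ j) mod M"

lemma digit_Suc: "digit M x (Suc j) = digit M (x div M) j"
  by (simp add: digit_def div_mult2_eq)

lemma runs_unpack:
  "reg s 3 = M \<Longrightarrow> d \<noteq> 3 \<Longrightarrow> reg s i < W \<Longrightarrow>
     runs W D (unpack d i j) s Q \<longleftrightarrow> Q (Suc j) (s\<lparr>reg := (reg s)(d := digit M (reg s i) j)\<rparr>)"
proof (induction j arbitrary: s i Q)
  case 0
  have "reg s i mod M < W" using 0(3) mod_less_eq_dividend[of "reg s i" M] by (rule le_less_trans[rotated])
  then show ?case using 0(1) unfolding digit_def power_0 div_by_1 by (simp add: fun_upd_def)
next
  case (Suc j)
  define s1 where "s1 = s\<lparr>reg := (reg s)(d := reg s i div M)\<rparr>"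
  have lt: "reg s i div M < W" using Suc.prems(3) div_le_dividend[of "reg s i" M] by (rule le_less_trans[rotated])
  then have "runs W D (unpack d i (Suc j)) s Q \<longleftrightarrow> runs W D (unpack d d j) s1 (\<lambda>k. Q (1 + k))"
    unfolding s1_def using Suc.prems(1) by simp
  also have "\<dots> \<longleftrightarrow> Q (1 + Suc j) (s1\<lparr>reg := (reg s1)(d := digit M (reg s1 d) j)\<rparr>)"
    by (rule Suc.IH) (use Suc.prems lt in \<open>simp_all add: s1_def\<close>)
  also have "s1\<lparr>reg := (reg s1)(d := digit M (reg s1 d) j)\<rparr> =
      s\<lparr>reg := (reg s)(d := digit M (reg s i) (Suc j))\<rparr>"
    unfolding s1_def digit_Suc by simp
  finally show ?case by (simp add: fun_upd_def)
qed

definition fetch :: "nat \<Rightarrow> nat \<Rightarrow> nat \<Rightarrow> prog" where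
  "fetch d i j = Probe d i ;; unpack d d j"

lemma runs_fetch:
  "reg s 3 = M \<Longrightarrow> d \<noteq> 3 \<Longrightarrow> \<forall>x\<in>set D. x < W \<Longrightarrow> reg s i < length D \<Longrightarrow>
     runs W D (fetch d i j) s Q \<longleftrightarrow>
     Q (Suc (Suc j)) (s\<lparr>reg := (reg s)(d := digit M (D ! reg s i) j)\<rparr>)"
  by (simp add: fetch_def runs_unpack[where M = M])

definition differ :: "nat \<Rightarrow> nat \<Rightarrow> nat \<Rightarrow> prog" where
  "differ d i j = Arith Equal d i j ;; Arith Equal d d 19"

lemma runs_differ:
  "reg s 19 = 0 \<Longrightarrow> d \<noteq> 19 \<Longrightarrow> 1 < W \<Longrightarrow>
     runs W D (differ d i j) s Q \<longleftrightarrow> Q 2 (s\<lparr>reg := (reg s)(d := of_bool (reg s i \<noteq> reg s j))\<rparr>)"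
  by (auto simp: differ_def numeral_2_eq_2 of_bool_def)

text \<open>
  The tree path from register 12 to register 13: the ascending part is reported at once, the
  descending part goes through the stack. Whichever end is deeper moves up, so the time is
  proportional to the length of the path, not to the depth of the tree.
\<close>

definition ascend_body :: prog where
  "ascend_body = fetch 14 12 1 ;; fetch 15 13 1 ;; Arith Less 14 14 15 ;;
     If_Nonzero 14 (Store 5 13 ;; Arith Add 5 5 4 ;; fetch 13 13 0) (Emit 12 ;; fetch 12 12 0) ;;
     differ 11 12 13"

definition descend_body :: prog where
  "descend_body = Arith Sub 5 5 4 ;; Load 14 5 ;; Emit 14 ;; Arith Less 11 16 5"

text \<open>Register 16 remembers the stack level at entry, so that only vertices pushed here are
  popped and the clusters still to be visited stay untouched below.\<close>

definition tree_route :: prog where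
  "tree_route = (Arith Add 16 5 19 ;; differ 11 12 13) ;; While_Nonzero 11 ascend_body ;;
     (Emit 12 ;; Arith Less 11 16 5) ;; While_Nonzero 11 descend_body"

section \<open>Correctness and running time of tree routes\<close>

definition unchanged :: "nat set \<Rightarrow> machine \<Rightarrow> machine \<Rightarrow> bool" where
  "unchanged R s s' \<longleftrightarrow> (\<forall>r. r \<notin> R \<longrightarrow> reg s' r = reg s r)"

locale stored_forest =
  fixes W :: nat and D :: "nat list" and M n :: nat and cl par dep :: "nat \<Rightarrow> nat"
  assumes forest: "rooted_forest n cl par dep"
    and len: "n \<le> length D"
    and words: "\<forall>x\<in>set D. x < W"
    and M: "n < M" "M ^ 4 < W" "2 \<le> M"
    and digits: "v < n \<Longrightarrow> digit M (D ! v) 0 = par v" "v < n \<Longrightarrow> digit M (D ! v) 1 = dep v"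
      "v < n \<Longrightarrow> digit M (D ! v) 2 = cl v"
begin

lemma W: "1 < W" "M < W"
proof -
  have "M \<le> M ^ 4" using M(3) by (intro self_le_power) auto
  then show "M < W" using M(2) by linarith
  then show "1 < W" using M(3) by linarith
qed

lemma par_less: "v < n \<Longrightarrow> par v < n"
  using rooted_forest_par[OF forest] by blast

lemma dep_less: "v < n \<Longrightarrow> dep v < M"
  using digits(2)[of v] M(3) by (metis digit_def less_le_trans mod_less_divisor pos2)

lemma ascend_body_down:
  assumes "a < n" "b < n" "dep a < dep b" "reg s 12 = a" "reg s 13 = b"
    "reg s 3 = M" "reg s 4 = 2" "reg s 19 = 0" "reg s 5 + 2 < W"
  shows "runs W D ascend_body s (\<lambda>k s'. k \<le> 15 \<and> reg s' 12 = a \<and> reg s' 13 = par b \<and>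
     reg s' 11 = of_bool (a \<noteq> par b) \<and> reg s' 5 = reg s 5 + 2 \<and>
     scratch s' = (scratch s)(reg s 5 := b) \<and> reported s' = reported s \<and>
     unchanged {5, 11, 12, 13, 14, 15} s s')"
  using assms len words W digits
  by (simp add: ascend_body_def runs_fetch[where M = M] runs_differ unchanged_def)

lemma ascend_body_up:
  assumes "a < n" "b < n" "\<not> dep a < dep b" "reg s 12 = a" "reg s 13 = b"
    "reg s 3 = M" "reg s 4 = 2" "reg s 19 = 0"
  shows "runs W D ascend_body s (\<lambda>k s'. k \<le> 15 \<and> reg s' 12 = par a \<and> reg s' 13 = b \<and>
     reg s' 11 = of_bool (par a \<noteq> b) \<and> reg s' 5 = reg s 5 \<and>
     scratch s' = scratch s \<and> reported s' = reported s @ [a] \<and>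
     unchanged {5, 11, 12, 13, 14, 15} s s')"
  using assms len words W digits
  by (simp add: ascend_body_def runs_fetch[where M = M] runs_differ unchanged_def)

text \<open>\<open>U\<close> was reported on the way up, \<open>x\<close> is the vertex where the
  ends meet, and \<open>L\<close> lists the stack from its bottom, which is the descending part
  backwards.\<close>

definition ascended :: "nat list \<Rightarrow> machine \<Rightarrow> nat \<Rightarrow> machine \<Rightarrow> bool" where
  "ascended P s k s' \<longleftrightarrow> (\<exists>U L x. P = U @ x # rev L \<and> reported s' = reported s @ U \<and>
     reg s' 12 = x \<and> reg s' 5 = reg s 5 + 2 * length L \<and>
     (\<forall>i<length L. scratch s' (reg s 5 + 2 * i) = L ! i) \<and>
     (\<forall>a<reg s 5. scratch s' a = scratch s a) \<and>
     unchanged {5, 11, 12, 13, 14, 15} s s' \<and> k \<le> 20 * length P \<and> reg s' 5 < W)"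

text \<open>The stack cannot overflow: a push raises register 5 by 2 and lowers \<open>dep b\<close>
  by 1, so \<open>reg s 5 + 2 * dep b\<close> never grows.\<close>

lemma ascend_loop:
  "tree_path par dep a b P \<Longrightarrow> a < n \<Longrightarrow> b < n \<Longrightarrow> reg s 12 = a \<Longrightarrow> reg s 13 = b \<Longrightarrow>
   reg s 11 = of_bool (a \<noteq> b) \<Longrightarrow> reg s 3 = M \<Longrightarrow> reg s 4 = 2 \<Longrightarrow> reg s 19 = 0 \<Longrightarrow>
   reg s 5 + 2 * dep b < W \<Longrightarrow> runs W D (While_Nonzero 11 ascend_body) s (ascended P s)"
proof (induction arbitrary: s rule: tree_path.induct)
  case (meet a)
  show ?case
    by (rule runs_while_stop)
      (use meet in \<open>auto simp: ascended_def unchanged_def intro!: exI[of _ "[]"]\<close>)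
next
  case (down a b P)
  have par: "par b < n" "dep b = Suc (dep (par b))"
    using rooted_forest_par[OF forest down.prems(2)] down.hyps(1) by auto
  show ?case
  proof (rule runs_while_step)
    show "reg s 11 \<noteq> 0" using down.prems down.hyps(1) by auto
    have "reg s 5 + 2 < W" using down.prems(9) par(2) by simp
    from ascend_body_down[OF down.prems(1,2) down.hyps(1) down.prems(3,4,6-8) this]
    show "runs W D ascend_body s
      (\<lambda>k s1. runs W D (While_Nonzero 11 ascend_body) s1 (\<lambda>k'. ascended (P @ [b]) s (1 + k + k')))"
    proof (rule runs_mono, elim conjE)
      fix k :: nat and s1 :: machine assume s1: "k \<le> 15" "reg s1 12 = a" "reg s1 13 = par b" "reg s1 11 = of_bool (a \<noteq> par b)"
        "reg s1 5 = reg s 5 + 2" "scratch s1 = (scratch s)(reg s 5 := b)" "reported s1 = reported s"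
        "unchanged {5, 11, 12, 13, 14, 15} s s1"
      have "reg s1 3 = M" "reg s1 4 = 2" "reg s1 19 = 0" "reg s1 5 + 2 * dep (par b) < W"
        using s1(5,8) down.prems(6-9) par(2) by (auto simp: unchanged_def)
      from down.IH[OF down.prems(1) par(1) s1(2-4) this]
      show "runs W D (While_Nonzero 11 ascend_body) s1 (\<lambda>k'. ascended (P @ [b]) s (1 + k + k'))"
      proof (rule runs_mono)
        fix k' s' assume "ascended P s1 k' s'"
        then obtain U L x where ULx: "P = U @ x # rev L" "reported s' = reported s @ U"
          "reg s' 12 = x" "reg s' 5 = reg s 5 + 2 + 2 * length L"
          "\<And>i. i < length L \<Longrightarrow> scratch s' (reg s 5 + 2 + 2 * i) = L ! i"
          "\<And>a. a < reg s 5 + 2 \<Longrightarrow> scratch s' a = ((scratch s)(reg s 5 := b)) a"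
          "unchanged {5, 11, 12, 13, 14, 15} s1 s'" "k' \<le> 20 * length P" "reg s' 5 < W"
          unfolding ascended_def s1(5-7) by blast
        have "scratch s' (reg s 5 + 2 * i) = (b # L) ! i" if "i < length (b # L)" for i
          using that ULx(5)[of "i - 1"] ULx(6)[of "reg s 5"] by (cases i) auto
        moreover have "scratch s' a = scratch s a" if "a < reg s 5" for a using ULx(6)[of a] that by simp
        moreover have "unchanged {5, 11, 12, 13, 14, 15} s s'"
          using s1(8) ULx(7) by (simp add: unchanged_def)
        ultimately show "ascended (P @ [b]) s (1 + k + k') s'" using ULx(1-4,8,9) s1(1)
          unfolding ascended_def
          by (intro exI[of _ U] exI[of _ "b # L"] exI[of _ x]) simp
      qed
    qed
  qed
next
  case (up a b P)
  show ?case
  proof (rule runs_while_step)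
    show "reg s 11 \<noteq> 0" using up.prems up.hyps(1) by auto
    from ascend_body_up[OF up.prems(1,2) up.hyps(2) up.prems(3,4,6-8)]
    show "runs W D ascend_body s
      (\<lambda>k s1. runs W D (While_Nonzero 11 ascend_body) s1 (\<lambda>k'. ascended (a # P) s (1 + k + k')))"
    proof (rule runs_mono, elim conjE)
      fix k :: nat and s1 :: machine assume s1: "k \<le> 15" "reg s1 12 = par a" "reg s1 13 = b" "reg s1 11 = of_bool (par a \<noteq> b)"
        "reg s1 5 = reg s 5" "scratch s1 = scratch s" "reported s1 = reported s @ [a]"
        "unchanged {5, 11, 12, 13, 14, 15} s s1"
      have "reg s1 3 = M" "reg s1 4 = 2" "reg s1 19 = 0" "reg s1 5 + 2 * dep b < W"
        using s1(5,8) up.prems(6-9) by (auto simp: unchanged_def)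
      from up.IH[OF par_less[OF up.prems(1)] up.prems(2) s1(2-4) this]
      show "runs W D (While_Nonzero 11 ascend_body) s1 (\<lambda>k'. ascended (a # P) s (1 + k + k'))"
      proof (rule runs_mono)
        fix k' s' assume "ascended P s1 k' s'"
        then obtain U L x where ULx: "P = U @ x # rev L" "reported s' = (reported s @ [a]) @ U"
          "reg s' 12 = x" "reg s' 5 = reg s 5 + 2 * length L"
          "\<forall>i<length L. scratch s' (reg s 5 + 2 * i) = L ! i"
          "\<forall>a<reg s 5. scratch s' a = scratch s a"
          "unchanged {5, 11, 12, 13, 14, 15} s1 s'" "k' \<le> 20 * length P" "reg s' 5 < W"
          unfolding ascended_def s1(5-7) by blast
        have "unchanged {5, 11, 12, 13, 14, 15} s s'"
          using s1(8) ULx(7) by (simp add: unchanged_def)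
        then show "ascended (a # P) s (1 + k + k') s'" using ULx(1-6,8,9) s1(1)
          unfolding ascended_def
          by (intro exI[of _ "a # U"] exI[of _ L] exI[of _ x]) simp
      qed
    qed
  qed
qed

lemma descend_loop:
  "reg s 5 = reg s 16 + 2 * length L \<Longrightarrow> \<forall>i<length L. scratch s (reg s 16 + 2 * i) = L ! i \<Longrightarrow>
   reg s 11 = of_bool (L \<noteq> []) \<Longrightarrow> reg s 4 = 2 \<Longrightarrow> reg s 5 < W \<Longrightarrow>
   runs W D (While_Nonzero 11 descend_body) s (\<lambda>k s'. reported s' = reported s @ rev L \<and>
     scratch s' = scratch s \<and> reg s' 5 = reg s 16 \<and> unchanged {5, 11, 14} s s' \<and>
     k \<le> 5 * length L + 1)"
proof (induction L arbitrary: s rule: rev_induct)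
  case Nil
  show ?case by (rule runs_while_stop) (use Nil in \<open>auto simp: unchanged_def\<close>)
next
  case (snoc x L)
  show ?case
  proof (rule runs_while_step)
    show "reg s 11 \<noteq> 0" using snoc.prems by simp
    have "runs W D descend_body s (\<lambda>k s1. k = 4 \<and> reg s1 5 = reg s 16 + 2 * length L \<and>
        reported s1 = reported s @ [x] \<and> scratch s1 = scratch s \<and> reg s1 11 = of_bool (L \<noteq> []) \<and>
        unchanged {5, 11, 14} s s1)"
      using snoc.prems W by (simp add: descend_body_def unchanged_def)
    then show "runs W D descend_body s (\<lambda>k s1. runs W D (While_Nonzero 11 descend_body) s1
      (\<lambda>k' s'. reported s' = reported s @ rev (L @ [x]) \<and> scratch s' = scratch s \<and>
        reg s' 5 = reg s 16 \<and> unchanged {5, 11, 14} s s' \<and> 1 + k + k' \<le> 5 * length (L @ [x]) + 1))"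
    proof (rule runs_mono, elim conjE)
      fix k :: nat and s1 :: machine assume s1: "k = 4" "reg s1 5 = reg s 16 + 2 * length L" "reported s1 = reported s @ [x]"
        "scratch s1 = scratch s" "reg s1 11 = of_bool (L \<noteq> [])" "unchanged {5, 11, 14} s s1"
      have r: "reg s1 16 = reg s 16" "reg s1 4 = 2" using s1(6) snoc.prems(4) by (auto simp: unchanged_def)
      have "\<forall>i<length L. scratch s1 (reg s1 16 + 2 * i) = L ! i"
        using snoc.prems(2) r s1(4) by (auto simp: nth_append)
      then have "runs W D (While_Nonzero 11 descend_body) s1 (\<lambda>k s'. reported s' = reported s1 @ rev L \<and>
         scratch s' = scratch s1 \<and> reg s' 5 = reg s1 16 \<and> unchanged {5, 11, 14} s1 s' \<and>
         k \<le> 5 * length L + 1)"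
        by (intro snoc.IH) (use r s1 snoc.prems in auto)
      then show "runs W D (While_Nonzero 11 descend_body) s1
        (\<lambda>k' s'. reported s' = reported s @ rev (L @ [x]) \<and> scratch s' = scratch s \<and>
          reg s' 5 = reg s 16 \<and> unchanged {5, 11, 14} s s' \<and> 1 + k + k' \<le> 5 * length (L @ [x]) + 1)"
        by (rule runs_mono) (use r s1 in \<open>auto simp: unchanged_def\<close>)
    qed
  qed
qed

lemma runs_tree_route:
  assumes P: "tree_path par dep a b P" and ab: "a < n" "b < n" "reg s 12 = a" "reg s 13 = b"
    and regs: "reg s 3 = M" "reg s 4 = 2" "reg s 19 = 0" and sp: "reg s 5 + 2 * M < W"
  shows "runs W D tree_route s (\<lambda>k s'. reported s' = reported s @ P \<and>
     (\<forall>i<reg s 5. scratch s' i = scratch s i) \<and> unchanged {11, 12, 13, 14, 15, 16} s s' \<and>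
     k \<le> 40 * length P)"
proof -
  define s0 where "s0 = s\<lparr>reg := (reg s)(16 := reg s 5, 11 := of_bool (a \<noteq> b))\<rparr>"
  have s0: "reg s0 12 = a" "reg s0 13 = b" "reg s0 11 = of_bool (a \<noteq> b)" "reg s0 3 = M" "reg s0 4 = 2"
    "reg s0 19 = 0" "reg s0 5 = reg s 5" "reg s0 16 = reg s 5" "reported s0 = reported s"
    "scratch s0 = scratch s" "unchanged {11, 16} s s0"
    using ab regs by (auto simp: s0_def unchanged_def)
  have sp': "reg s0 5 + 2 * dep b < W" using dep_less[OF ab(2)] sp s0(7) by simp
  have 1: "runs W D (While_Nonzero 11 ascend_body) s0 (ascended P s0)"
    by (rule ascend_loop[OF P ab(1,2) s0(1-6) sp'])
  have sp1: "reg s 5 < W" using sp by simp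
  have init: "runs W D (Arith Add 16 5 19 ;; differ 11 12 13) s (\<lambda>k s1. k = 3 \<and> s1 = s0)"
    using sp1 regs ab W by (simp add: runs_differ s0_def)
  show ?thesis unfolding tree_route_def
  proof (rule runs_Seq[OF init], elim conjE, hypsubst, rule runs_Seq[OF 1])
    fix k s1 assume "ascended P s0 k s1"
    then obtain U L x where ULx: "P = U @ x # rev L" "reported s1 = reported s @ U"
      "reg s1 12 = x" "reg s1 5 = reg s 5 + 2 * length L"
      "\<forall>i<length L. scratch s1 (reg s 5 + 2 * i) = L ! i"
      "\<forall>a<reg s 5. scratch s1 a = scratch s a"
      "unchanged {5, 11, 12, 13, 14, 15} s0 s1" "k \<le> 20 * length P" "reg s1 5 < W"
      unfolding ascended_def s0(7,9,10) by blast
    define s2 where "s2 = s1\<lparr>reported := reported s @ U @ [x], reg := (reg s1)(11 := of_bool (L \<noteq> []))\<rparr>"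
    have r16: "reg s1 16 = reg s 5" "reg s1 4 = 2" using ULx(7) s0 by (auto simp: unchanged_def)
    have mid: "runs W D (Emit 12 ;; Arith Less 11 16 5) s1 (\<lambda>k s'. k = 2 \<and> s' = s2)"
      using ULx(2-4) r16 W by (simp add: s2_def)
    have "runs W D (While_Nonzero 11 descend_body) s2 (\<lambda>k s'. reported s' = reported s2 @ rev L \<and>
     scratch s' = scratch s2 \<and> reg s' 5 = reg s2 16 \<and> unchanged {5, 11, 14} s2 s' \<and>
     k \<le> 5 * length L + 1)"
      by (rule descend_loop) (use ULx(4,5,9) r16 in \<open>auto simp: s2_def\<close>)
    then have fin: "runs W D (While_Nonzero 11 descend_body) s2 (\<lambda>k' s'. reported s' = reported s @ P \<and>
      (\<forall>i<reg s 5. scratch s' i = scratch s i) \<and> unchanged {11, 12, 13, 14, 15, 16} s s' \<and>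
      3 + (k + (2 + k')) \<le> 40 * length P)"
    proof (rule runs_mono, elim conjE, intro conjI)
      fix k' s' assume s': "reported s' = reported s2 @ rev L" "scratch s' = scratch s2"
        "reg s' 5 = reg s2 16" "unchanged {5, 11, 14} s2 s'" "k' \<le> 5 * length L + 1"
      show "reported s' = reported s @ P" using s'(1) ULx(1) by (simp add: s2_def)
      show "\<forall>i<reg s 5. scratch s' i = scratch s i" using s'(2) ULx(6) by (simp add: s2_def)
      show "unchanged {11, 12, 13, 14, 15, 16} s s'" unfolding unchanged_def
      proof (intro allI impI)
        fix r :: nat assume r: "r \<notin> {11, 12, 13, 14, 15, 16}"
        show "reg s' r = reg s r"
        proof (cases "r = 5")
          case True then show ?thesis using s'(3) r16 by (simp add: s2_def)
        next
          case False
          then have "reg s' r = reg s2 r" "reg s2 r = reg s1 r" "reg s1 r = reg s0 r" "reg s0 r = reg s r"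
            using r s'(4) ULx(7) s0(11) by (auto simp: unchanged_def s2_def)
          then show ?thesis by simp
        qed
      qed
      have "length L < length P" using ULx(1) by simp
      then show "3 + (k + (2 + k')) \<le> 40 * length P" using s'(5) ULx(8) by linarith
    qed
    show "runs W D ((Emit 12 ;; Arith Less 11 16 5) ;; While_Nonzero 11 descend_body) s1
      (\<lambda>k' s2. reported s2 = reported s @ P \<and> (\<forall>i<reg s 5. scratch s2 i = scratch s i) \<and>
        unchanged {11, 12, 13, 14, 15, 16} s s2 \<and> 3 + (k + k') \<le> 40 * length P)"
      by (rule runs_Seq[OF mid]) (use fin in simp)
  qed
qed

end

text \<open>
  Registers 0, 8, 9 and 10 hold the number of vertices, the number of clusters, the multiplier of the
  first hash function and the number of keys. The clusters in registers 17 and 18 form the key;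
  registers 13 and 20 receive the ends of the stored edge between them.
\<close>

definition lookup :: prog where
  "lookup = (Arith Mul 14 17 8 ;; Arith Add 14 14 18 ;; Arith Mul 15 8 8 ;; Arith Mul 20 10 15 ;;
       Arith Mul 21 9 14 ;; Arith Mod 21 21 20 ;; Arith Div 21 21 15 ;; Arith Add 21 21 0 ;; Probe 21 21) ;;
     (unpack 22 21 0 ;; unpack 23 21 1 ;; unpack 24 21 2 ;; Arith Mul 23 23 15 ;; Arith Mul 22 22 14 ;;
       Arith Mod 22 22 23 ;; Arith Div 22 22 15 ;; Arith Add 22 22 24 ;; Probe 22 22) ;;
     unpack 13 22 0 ;; unpack 20 22 1"

text \<open>The stack pointer is odd and equals 1 on the empty stack, so comparing it with the
  constant 2 in register 4 tells whether a further cluster is waiting.\<close>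

definition step_body :: prog where
  "step_body = (Arith Sub 5 5 4 ;; Load 18 5) ;; lookup ;; tree_route ;;
     Arith Add 12 20 19 ;; Arith Add 17 18 19 ;; Arith Less 11 4 5"

definition finish :: prog where
  "finish = Arith Add 13 2 19 ;; tree_route"

text \<open>
  The digits of the word stored for a vertex are its parent, depth and cluster, the values for
  registers 8, 9 and 10, and the position of the given algorithm's data.
\<close>

definition setup_query :: prog where
  "setup_query = (Const 4 2 ;; Arith Add 3 0 4 ;; Arith Mul 3 3 3 ;; Arith Mul 3 3 3 ;; Arith Mul 3 3 3 ;;
       Arith Mul 3 3 3 ;; Const 5 1) ;;
     fetch 17 1 2 ;; fetch 18 2 2 ;; Arith Add 12 1 19 ;; Arith Equal 11 17 18"

text \<open>Registers 30, 31 and 32 are registers 0, 1 and 2 of the embedded program, so this builds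
  its initial state for the query from \<open>cl v\<close> to \<open>cl u\<close>; its other
  registers and the scratch memory are still zero. All parameters are read from the word of the
  first end.\<close>

definition setup_embedded :: prog where
  "setup_embedded = fetch 8 1 3 ;; fetch 9 1 4 ;; fetch 10 1 5 ;; fetch 6 1 6 ;;
     Arith Add 30 8 19 ;; Arith Add 31 18 19 ;; Arith Add 32 17 19"

text \<open>
  The given algorithm is asked for a path in the opposite direction, since its answer is popped
  off a stack.
\<close>

definition query_prog :: "prog \<Rightarrow> prog" where
  "query_prog p = setup_query ;; If_Nonzero 11 finish
     (setup_embedded ;; embed p ;; (Arith Sub 5 5 4 ;; Arith Less 11 4 5) ;;
       While_Nonzero 11 step_body ;; finish)"

section \<open>Correctness and running time of queries\<close>

lemma runs_while_Seq_step:
  assumes "reg s i \<noteq> 0" "runs W D p s R"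
    and "\<And>k s1. R k s1 \<Longrightarrow> runs W D (While_Nonzero i p ;; q) s1 (\<lambda>k' s2. Q (1 + k + k') s2)"
  shows "runs W D (While_Nonzero i p ;; q) s Q"
  unfolding runs_simps(8)
proof (rule runs_while_step[OF assms(1)], rule runs_mono[OF assms(2)])
  fix k s1 assume "R k s1"
  from assms(3)[OF this] show "runs W D (While_Nonzero i p) s1
     (\<lambda>k' s2. runs W D q s2 (\<lambda>k''. Q (1 + k + k' + k'')))"
    unfolding runs_simps(8) by (simp add: add.assoc)
qed

lemma hash_le: "hash m L a x \<le> a * x"
proof -
  have "hash m L a x \<le> a * x mod (m * L)" unfolding hash_def by (rule div_le_dividend)
  also have "\<dots> \<le> a * x" by (rule mod_less_eq_dividend)
  finally show ?thesis .
qed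

declare unpack.simps [simp del]

lemma digit_less: "0 < M \<Longrightarrow> digit M x j < M"
  by (simp add: digit_def)

text \<open>Behind the vertex words come the headers, one per value of the first hash function,
  whose digits are the second multiplier, the second range and an absolute position. The sum in
  \<open>table2\<close> is thus an address in \<open>D\<close>; the word there holds both ends of
  the crossing edge.\<close>

locale stored_oracle = stored_forest +
  fixes N k a off :: nat and S :: "nat set set" and X Y :: "nat \<Rightarrow> nat \<Rightarrow> nat"
  assumes NM: "N \<le> n" "a < M" "k < M"
    and digits': "v < n \<Longrightarrow> digit M (D ! v) 3 = N" "v < n \<Longrightarrow> digit M (D ! v) 4 = a"
      "v < n \<Longrightarrow> digit M (D ! v) 5 = k" "v < n \<Longrightarrow> digit M (D ! v) 6 = off"
    and S: "{i, j} \<in> S \<Longrightarrow> i < N \<and> j < N \<and> X i j < n \<and> Y i j < n"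
    and table1: "{i, j} \<in> S \<Longrightarrow> n + hash k (N * N) a (i * N + j) < length D"
    and table2: "{i, j} \<in> S \<Longrightarrow> h = D ! (n + hash k (N * N) a (i * N + j)) \<Longrightarrow>
      z = hash (digit M h 1) (N * N) (digit M h 0) (i * N + j) + digit M h 2 \<Longrightarrow>
      z < length D \<and> digit M (D ! z) 0 = X i j \<and> digit M (D ! z) 1 = Y i j"
begin

lemma runs_lookup:
  assumes ij: "{i, j} \<in> S" "reg s 17 = i" "reg s 18 = j"
    and regs: "reg s 0 = n" "reg s 3 = M" "reg s 8 = N" "reg s 9 = a" "reg s 10 = k"
  shows "runs W D lookup s (\<lambda>t s'. t \<le> 30 \<and> reg s' 13 = X i j \<and> reg s' 20 = Y i j \<and>
     scratch s' = scratch s \<and> reported s' = reported s \<and>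
     unchanged {13, 14, 15, 20, 21, 22, 23, 24} s s')"
proof -
  define x where "x = i * N + j"
  define h where "h = D ! (n + hash k (N * N) a x)"
  define z where "z = hash (digit M h 1) (N * N) (digit M h 0) x + digit M h 2"
  have i: "i < N" "j < N" using S[OF ij(1)] by auto
  have tab: "n + hash k (N * N) a x < length D" "z < length D" "digit M (D ! z) 0 = X i j"
    "digit M (D ! z) 1 = Y i j"
    using table1[OF ij(1)] table2[OF ij(1) h_def[unfolded x_def] z_def[unfolded x_def]]
    by (simp_all add: x_def)
  have NM': "N < M" using NM(1) M(1) by simp
  have M0: "0 < M" using M(3) by simp
  have x: "x < M * M"
  proof -
    have "x < i * N + N" using i by (simp add: x_def)
    also have "\<dots> = Suc i * N" by simp
    also have "\<dots> \<le> M * M" using i NM' by (intro mult_le_mono) auto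
    finally show ?thesis .
  qed
  \<comment> \<open>Every product in the lookup has one factor below \<open>M\<close> and one below
    \<open>M * M\<close>, and adding a position costs at most another \<open>M\<close>; this bound
    excludes overflow.\<close>
  have cube: "M ^ 3 + M < W"
  proof -
    have "M ^ 3 + M \<le> M ^ 3 + M ^ 3" using self_le_power[of M 3] M(3) by simp
    also have "\<dots> = 2 * M ^ 3" by simp
    also have "\<dots> \<le> M * M ^ 3" by (rule mult_le_mono1[OF M(3)])
    also have "\<dots> = M ^ 4" by (simp add: power_eq_if)
    finally show ?thesis using M(2) by simp
  qed
  have mul: "c * y < M ^ 3" if "c < M" "y < M * M" for c y
  proof -
    have "c * y \<le> c * (M * M)" using that by simp
    also have "\<dots> < M * (M * M)" using that M0 by simp
    finally show ?thesis by (simp add: power3_eq_cube mult.assoc)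
  qed
  have NN: "N * N < M * M" using NM' by (simp add: mult_strict_mono)
  have sq: "M * M \<le> M ^ 3" using M0 by (simp add: power3_eq_cube)
  have d: "digit M y q < M" for y q using digit_less[OF M0] .
  have hl: "hash m L c x + y < W" if "c < M" "y < M" for m L c y
    using hash_le[of m L c x] mul[OF that(1) x] that(2) cube by linarith
  have small: "i * N < W" "x < W" "N * N < W" "k * (N * N) < W" "a * x < W"
    "digit M h 1 * (N * N) < W" "digit M h 0 * x < W"
    using mul[OF NM(3) NN] mul[OF NM(2) x] mul[OF d NN, of h 1] mul[OF d x, of h 0] cube x NN sq
    by (auto simp: x_def)
  have small2: "a * x mod (k * (N * N)) < W" "digit M h 0 * x mod (digit M h 1 * (N * N)) < W"
    using small(5,7) by (meson le_less_trans mod_less_eq_dividend)+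
  have small3: "hash k (N * N) a x < W" "hash k (N * N) a x + n < W"
     "hash (digit M h 1) (N * N) (digit M h 0) x < W" "z < W"
    using hl[OF NM(2) M0, of k "N * N"] hl[OF NM(2) M(1), of k "N * N"]
      hl[OF d M0, of "digit M h 1" "N * N" h 0] hl[OF d d, of "digit M h 1" "N * N" h 0 h 2]
    by (simp_all add: z_def)
  have hW: "h < W" "D ! z < W" using words tab by (auto simp: h_def)
  define s1 where "s1 = s\<lparr>reg := (reg s)(14 := x, 15 := N * N, 20 := k * (N * N), 21 := h)\<rparr>"
  define s2 where "s2 = s1\<lparr>reg := (reg s1)(22 := D ! z, 23 := digit M h 1 * (N * N), 24 := digit M h 2)\<rparr>"
  have 1: "runs W D (Arith Mul 14 17 8 ;; Arith Add 14 14 18 ;; Arith Mul 15 8 8 ;; Arith Mul 20 10 15 ;;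
       Arith Mul 21 9 14 ;; Arith Mod 21 21 20 ;; Arith Div 21 21 15 ;; Arith Add 21 21 0 ;; Probe 21 21) s
       (\<lambda>t s'. t = 9 \<and> s' = s1)"
    using ij regs small(1-5) small2(1) small3(1,2) tab(1)
    by (simp add: x_def[symmetric] hash_def[symmetric] add.commute[of _ n] h_def[symmetric] s1_def fun_upd_twist)
  have 2: "runs W D (unpack 22 21 0 ;; unpack 23 21 1 ;; unpack 24 21 2 ;; Arith Mul 23 23 15 ;; Arith Mul 22 22 14 ;;
       Arith Mod 22 22 23 ;; Arith Div 22 22 15 ;; Arith Add 22 22 24 ;; Probe 22 22) s1
       (\<lambda>t s'. t = 12 \<and> s' = s2)"
    using regs small(6-7) small2(2) small3(3,4) tab(2) hW(1)
    by (simp add: runs_unpack[where M = M] hash_def[symmetric] z_def[symmetric, simplified] s2_def s1_def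
        fun_upd_twist)
  show ?thesis unfolding lookup_def
    by (rule runs_Seq[OF 1], elim conjE, hypsubst, rule runs_Seq[OF 2], elim conjE, hypsubst)
      (use regs hW tab in \<open>simp add: s2_def s1_def runs_unpack[where M = M] unchanged_def\<close>)
qed

definition globals :: "nat \<Rightarrow> machine \<Rightarrow> bool" where
  "globals v s \<longleftrightarrow> reg s 0 = n \<and> reg s 2 = v \<and> reg s 3 = M \<and> reg s 4 = 2 \<and> reg s 8 = N \<and>
     reg s 9 = a \<and> reg s 10 = k \<and> reg s 19 = 0"

lemma globals_unchanged:
  "globals v s \<Longrightarrow> unchanged R s s' \<Longrightarrow> \<forall>r\<in>{0, 2, 3, 4, 8, 9, 10, 19}. r \<notin> R \<Longrightarrow> globals v s'"
  by (simp add: globals_def unchanged_def)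

lemma runs_finish:
  assumes P: "tree_path par dep u v P" and uv: "u < n" "v < n" "reg s 12 = u" "reg s 2 = v"
    and regs: "reg s 3 = M" "reg s 4 = 2" "reg s 19 = 0" and sp: "reg s 5 + 2 * M < W"
  shows "runs W D finish s (\<lambda>t s'. reported s' = reported s @ P \<and> t \<le> 41 * length P)"
proof -
  define s0 where "s0 = s\<lparr>reg := (reg s)(13 := v)\<rparr>"
  have "runs W D (Arith Add 13 2 19) s (\<lambda>t s'. t = 1 \<and> s' = s0)"
    using uv regs M(1) W by (simp add: s0_def)
  then show ?thesis unfolding finish_def
  proof (rule runs_Seq, elim conjE, hypsubst)
    have "runs W D tree_route s0 (\<lambda>t s'. reported s' = reported s0 @ P \<and>
      (\<forall>i<reg s0 5. scratch s' i = scratch s0 i) \<and> unchanged {11, 12, 13, 14, 15, 16} s0 s' \<and> t \<le> 40 * length P)"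
      by (rule runs_tree_route[OF P uv(1,2)]) (use uv regs sp in \<open>simp_all add: s0_def\<close>)
    moreover have "1 \<le> length P" using P by cases auto
    ultimately show "runs W D tree_route s0 (\<lambda>t s'. reported s' = reported s @ P \<and> 1 + t \<le> 41 * length P)"
      by (elim runs_mono) (auto simp: s0_def)
  qed
qed

text \<open>The clusters still to be entered lie on the stack with the next one on top. The constant
  cost of a lookup is charged to the tree path in the current cluster, which reports at least one
  vertex, so the time is linear in the output alone.\<close>

lemma cluster_loop:
  "cluster_route par dep X Y v Q u P \<Longrightarrow> set (path_edges Q) \<subseteq> S \<Longrightarrow> u < n \<Longrightarrow> v < n \<Longrightarrow> reg s 12 = u \<Longrightarrow>
   reg s 17 = hd Q \<Longrightarrow> reg s 5 = 2 * length (tl Q) + 1 \<Longrightarrow>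
   \<forall>i<length (tl Q). scratch s (2 * i + 1) = rev (tl Q) ! i \<Longrightarrow> reg s 11 = of_bool (tl Q \<noteq> []) \<Longrightarrow>
   globals v s \<Longrightarrow> 2 * length Q + 1 + 2 * M < W \<Longrightarrow>
   runs W D (While_Nonzero 11 step_body ;; finish) s
     (\<lambda>t s'. reported s' = reported s @ P \<and> t \<le> 100 * length P)"
proof (induction arbitrary: s rule: cluster_route.induct)
  case (last u P c)
  have "runs W D finish s (\<lambda>t s'. reported s' = reported s @ P \<and> t \<le> 41 * length P)"
    by (rule runs_finish[OF last(1)]) (use last in \<open>auto simp: globals_def\<close>)
  moreover have "1 \<le> length P" using last(1) by cases auto
  ultimately show ?case unfolding runs_simps(8)
    by (intro runs_while_stop) (use last in \<open>auto elim!: runs_mono\<close>)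
next
  case (cross u c d P cs P')
  note prems = cross.prems
  have cd: "{c, d} \<in> S" using prems(1) by simp
  have XY: "X c d < n" "Y c d < n" "c < N" "d < N" using S[OF cd] by auto
  have dW: "d < W" "Y c d < W" using XY NM(1) M(1) W by linarith+
  have P1: "1 \<le> length P" using cross.hyps(1) by cases auto
  define R where "R t s' \<longleftrightarrow> t \<le> 40 * length P + 40 \<and> reported s' = reported s @ P \<and> reg s' 12 = Y c d \<and>
    reg s' 17 = d \<and> reg s' 5 = 2 * length cs + 1 \<and> (\<forall>i<length cs. scratch s' (2 * i + 1) = rev cs ! i) \<and>
    reg s' 11 = of_bool (cs \<noteq> []) \<and> globals v s'" for t s'
  have body: "runs W D step_body s R"
  proof -
    define s0 where "s0 = s\<lparr>reg := (reg s)(5 := 2 * length cs + 1, 18 := d)\<rparr>"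
    have "scratch s (2 * length cs + 1) = d" using prems(7)[rule_format, of "length cs"] by (simp add: nth_append)
    then have 1: "runs W D (Arith Sub 5 5 4 ;; Load 18 5) s (\<lambda>t s'. t = 2 \<and> s' = s0)"
      using prems(6,9,10) by (simp add: s0_def globals_def)
    have g0: "globals v s0" using prems(9) by (simp add: globals_def s0_def)
    have 2: "runs W D lookup s0 (\<lambda>t s'. t \<le> 30 \<and> reg s' 13 = X c d \<and> reg s' 20 = Y c d \<and>
     scratch s' = scratch s0 \<and> reported s' = reported s0 \<and>
     unchanged {13, 14, 15, 20, 21, 22, 23, 24} s0 s')"
      by (rule runs_lookup[OF cd]) (use prems(5) g0 in \<open>auto simp: s0_def globals_def\<close>)
    show ?thesis unfolding step_body_def
    proof (rule runs_Seq[OF 1], elim conjE, hypsubst, rule runs_Seq[OF 2], elim conjE)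
      fix t :: nat and s1 :: machine assume s1: "t \<le> 30" "reg s1 13 = X c d" "reg s1 20 = Y c d" "scratch s1 = scratch s0"
        "reported s1 = reported s0" "unchanged {13, 14, 15, 20, 21, 22, 23, 24} s0 s1"
      have g1: "globals v s1" by (rule globals_unchanged[OF g0 s1(6)]) auto
      have r1: "reg s1 12 = u" "reg s1 18 = d" "reg s1 5 = 2 * length cs + 1"
        using s1(6) prems(4) by (auto simp: unchanged_def s0_def)
      have 3: "runs W D tree_route s1 (\<lambda>t s'. reported s' = reported s1 @ P \<and>
        (\<forall>i<reg s1 5. scratch s' i = scratch s1 i) \<and> unchanged {11, 12, 13, 14, 15, 16} s1 s' \<and> t \<le> 40 * length P)"
        by (rule runs_tree_route[OF cross.hyps(1) prems(2) XY(1)])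
          (use g1 r1 s1(2) prems(10) in \<open>auto simp: globals_def\<close>)
      show "runs W D (tree_route ;; Arith Add 12 20 19 ;; Arith Add 17 18 19 ;; Arith Less 11 4 5) s1
         (\<lambda>t'. R (2 + (t + t')))"
      proof (rule runs_Seq[OF 3], elim conjE)
        fix t' s2 assume s2: "reported s2 = reported s1 @ P" "\<forall>i<reg s1 5. scratch s2 i = scratch s1 i"
          "unchanged {11, 12, 13, 14, 15, 16} s1 s2" "t' \<le> 40 * length P"
        have g2: "globals v s2" by (rule globals_unchanged[OF g1 s2(3)]) auto
        have r2: "reg s2 20 = Y c d" "reg s2 18 = d" "reg s2 5 = 2 * length cs + 1"
          using s2(3) r1 s1(3) by (auto simp: unchanged_def)
        have "scratch s2 (2 * i + 1) = rev cs ! i" if "i < length cs" for i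
          using that s2(2) r1(3) s1(4) prems(7)[rule_format, of i] by (simp add: s0_def nth_append)
        then show "runs W D (Arith Add 12 20 19 ;; Arith Add 17 18 19 ;; Arith Less 11 4 5) s2
           (\<lambda>t''. R (2 + (t + (t' + t''))))"
          using g2 r2 s2(1,4) s1(1,5) dW W by (cases cs) (auto simp: R_def globals_def s0_def)
      qed
    qed
  qed
  show ?case
  proof (rule runs_while_Seq_step[OF _ body])
    show "reg s 11 \<noteq> 0" using prems(8) by simp
    fix t s1 assume R: "R t s1"
    have "runs W D (While_Nonzero 11 step_body ;; finish) s1
      (\<lambda>t s'. reported s' = reported s1 @ P' \<and> t \<le> 100 * length P')"
      by (rule cross.IH) (use R prems XY in \<open>auto simp: R_def\<close>)
    then show "runs W D (While_Nonzero 11 step_body ;; finish) s1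
      (\<lambda>t' s'. reported s' = reported s @ (P @ P') \<and> 1 + t + t' \<le> 100 * length (P @ P'))"
      by (rule runs_mono) (use R P1 in \<open>auto simp: R_def\<close>)
  qed
qed

text \<open>The base of the digits is computed, not stored: four squarings of \<open>n + 2\<close>
  give the exponent 16.\<close>

lemma runs_setup_query:
  assumes uv: "u < n" "v < n" and Mn: "M = (n + 2) ^ 16"
  shows "runs W D setup_query (query_state n u v) (\<lambda>t s. t \<le> 20 \<and> reg s 11 = of_bool (cl u = cl v) \<and>
     reg s 0 = n \<and> reg s 1 = u \<and> reg s 2 = v \<and> reg s 3 = M \<and> reg s 4 = 2 \<and> reg s 5 = 1 \<and> reg s 12 = u \<and>
     reg s 17 = cl u \<and> reg s 18 = cl v \<and> (\<forall>r\<ge>19. reg s r = 0) \<and> scratch s = (\<lambda>_. 0) \<and> reported s = [])"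
proof -
  define b where "b = n + 2"
  have b: "Suc (Suc n) = b" by (simp add: b_def)
  have Mb: "M = b ^ 16" using Mn by (simp add: b_def)
  have sq: "b * b = b ^ 2" "b ^ 2 * b ^ 2 = b ^ 4" "b ^ 4 * b ^ 4 = b ^ 8" "b ^ 8 * b ^ 8 = b ^ 16"
    by (simp_all add: power_add[symmetric] power2_eq_square[symmetric])
  have le: "b ^ j < W" if "j \<le> 16" for j
  proof -
    have "b ^ j \<le> b ^ 16" by (rule power_increasing) (use that in \<open>auto simp: b_def\<close>)
    then show ?thesis using W(2) unfolding Mb by linarith
  qed
  have ltW: "2 < W" "b < W" "u < W" using le[of 1] uv by (auto simp: b_def)
  have lt: "b ^ 2 < W" "b ^ 4 < W" "b ^ 8 < W" "b ^ 16 < W" using le by auto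
  have 1: "runs W D (Const 4 2 ;; Arith Add 3 0 4 ;; Arith Mul 3 3 3 ;; Arith Mul 3 3 3 ;; Arith Mul 3 3 3 ;;
       Arith Mul 3 3 3 ;; Const 5 1) (query_state n u v)
     (\<lambda>t s. t = 7 \<and> s = query_state n u v\<lparr>reg := (reg (query_state n u v))(3 := M, 4 := 2, 5 := 1)\<rparr>)"
    using ltW lt W(1) by (simp add: query_state_def b sq Mb fun_upd_twist)
  show ?thesis unfolding setup_query_def
    by (rule runs_Seq[OF 1], elim conjE, hypsubst)
      (use uv len words digits W ltW in \<open>auto simp: runs_fetch[where M = M] query_state_def\<close>)
qed

lemma cl_less: "v < n \<Longrightarrow> cl v < M"
  using digits(3)[of v] digit_less[of M "D ! v" 2] M(3) by simp

lemma query_same_cluster: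
  assumes uv: "u < n" "v < n" and Mn: "M = (n + 2) ^ 16" and cl: "cl u = cl v"
    and P: "tree_path par dep u v P" and M2: "2 * M + 1 < W"
  shows "runs W D (query_prog p) (query_state n u v) (\<lambda>t s. reported s = P \<and> t \<le> 100 * length P)"
  unfolding query_prog_def
proof (rule runs_Seq[OF runs_setup_query[OF uv Mn]], elim conjE)
  fix t :: nat and s :: machine assume s: "t \<le> 20" "reg s 11 = of_bool (cl u = cl v)" "reg s 2 = v" "reg s 3 = M"
    "reg s 4 = 2" "reg s 5 = 1" "reg s 12 = u" "\<forall>r\<ge>19. reg s r = 0" "reported s = []"
  have "runs W D finish s (\<lambda>t s'. reported s' = reported s @ P \<and> t \<le> 41 * length P)"
    by (rule runs_finish[OF P uv]) (use s M2 in auto)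
  moreover have "1 \<le> length P" using P by cases auto
  ultimately show "runs W D (If_Nonzero 11 finish (setup_embedded ;; embed p ;; (Arith Sub 5 5 4 ;; Arith Less 11 4 5) ;;
       While_Nonzero 11 step_body ;; finish)) s (\<lambda>t' s. reported s = P \<and> t + t' \<le> 100 * length P)"
    using s(1,2,9) cl by (auto elim!: runs_mono)
qed

lemma query_other_cluster:
  assumes uv: "u < n" "v < n" and Mn: "M = (n + 2) ^ 16" and cl: "cl u \<noteq> cl v"
    and p: "exec W' D' p (query_state N (cl v) (cl u)) k' s'" "reported s' = P'"
    and P': "P' \<noteq> []" "last P' = cl u" "set (path_edges (rev P')) \<subseteq> S"
    and route: "cluster_route par dep X Y v (rev P') u P"
    and B: "W' \<le> B" "2 * B \<le> W" "off + B \<le> W" "\<forall>x\<in>set D'. x < B" "N < B" "cl u < B" "cl v < B"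
    and D': "off + length D' \<le> length D" "\<And>i. i < length D' \<Longrightarrow> D ! (off + i) = D' ! i"
    and M2: "2 * length P' + 1 + 2 * M < W"
  shows "runs W D (query_prog p) (query_state n u v)
     (\<lambda>t s. reported s = P \<and> t \<le> 100 * length P + 2 * k' + 100)"
  unfolding query_prog_def
proof (rule runs_Seq[OF runs_setup_query[OF uv Mn]], elim conjE)
  fix t :: nat and s :: machine assume s: "t \<le> 20" "reg s 11 = of_bool (cl u = cl v)" "reg s 0 = n" "reg s 1 = u"
    "reg s 2 = v" "reg s 3 = M" "reg s 4 = 2" "reg s 5 = 1" "reg s 12 = u" "reg s 17 = cl u" "reg s 18 = cl v"
    "\<forall>r\<ge>19. reg s r = 0" "scratch s = (\<lambda>_. 0)" "reported s = []"
  define s0 where "s0 = s\<lparr>reg := (reg s)(8 := N, 9 := a, 10 := k, 6 := off, 30 := N, 31 := cl v, 32 := cl u)\<rparr>"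
  have clW: "cl u < W" "cl v < W" using cl_less uv W by (meson less_trans)+
  have NW: "N < W" using NM(1) M(1) W by linarith
  have 1: "runs W D setup_embedded s (\<lambda>t s'. t \<le> 40 \<and> s' = s0)"
    unfolding setup_embedded_def
    using s uv len words digits' clW NW by (simp add: runs_fetch[where M = M] s0_def fun_upd_twist)
  have sim0: "simulates off (query_state N (cl v) (cl u)) s0"
    using s(7,8,12,13) by (simp add: simulates_def s0_def query_state_def)
  have bd0: "bounded_by B (query_state N (cl v) (cl u))"
    using B(5-7) by (auto simp: bounded_by_def query_state_def)
  have sp: "2 * length (reported s') + 1 < W" using M2 p(2) by simp
  note 2 = embed_exec[OF p(1) B(1-4) D' sim0 bd0 sp]
  have "runs W D (setup_embedded ;; embed p ;; (Arith Sub 5 5 4 ;; Arith Less 11 4 5) ;;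
       While_Nonzero 11 step_body ;; finish) s (\<lambda>t' s. reported s = P \<and> t' \<le> 100 * length P + 2 * k' + 50)"
  proof (rule runs_Seq[OF 1], elim conjE, hypsubst, rule runs_Seq[OF 2], assumption, elim conjE)
    fix t0 t1 :: nat and s1 :: machine
    assume s1: "t0 \<le> 40" "t1 \<le> 2 * k'" "simulates off s' s1" "reported s1 = reported s0"
      "\<forall>r<30. r \<noteq> 5 \<and> r \<noteq> 7 \<longrightarrow> reg s1 r = reg s0 r"
    have st: "reg s1 5 = 2 * length P' + 1" "reg s1 4 = 2" "\<forall>i<length P'. scratch s1 (2 * i + 1) = P' ! i"
      using s1(3) p(2) by (auto simp: simulates_def)
    \<comment> \<open>The top of the stack is \<open>cl u\<close>, where the route already is;
      lowering the pointer by 2 skips it.\<close>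
    define s2 where "s2 = s1\<lparr>reg := (reg s1)(5 := 2 * length P' - 1, 11 := of_bool (2 < 2 * length P' - 1))\<rparr>"
    have 3: "runs W D (Arith Sub 5 5 4 ;; Arith Less 11 4 5) s1 (\<lambda>t s'. t = 2 \<and> s' = s2)"
      using st(1,2) M2 W P'(1) by (simp add: s2_def fun_upd_twist)
    have reg1: "reg s1 0 = n" "reg s1 2 = v" "reg s1 3 = M" "reg s1 8 = N" "reg s1 9 = a" "reg s1 10 = k"
      "reg s1 12 = u" "reg s1 17 = cl u" "reg s1 19 = 0"
      using s1(5) s by (simp_all add: s0_def)
    have lenP': "1 \<le> length P'" using P'(1) by (cases P') auto
    have tlP: "tl (rev P') = rev (butlast P')" using P'(1) by (metis butlast_rev rev_rev_ident)
    have "runs W D (While_Nonzero 11 step_body ;; finish) s2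
      (\<lambda>t s'. reported s' = reported s2 @ P \<and> t \<le> 100 * length P)"
    proof (rule cluster_loop[OF route P'(3) uv])
      show "reg s2 12 = u" "reg s2 17 = hd (rev P')" using reg1 P'(1,2) by (simp_all add: s2_def hd_rev)
      show "reg s2 5 = 2 * length (tl (rev P')) + 1" using lenP' by (simp add: s2_def)
      show "\<forall>i<length (tl (rev P')). scratch s2 (2 * i + 1) = rev (tl (rev P')) ! i"
        unfolding tlP using st(3) by (simp add: s2_def nth_butlast)
      have "2 < 2 * length P' - 1 \<longleftrightarrow> butlast P' \<noteq> []"
        unfolding length_0_conv[symmetric] length_butlast by linarith
      then show "reg s2 11 = of_bool (tl (rev P') \<noteq> [])" unfolding tlP by (simp add: s2_def)
      show "globals v s2" using reg1 st(2) by (simp add: globals_def s2_def)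
      show "2 * length (rev P') + 1 + 2 * M < W" using M2 by simp
    qed
    then have 4: "runs W D (While_Nonzero 11 step_body ;; finish) s2
      (\<lambda>t s'. reported s' = P \<and> t0 + (t1 + (2 + t)) \<le> 100 * length P + 2 * k' + 50)"
      by (rule runs_mono) (use s1 s(14) in \<open>auto simp: s2_def s0_def\<close>)
    show "runs W D ((Arith Sub 5 5 4 ;; Arith Less 11 4 5) ;; While_Nonzero 11 step_body ;; finish) s1
      (\<lambda>t s'. reported s' = P \<and> t0 + (t1 + t) \<le> 100 * length P + 2 * k' + 50)"
      by (rule runs_Seq[OF 3]) (use 4 in simp)
  qed
  then show "runs W D (If_Nonzero 11 finish (setup_embedded ;; embed p ;; (Arith Sub 5 5 4 ;; Arith Less 11 4 5) ;;
       While_Nonzero 11 step_body ;; finish)) s (\<lambda>t' s. reported s = P \<and> t + t' \<le> 100 * length P + 2 * k' + 100)"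
    using s(1,2) cl by (auto elim!: runs_mono)
qed

end

section \<open>The stored words\<close>

primrec pack :: "nat \<Rightarrow> nat list \<Rightarrow> nat" where
  "pack M [] = 0"
| "pack M (x # xs) = x + M * pack M xs"

lemma digit_pack: "\<forall>x\<in>set xs. x < M \<Longrightarrow> j < length xs \<Longrightarrow> digit M (pack M xs) j = xs ! j"
proof (induction xs arbitrary: j)
  case (Cons x xs)
  then have x: "x < M" by simp
  show ?case
  proof (cases j)
    case 0
    then show ?thesis using x by (simp add: digit_def)
  next
    case (Suc i)
    have "(x + M * pack M xs) div M = pack M xs" using x by simp
    then show ?thesis using Cons Suc by (simp add: digit_Suc)
  qed
qed simp

lemma pack_less: "\<forall>x\<in>set xs. x < M \<Longrightarrow> 0 < M \<Longrightarrow> pack M xs < M ^ length xs"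
proof (induction xs)
  case (Cons x xs)
  then have x: "x < M" and IH: "pack M xs + 1 \<le> M ^ length xs" by simp_all
  have "x + M * pack M xs < M * (pack M xs + 1)" using x by simp
  also have "\<dots> \<le> M * M ^ length xs" by (rule mult_le_mono2[OF IH])
  finally show ?case by simp
qed simp

text \<open>Depths must fit into a digit for every \<open>t\<close>, so the bound
  \<open>3 * t\<close> does not help here. All smaller depths occur on the way to the root, which
  gives \<open>dep v + 1\<close> distinct values among \<open>n\<close> vertices.\<close>

lemma dep_bound:
  assumes r: "rooted_forest n cl par dep" and v: "v < n"
  shows "dep v < n"
proof -
  have "{..dep v} \<subseteq> dep ` {..<n}" if "v < n" for v
    using that
  proof (induction "dep v" arbitrary: v)
    case 0
    then show ?case by (auto intro!: rev_image_eqI[of v])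
  next
    case (Suc k)
    have p: "par v < n" "dep v = Suc (dep (par v))" using rooted_forest_par[OF r Suc.prems] Suc(2) by auto
    have "{..dep (par v)} \<subseteq> dep ` {..<n}" using Suc(1)[OF _ p(1)] Suc(2) p(2) by simp
    moreover have "dep v \<in> dep ` {..<n}" using Suc.prems by simp
    moreover have "{..dep v} = insert (dep v) {..dep (par v)}" unfolding p(2) by (rule atMost_Suc)
    ultimately show ?case by (metis insert_subset)
  qed
  then have "card {..dep v} \<le> card (dep ` {..<n})" using v by (intro card_mono) auto
  also have "\<dots> \<le> n" using card_image_le[of "{..<n}" dep] by simp
  finally show ?thesis by simp
qed

text \<open>The table is keyed by ordered pairs of clusters, so that an entry knows which end lies
  on which side; an edge yields at most two keys.\<close>

lemma card_ordered_pairs: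
  assumes "finite S"
  shows "finite {(i, j). {i, j} \<in> S}" "card {(i, j). {i, j} \<in> S} \<le> 2 * card S"
proof -
  have fc: "finite {(i, j). {i, j} = e} \<and> card {(i, j). {i, j} = e} \<le> 2" for e :: "'a set"
  proof (cases "\<exists>x y. e = {x, y}")
    case True
    then obtain x y where e: "e = {x, y}" by blast
    have *: "{(i, j). {i, j} = e} \<subseteq> {(x, y), (y, x)}" unfolding e by (auto simp: doubleton_eq_iff)
    have "card {(i, j). {i, j} = e} \<le> card {(x, y), (y, x)}" by (rule card_mono[OF _ *]) simp
    moreover have "card {(x, y), (y, x)} \<le> 2" by (rule card_insert_le_m1) simp_all
    moreover have "finite {(i, j). {i, j} = e}" by (rule finite_subset[OF *]) simp
    ultimately show ?thesis by (intro conjI) (assumption, rule le_trans)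
  next
    case False
    then have "{(i, j). {i, j} = e} = {}" by auto
    then show ?thesis by simp
  qed
  have eq: "{(i, j). {i, j} \<in> S} = (\<Union>e\<in>S. {(i, j). {i, j} = e})" by auto
  show "finite {(i, j). {i, j} \<in> S}" unfolding eq using assms fc by (intro finite_UN_I) auto
  have "card {(i, j). {i, j} \<in> S} \<le> (\<Sum>e\<in>S. card {(i, j). {i, j} = e})"
    unfolding eq by (rule card_UN_le[OF assms])
  also have "\<dots> \<le> (\<Sum>e\<in>S. 2)" by (intro sum_mono) (use fc in simp)
  finally show "card {(i, j). {i, j} \<in> S} \<le> 2 * card S" by simp
qed

text \<open>There are at most \<open>2 * card S\<close> keys, and \<open>k\<close> keys take
  \<open>k\<close> headers and at most \<open>42 * k\<close> cells: this gives 86. The exponent 113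
  is \<open>7 * 16\<close> for the seven digits of a vertex word, plus one for the factor 2 in
  \<open>word_bounds\<close>; adding \<open>b0\<close> makes room for the given data.\<close>

lemma oracle_data:
  fixes X Y :: "nat \<Rightarrow> nat \<Rightarrow> nat"
  assumes forest: "rooted_forest n cl par dep" and cl: "\<And>v. v < n \<Longrightarrow> cl v < 2 * n"
    and N: "N \<le> n" and fin: "finite S"
    and S: "\<And>i j. {i, j} \<in> S \<Longrightarrow> i < N \<and> j < N \<and> X i j < n \<and> Y i j < n"
    and D': "\<forall>x\<in>set D'. x < word_bound b0 N"
    and M: "M = (n + 2) ^ 16" and b: "b = b0 + 113"
  obtains D k a off where
    "stored_oracle (word_bound b n) D M n cl par dep N k a off S X Y"
    "length D \<le> n + 86 * card S + length D'" "off < M"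
    "off + length D' \<le> length D" "\<And>i. i < length D' \<Longrightarrow> D ! (off + i) = D' ! i"
proof -
  define B where "B = n + 2"
  have B2: "2 \<le> B" by (simp add: B_def)
  have MB: "M = B ^ 16" by (simp add: M B_def)
  have pw: "B ^ i \<le> B ^ j" if "i \<le> j" for i j by (rule power_increasing) (use that B2 in auto)
  have M2: "2 \<le> M" using pw[of 1 16] B2 MB by simp
  then have M0: "0 < M" by simp
  have nB: "n < B" "N < B" using N by (auto simp: B_def)
  define pairs where "pairs = {(i, j). {i, j} \<in> S}"
  define Z where "Z = (\<lambda>(i, j). i * N + j) ` pairs"
  define k where "k = card Z"
  have pairs: "finite pairs" "card pairs \<le> 2 * card S"
    unfolding pairs_def using card_ordered_pairs[OF fin] by auto
  have Zfin: "finite Z" using pairs by (simp add: Z_def)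
  have kS: "k \<le> 2 * card S" using card_image_le[OF pairs(1)] pairs(2) unfolding k_def Z_def by (rule le_trans)
  have key: "i * N + j < N * N" "(i * N + j) div N = i" "(i * N + j) mod N = j" if "{i, j} \<in> S" for i j
  proof -
    have ij: "i < N" "j < N" using S[OF that] by auto
    have "i * N + j < Suc i * N" using ij by simp
    also have "\<dots> \<le> N * N" using ij by (intro mult_le_mono1) simp
    finally show "i * N + j < N * N" .
    show "(i * N + j) div N = i" "(i * N + j) mod N = j" using ij by simp_all
  qed
  have Zsub: "Z \<subseteq> {..<N * N}" using key by (auto simp: Z_def pairs_def)
  define val where "val x = pack M [X (x div N) (x mod N), Y (x div N) (x mod N)]" for x
  obtain a a2 m2 o2 tb where H: "a \<le> k * (N * N)" "length tb \<le> 42 * k" "set tb \<subseteq> insert 0 (val ` Z)"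
    "\<And>g. a2 g \<le> 6 * k\<^sup>2 * (N * N)" "\<And>g. m2 g \<le> 6 * k\<^sup>2" "\<And>g. g < k \<Longrightarrow> o2 g \<le> 42 * k"
    "\<And>x. x \<in> Z \<Longrightarrow> hash k (N * N) a x < k"
    "\<And>x g j. x \<in> Z \<Longrightarrow> g = hash k (N * N) a x \<Longrightarrow> j = o2 g + hash (m2 g) (N * N) (a2 g) x \<Longrightarrow>
       j < length tb \<and> tb ! j = val x"
    using perfect_hash_table[OF Zfin Zsub k_def, of val] unfolding Let_def by blast

  have NN: "N * N \<le> B ^ 2" unfolding power2_eq_square using nB by (intro mult_le_mono) auto
  have kB: "k \<le> B ^ 2"
    using card_mono[OF finite_lessThan Zsub] NN unfolding k_def by simp
  have k2: "6 * k\<^sup>2 \<le> B ^ 7"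
  proof -
    have "6 * k\<^sup>2 \<le> B ^ 3 * (B ^ 2)\<^sup>2"
      using kB power_mono[OF B2, of 3] by (intro mult_le_mono power_mono) auto
    then show ?thesis by (simp add: power_mult[symmetric] power_add[symmetric])
  qed
  \<comment> \<open>The largest power needed below is \<open>B ^ 9\<close>, for the second-level
    multipliers. The exponent 16 leaves room and is a power of two, as repeated squaring
    requires.\<close>
  have lt: "x < M" if "x \<le> B ^ j" "j < 16" for x j
  proof -
    have "B ^ j < B ^ 16" by (rule power_strict_increasing) (use that B2 in auto)
    then show ?thesis using that(1) MB by simp
  qed
  have aM: "a < M"
  proof (rule lt)
    have "a \<le> B ^ 2 * B ^ 2" using H(1) mult_le_mono[OF kB NN] by (rule le_trans)
    then show "a \<le> B ^ 4" by (simp add: power_add[symmetric])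
  qed simp
  have a2M: "a2 g < M" for g
  proof (rule lt)
    have "a2 g \<le> B ^ 7 * B ^ 2" using H(4) mult_le_mono[OF k2 NN] by (rule le_trans)
    then show "a2 g \<le> B ^ 9" by (simp add: power_add[symmetric])
  qed simp
  have m2M: "m2 g < M" for g by (rule lt[of _ 7]) (use H(5)[of g] k2 in auto)
  have kM: "k < M" by (rule lt[OF kB]) simp
  have offM: "n + k + y < M" if "y \<le> 42 * k" for y
  proof (rule lt)
    have "n + k + y \<le> B ^ 2 + 43 * B ^ 2" using that kB nB(1) pw[of 1 2] by simp
    also have "\<dots> = 44 * B ^ 2" by simp
    also have "\<dots> \<le> B ^ 6 * B ^ 2" using power_mono[OF B2, of 6] by (intro mult_le_mono1) simp
    finally show "n + k + y \<le> B ^ 8" by (simp add: power_add[symmetric])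
  qed simp
  define off where "off = n + k + length tb"
  define base where "base v = [par v, dep v, cl v, N, a, k, off]" for v
  define header where "header g = [a2 g, m2 g, n + k + o2 g]" for g
  define D where "D = map (\<lambda>v. pack M (base v)) [0..<n] @ map (\<lambda>g. pack M (header g)) [0..<k] @ tb @ D'"
  have nM: "n < M" "2 * n < M"
  proof -
    have "2 * n \<le> B * B" using nB B2 by (intro mult_le_mono) auto
    then show "2 * n < M" by (intro lt[of _ 2]) (auto simp: power2_eq_square)
    then show "n < M" by simp
  qed
  have base: "\<forall>x\<in>set (base v). x < M" if "v < n" for v
  proof -
    have "par v < n" "dep v < n" "cl v < 2 * n"
      using rooted_forest_par[OF forest that] dep_bound[OF forest that] cl[OF that] by auto
    then show ?thesis unfolding base_def off_def
      using nM aM kM offM[OF H(2)] N by auto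
  qed
  have header: "\<forall>x\<in>set (header g). x < M" if "g < k" for g
    unfolding header_def using a2M m2M offM[OF H(6)[OF that]] by simp
  have valM: "\<forall>x\<in>set [X i j, Y i j]. x < M" if "{i, j} \<in> S" for i j
    using S[OF that] nM by auto
  have W: "word_bound b n = B ^ b" by (simp add: word_bound_def B_def)
  have ltW: "x < word_bound b n" if "x < M ^ j" "j \<le> 7" for x j
  proof -
    have "M ^ j \<le> M ^ 7" using that(2) M2 by (intro power_increasing) auto
    also have "\<dots> = B ^ 112" unfolding MB by (simp add: power_mult[symmetric])
    also have "\<dots> \<le> B ^ b" by (rule pw) (simp add: b)
    finally show ?thesis using that(1) W by simp
  qed
  have words: "\<forall>x\<in>set D. x < word_bound b n"
  proof
    fix x assume "x \<in> set D"
    then consider v where "v < n" "x = pack M (base v)" | g where "g < k" "x = pack M (header g)" |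
      "x \<in> set tb" | "x \<in> set D'" unfolding D_def by auto
    then show "x < word_bound b n"
    proof cases
      case 1
      then show ?thesis using ltW[OF pack_less[OF base M0]] by (simp add: base_def)
    next
      case 2
      then show ?thesis using ltW[OF pack_less[OF header M0]] by (simp add: header_def)
    next
      case 3
      then consider "x = 0" | i j where "{i, j} \<in> S" "x = val (i * N + j)"
        using H(3) unfolding Z_def pairs_def by auto
      then show ?thesis
      proof cases
        case 1
        then show ?thesis using B2 by (simp add: W)
      next
        case 2
        then have "x = pack M [X i j, Y i j]" using key by (simp only: val_def)
        then show ?thesis using ltW[OF pack_less[OF valM[OF 2(1)] M0]] by simp
      qed
    next
      case 4
      then have "x < (N + 2) ^ b0" using D' by (simp add: word_bound_def)
      also have "\<dots> \<le> B ^ b0" by (rule power_mono) (use N in \<open>auto simp: B_def\<close>)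
      also have "\<dots> \<le> B ^ b" by (rule pw) (simp add: b)
      finally show ?thesis by (simp add: W)
    qed
  qed
  have Dbase: "D ! v = pack M (base v)" if "v < n" for v using that by (simp add: D_def nth_append)
  have dig: "digit M (D ! v) j = base v ! j" if "v < n" "j < 7" for v j
    unfolding Dbase[OF that(1)] by (rule digit_pack[OF base[OF that(1)]]) (use that(2) in \<open>simp add: base_def\<close>)
  have Dheader: "D ! (n + g) = pack M (header g)" if "g < k" for g using that by (simp add: D_def nth_append)
  have dig': "digit M (D ! (n + g)) j = header g ! j" if "g < k" "j < 3" for g j
    unfolding Dheader[OF that(1)] by (rule digit_pack[OF header[OF that(1)]]) (use that(2) in \<open>simp add: header_def\<close>)
  have Dtb: "D ! (n + k + i) = tb ! i" if "i < length tb" for i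
    using that by (simp add: D_def nth_append)
  have DD': "D ! (off + i) = D' ! i" for i
    by (simp add: D_def nth_append off_def)
  have lenD: "length D = n + k + length tb + length D'" by (simp add: D_def)
  have "stored_oracle (word_bound b n) D M n cl par dep N k a off S X Y"
  proof unfold_locales
    show "M ^ 4 < word_bound b n"
    proof -
      have "M ^ 4 < M ^ 5" using M2 by simp
      then show ?thesis by (rule ltW) simp
    qed
  next
    fix i j assume ij: "{i, j} \<in> S"
    define x where "x = i * N + j"
    define g where "g = hash k (N * N) a x"
    have x: "x \<in> Z" using ij by (force simp: x_def Z_def pairs_def)
    have g: "g < k" unfolding g_def by (rule H(7)[OF x])
    then show "n + hash k (N * N) a (i * N + j) < length D" by (simp add: lenD g_def x_def)
    fix h z assume h: "h = D ! (n + hash k (N * N) a (i * N + j))"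
      and z: "z = hash (digit M h 1) (N * N) (digit M h 0) (i * N + j) + digit M h 2"
    have h': "h = D ! (n + g)" by (simp add: h g_def x_def)
    have dh: "digit M h 0 = a2 g" "digit M h 1 = m2 g" "digit M h 2 = n + k + o2 g"
      unfolding h' using dig'[OF g, of 0] dig'[OF g, of 1] dig'[OF g, of 2] by (simp_all add: header_def)
    define y where "y = o2 g + hash (m2 g) (N * N) (a2 g) x"
    have zy: "z = n + k + y" unfolding z dh by (simp add: y_def x_def)
    have y: "y < length tb" "tb ! y = val x" using H(8)[OF x g_def y_def] by auto
    have "D ! z = pack M [X i j, Y i j]"
      unfolding zy Dtb[OF y(1)] y(2) val_def x_def using key[OF ij] by simp
    then show "z < length D \<and> digit M (D ! z) 0 = X i j \<and> digit M (D ! z) 1 = Y i j"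
      using digit_pack[OF valM[OF ij], of 0] digit_pack[OF valM[OF ij], of 1] y(1)
      by (simp add: zy lenD)
  qed (use forest lenD words nM M2 aM kM N S dig in \<open>auto simp: base_def\<close>)
  moreover have "length D \<le> n + 86 * card S + length D'" using lenD H(2) kS by linarith
  moreover have "off < M" unfolding off_def by (rule offM[OF H(2)])
  moreover have "off + length D' \<le> length D" by (simp add: lenD off_def)
  ultimately show thesis using that DD' by blast
qed

section \<open>The spanner\<close>

lemma exec_time_pos: "exec W D p s k s' \<Longrightarrow> 1 \<le> k"
  by (induction rule: exec.induct) auto

text \<open>Two tiny graphs force these bounds. On one vertex the answer has no edges, yet every run
  takes at least one step; on a single edge of weight 1 the distance is positive and the answer is
  at least as heavy. They serve to absorb additive constants in time and stretch.\<close>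

lemma oracle_parameters:
  assumes "0 < c" and spanner: "\<forall>n E w. weighted_graph n E w \<longrightarrow>
       (\<exists>S D. interactive_spanner p b c n E w \<alpha> q S D \<and> real (spanner_size S D) \<le> h n)"
  shows "1 \<le> c * q" "1 \<le> \<alpha>"
proof -
  have "weighted_graph 1 {} (\<lambda>_. 0)" by (simp add: weighted_graph_def)
  then obtain S D where "interactive_spanner p b c 1 {} (\<lambda>_. 0) \<alpha> q S D" using spanner by blast
  moreover have "is_path {} 0 0 [0]" by (simp add: is_path_def)
  ultimately obtain P k where Pk: "answers_in p b 1 D 0 0 P k" "is_path S 0 0 P"
    "real k \<le> c * (q + real (length (path_edges P)))"
    unfolding interactive_spanner_def by (metis less_one)
  obtain s where "exec (word_bound b 1) D p (query_state 1 0 0) k s" using Pk(1) unfolding answers_in_def by auto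
  then have "1 \<le> k" by (rule exec_time_pos)
  moreover have "length P \<le> 1"
  proof (cases P)
    case (Cons x xs)
    then have "x = 0" "x \<notin> set xs" "xs \<noteq> [] \<Longrightarrow> last xs = 0" using Pk(2) by (auto simp: is_path_def)
    then have "xs = []" using last_in_set[of xs] by auto
    then show ?thesis using Cons by simp
  qed simp
  ultimately show "1 \<le> c * q" using Pk(3) by simp
next
  define E where "E = {{0, 1 :: nat}}"
  define w where "w = (\<lambda>_ :: nat set. 1 :: real)"
  have "{0, 1 :: nat} \<in> {{x, y} | x y. x < 2 \<and> y < 2 \<and> x \<noteq> y}"
    by (rule CollectI, rule exI[of _ 0], rule exI[of _ 1]) simp
  then have g: "weighted_graph 2 E w" by (simp add: weighted_graph_def E_def w_def)
  then obtain S D where "interactive_spanner p b c 2 E w \<alpha> q S D" using spanner by blast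
  moreover have P0: "is_path E 0 1 [0, 1]" by (simp add: is_path_def E_def)
  ultimately obtain P where P: "path_weight w P \<le> \<alpha> * graph_dist E w 0 1"
    "graph_dist E w 0 1 \<le> path_weight w P"
    unfolding interactive_spanner_def by (metis one_less_numeral_iff semiring_norm(76) zero_less_numeral)
  obtain Q where Q: "is_path E 0 1 Q" "path_weight w Q = graph_dist E w 0 1"
    using graph_dist_attained[OF g P0] by auto
  have "2 \<le> length Q"
  proof (cases Q)
    case (Cons x xs)
    then show ?thesis using Q(1) by (cases xs) (auto simp: is_path_def)
  qed (use Q(1) in \<open>simp add: is_path_def\<close>)
  then have "1 \<le> graph_dist E w 0 1"
    unfolding Q(2)[symmetric] by (simp add: path_weight_def w_def map_replicate_const sum_list_replicate)
  moreover have "graph_dist E w 0 1 \<le> \<alpha> * graph_dist E w 0 1" using P by linarith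
  ultimately show "1 \<le> \<alpha>" by (simp add: mult_le_cancel_right1)
qed

lemma word_bounds:
  assumes M: "M = (n + 2) ^ 16" and b: "b = b0 + 113" and N: "N \<le> n" and off: "off < M"
  shows "2 * (N + 2) ^ (b0 + 1) \<le> word_bound b n" "off + (N + 2) ^ (b0 + 1) \<le> word_bound b n"
    "2 * n + 1 + 2 * M < word_bound b n"
proof -
  define B where "B = n + 2"
  have B2: "2 \<le> B" and MB: "M = B ^ 16" by (simp_all add: B_def M)
  have pw: "B ^ i \<le> B ^ j" if "i \<le> j" for i j by (rule power_increasing) (use that B2 in auto)
  have W: "B * B ^ (b0 + 112) = word_bound b n"
    unfolding word_bound_def b B_def[symmetric] power_Suc[symmetric] by (simp add: add.commute)
  have dbl: "2 * B ^ (b0 + 112) \<le> word_bound b n" unfolding W[symmetric] by (rule mult_le_mono1[OF B2])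
  have "(N + 2) ^ (b0 + 1) \<le> B ^ (b0 + 1)" by (rule power_mono) (use N in \<open>auto simp: B_def\<close>)
  also have "\<dots> \<le> B ^ (b0 + 112)" by (rule pw) simp
  finally have 1: "(N + 2) ^ (b0 + 1) \<le> B ^ (b0 + 112)" .
  then show "2 * (N + 2) ^ (b0 + 1) \<le> word_bound b n" using dbl by linarith
  have 2: "M \<le> B ^ (b0 + 112)" unfolding MB by (rule pw) simp
  then show "off + (N + 2) ^ (b0 + 1) \<le> word_bound b n" using 1 dbl off by linarith
  have "2 * n + 1 + 2 * M < 4 * M" using pw[of 1 16] by (simp add: MB B_def)
  also have "\<dots> \<le> B ^ 2 * M" using power_mono[OF B2, of 2] by (intro mult_le_mono1) simp
  also have "\<dots> = B ^ 18" by (simp add: MB power_add[symmetric])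
  also have "\<dots> \<le> word_bound b n" unfolding word_bound_def B_def[symmetric] b by (rule pw) simp
  finally show "2 * n + 1 + 2 * M < word_bound b n" .
qed

text \<open>The constants are rounded up. For a pair at distance \<open>d\<close>, the route in the
  quotient weighs at most \<open>\<alpha> * d\<close>, and detours of at most \<open>6 * t\<close>
  edges add \<open>24 * \<alpha> * t * d\<close>. The storage is at most \<open>n\<close> plus 87
  times the given size. The time is at most \<open>100 * length P + 2 * k' + 100\<close>, where
  \<open>1 \<le> c * q\<close> turns the constant 200 left after replacing vertices by edges into
  \<open>200 * c * q\<close>; hence \<open>202 * c\<close>.\<close>

lemma spanner_from_clusters:
  assumes c: "0 < c" and q: "1 \<le> c * q" and \<alpha>: "1 \<le> \<alpha>" and t: "1 \<le> t"
    and spanner: "\<forall>n E w. weighted_graph n E w \<longrightarrow>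
       (\<exists>S D. interactive_spanner p b0 c n E w \<alpha> q S D \<and> real (spanner_size S D) \<le> h n)"
    and g: "weighted_graph n E w" and b: "b = b0 + 113"
  shows "\<exists>S D. interactive_spanner (query_prog p) b (202 * c + 100) n E w (100 * (\<alpha> * t)) (q + t) S D \<and>
     real (spanner_size S D) \<le> real n + 100 * h (nat \<lfloor>real n / t\<rfloor>)"
proof -
  define N where "N = nat \<lfloor>real n / t\<rfloor>"
  define M where "M = (n + 2) ^ 16"
  have Nn: "N \<le> n"
  proof -
    have "real n / t \<le> real n" using t by (simp add: divide_le_eq mult_le_cancel_left1)
    then show ?thesis unfolding N_def by linarith
  qed
  obtain cl par dep where forest: "rooted_forest n cl par dep"
    and FE: "forest_edges n par dep \<subseteq> E"
    and depth: "\<And>v. v < n \<Longrightarrow> real (dep v) \<le> 3 * t"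
    and cl2: "\<And>v. v < n \<Longrightarrow> cl v < 2 * n"
    and clN': "\<And>v z. v < n \<Longrightarrow> z < n \<Longrightarrow> {v, z} \<in> E \<Longrightarrow> cl z \<noteq> cl v \<Longrightarrow> cl v < N"
    and same: "\<And>l u v. u < n \<Longrightarrow> v < n \<Longrightarrow> (u, v) \<in> conn E w l \<Longrightarrow> cl u = cl v \<Longrightarrow>
       (u, v) \<in> conn (forest_edges n par dep) w l"
    and other: "\<And>l u v. u < n \<Longrightarrow> v < n \<Longrightarrow> (u, v) \<in> conn E w l \<Longrightarrow> cl u \<noteq> cl v \<Longrightarrow> anchored n cl par dep w l u"
    using clustering[OF g t] unfolding N_def anchored_def by blast
  have clN: "cl v < N" if "{v, z} \<in> E" "cl z \<noteq> cl v" for v z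
    using clN'[OF _ _ that] weighted_graph_edge[OF g that(1)] by simp
  have w0: "\<forall>e\<in>E. 0 \<le> w e" using g by (simp add: weighted_graph_def)
  have anc: "anchored n cl par dep w (w {x, y}) x" if "{x, y} \<in> E" "cl x \<noteq> cl y" for x y
    using other[OF _ _ conn_edge[where w = w, OF that(1) order_refl] that(2)]
      weighted_graph_edge[OF g that(1)] by simp

  define E' where "E' = quotient_edges E cl"
  define w' where "w' = quotient_weight E w cl"
  have g': "weighted_graph N E' w'" unfolding E'_def w'_def by (rule quotient_graph[where cl = cl and N = N, OF g clN])
  obtain S' D' where SD': "interactive_spanner p b0 c N E' w' \<alpha> q S' D'" "real (spanner_size S' D') \<le> h N"
    using spanner g' by blast
  have S'E': "S' \<subseteq> E'" and D'words: "\<forall>x\<in>set D'. x < word_bound b0 N"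
    using SD'(1) by (auto simp: interactive_spanner_def)
  have fin: "finite S'" using S'E' weighted_graph_finite[OF g'] finite_subset by blast
  have "\<forall>i j. \<exists>x y. {i, j} \<in> S' \<longrightarrow> {x, y} \<in> E \<and> cl x = i \<and> cl y = j \<and> w {x, y} = w' {i, j}"
    using quotient_weight_attained[OF g] S'E' unfolding E'_def w'_def by blast
  then obtain X Y where XY: "\<And>i j. {i, j} \<in> S' \<Longrightarrow> {X i j, Y i j} \<in> E \<and> cl (X i j) = i \<and> cl (Y i j) = j \<and>
      w {X i j, Y i j} = w' {i, j}"
    by metis
  have S'N: "i < N \<and> j < N \<and> X i j < n \<and> Y i j < n" if "{i, j} \<in> S'" for i j
    using that S'E' weighted_graph_edge[OF g', of i j] weighted_graph_edge[OF g, of "X i j" "Y i j"] XY[OF that]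
    by auto
  obtain D k a off where stored: "stored_oracle (word_bound b n) D M n cl par dep N k a off S' X Y"
    and lenD: "length D \<le> n + 86 * card S' + length D'" and off: "off < M" "off + length D' \<le> length D"
      "\<And>i. i < length D' \<Longrightarrow> D ! (off + i) = D' ! i"
    using oracle_data[OF forest cl2 Nn fin S'N D'words M_def b] by blast
  define S where "S = forest_edges n par dep \<union> {{X i j, Y i j} | i j. {i, j} \<in> S'}"

  have SE: "S \<subseteq> E" using FE XY unfolding S_def by blast
  have size: "real (spanner_size S D) \<le> real n + 100 * h N"
  proof -
    have f: "forest_edges n par dep \<subseteq> (\<lambda>v. {v, par v}) ` {..<n}" by (auto simp: forest_edges_def)
    have "card (forest_edges n par dep) \<le> n"
      using surj_card_le[OF _ f] by simp
    moreover have eq: "{{X i j, Y i j} | i j. {i, j} \<in> S'} = (\<lambda>(i, j). {X i j, Y i j}) ` {(i, j). {i, j} \<in> S'}"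
      by auto
    have "card {{X i j, Y i j} | i j. {i, j} \<in> S'} \<le> 2 * card S'"
      unfolding eq using card_image_le[OF card_ordered_pairs(1)[OF fin]] card_ordered_pairs(2)[OF fin]
      by (rule le_trans)
    ultimately have "card S \<le> n + 2 * card S'" unfolding S_def by (meson add_mono card_Un_le le_trans)
    moreover have "card S' \<le> spanner_size S' D'" "length D' \<le> spanner_size S' D'"
      by (auto simp: spanner_size_def)
    ultimately have "spanner_size S D \<le> n + 100 * spanner_size S' D'"
      unfolding spanner_size_def[of S D] using lenD by simp
    then show ?thesis using SD'(2) by linarith
  qed

  interpret stored_oracle "word_bound b n" D M n cl par dep N k a off S' X Y by (rule stored)
  note bounds = word_bounds[OF M_def b Nn off(1)]
  have query: "\<exists>P k. answers_in (query_prog p) b n D u v P k \<and> is_path S u v P \<and>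
           graph_dist E w u v \<le> path_weight w P \<and>
           path_weight w P \<le> 100 * (\<alpha> * t) * graph_dist E w u v \<and>
           real k \<le> (202 * c + 100) * (q + t + real (length (path_edges P)))"
    if uv: "u < n" "v < n" and conn: "is_path E u v P1" for u v P1
  proof -
    define d where "d = graph_dist E w u v"
    obtain P0 where P0: "is_path E u v P0" "path_weight w P0 = d"
      using graph_dist_attained[OF g conn uv(1)] unfolding d_def by auto
    have P0': "P0 \<noteq> []" "set (path_edges P0) \<subseteq> E" "hd P0 = u" "last P0 = v"
      using P0(1) by (auto simp: is_path_def)
    have d0: "0 \<le> d" using path_weight_nonneg[OF w0 P0'(2)] P0(2) by simp
    have cd: "(u, v) \<in> conn E w d" using path_conn[OF w0 P0'(2,1)] P0' P0(2) by simp
    \<comment> \<open>Both cases end alike: \<open>T\<close> is the time beyond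
      \<open>100 * length P\<close>, namely 0 inside a cluster and \<open>2 * k' + 100\<close>
      otherwise.\<close>
    have ans: ?thesis
      if r: "runs (word_bound b n) D (query_prog p) (query_state n u v)
          (\<lambda>k s. reported s = P \<and> k \<le> 100 * length P + T)"
        and T: "real T \<le> 100 + 2 * c * (q + real (length P - 1))"
        and P: "is_path S u v P" and wP: "path_weight w P \<le> 100 * (\<alpha> * t) * d" for P T
    proof -
      obtain k s where ks: "exec (word_bound b n) D (query_prog p) (query_state n u v) k s"
        "reported s = P" "k \<le> 100 * length P + T"
        using r unfolding runs_def by auto
      have "is_path E u v P" using P SE by (auto simp: is_path_def)
      then have "d \<le> path_weight w P" unfolding d_def by (rule graph_dist_le[OF g])
      moreover have "real k \<le> (202 * c + 100) * (q + t + real (length (path_edges P)))"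
      proof -
        define m where "m = real (length P - 1)"
        have "P \<noteq> []" using P by (simp add: is_path_def)
        then have lenP: "real (length P) = m + 1" unfolding m_def by (cases P) auto
        have m0: "0 \<le> m" by (simp add: m_def)
        have cm: "0 \<le> c * m" "0 \<le> c * t" using c t m0 by simp_all
        have q0: "0 \<le> q" using q c by (metis less_eq_real_def mult_pos_neg not_le order_trans zero_le_one linorder_not_less)
        have "real k \<le> 100 * real (length P) + real T"
          using ks(3) by (metis of_nat_add of_nat_le_iff of_nat_mult of_nat_numeral)
        also have "\<dots> \<le> 100 * m + 200 + 2 * c * (q + m)" using T unfolding lenP m_def by simp
        also have "\<dots> \<le> 100 * m + 200 * (c * q) + 2 * c * (q + m)" using q by simp
        also have "\<dots> \<le> (202 * c + 100) * (q + t + m)"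
          using cm q0 t m0 by (simp add: algebra_simps)
        finally show ?thesis by (simp add: m_def)
      qed
      ultimately show ?thesis using ks P wP unfolding answers_in_def d_def by blast
    qed
    show ?thesis
    proof (cases "cl u = cl v")
      case True
      obtain P where P: "tree_path par dep u v P" using tree_path_exists[OF forest uv True] ..
      note pr = tree_path_props[OF forest P uv True]
      have "path_weight w P \<le> 2 * (3 * t) * d"
        by (rule tree_path_weight[OF forest P uv True depth same[OF uv cd True] d0])
      also have "\<dots> \<le> 100 * (\<alpha> * t) * d"
      proof (rule mult_right_mono[OF _ d0])
        have "1 * t \<le> \<alpha> * t" using \<alpha> t by (intro mult_right_mono) auto
        then show "2 * (3 * t) \<le> 100 * (\<alpha> * t)" using t by linarith
      qed
      finally have wP: "path_weight w P \<le> 100 * (\<alpha> * t) * d" .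
      have "is_path S u v P" using pr unfolding is_path_def S_def by blast
      moreover have "2 * M + 1 < word_bound b n" using bounds(3) by simp
      from query_same_cluster[OF uv M_def True P this, of p]
      have "runs (word_bound b n) D (query_prog p) (query_state n u v)
          (\<lambda>k s. reported s = P \<and> k \<le> 100 * length P + 0)" by simp
      ultimately show ?thesis
        by (intro ans[of P 0]) (use wP q c in \<open>simp_all add: distrib_left\<close>)
    next
      case False
      have dc: "(v, u) \<in> conn E w d" by (rule conn_sym[OF cd])
      \<comment> \<open>The walk between the ends leaves both clusters, and a cluster with an
        outgoing edge is labelled below \<open>N\<close>; so both labels are vertices of the
        quotient graph.\<close>
      have clless: "cl x < N" if xy: "(x, y) \<in> conn E w d" "cl x \<noteq> cl y" for x y
      proof -
        obtain x' z where "x' \<in> {z. cl z = cl x}" "z \<notin> {z. cl z = cl x}" "{x', z} \<in> E"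
          by (rule conn_exit[OF xy(1), of "{z. cl z = cl x}"]) (use xy(2) in auto)
        then show ?thesis using clN[of x' z] by simp
      qed
      have cluv: "cl u < N" "cl v < N" using clless[OF cd] clless[OF dc] False by auto
      have rP0: "is_path E v u (rev P0)" "path_weight w (rev P0) = d"
        using is_path_rev[OF P0(1)] P0(2) by (simp_all add: path_weight_rev)
      have "\<exists>Q. is_path (quotient_edges E cl) (cl (hd (rev P0))) (cl (last (rev P0))) Q \<and>
          path_weight (quotient_weight E w cl) Q \<le> path_weight w (rev P0)"
        by (rule quotient_path[OF g, where N = N]) (use clN rP0(1) in \<open>auto simp: is_path_def\<close>)
      moreover have "hd (rev P0) = v" "last (rev P0) = u" using rP0(1) by (auto simp: is_path_def)
      ultimately obtain Q where Q: "is_path E' (cl v) (cl u) Q" "path_weight w' Q \<le> d"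
        unfolding rP0(2) E'_def w'_def by auto
      have d': "graph_dist E' w' (cl v) (cl u) \<le> d" using graph_dist_le[OF g' Q(1)] Q(2) by simp
      obtain P' k' where P': "answers_in p b0 N D' (cl v) (cl u) P' k'" "is_path S' (cl v) (cl u) P'"
        "path_weight w' P' \<le> \<alpha> * graph_dist E' w' (cl v) (cl u)"
        "real k' \<le> c * (q + real (length (path_edges P')))"
        using SD'(1) cluv Q(1) unfolding interactive_spanner_def by blast
      have wP': "path_weight w' (rev P') \<le> \<alpha> * d"
      proof -
        have "\<alpha> * graph_dist E' w' (cl v) (cl u) \<le> \<alpha> * d" by (rule mult_left_mono[OF d']) (use \<alpha> in simp)
        then show ?thesis using P'(3) unfolding path_weight_rev by (rule order_trans[rotated])
      qed
      obtain s' where s': "exec (word_bound b0 N) D' p (query_state N (cl v) (cl u)) k' s'" "reported s' = P'"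
        using P'(1) unfolding answers_in_def by auto
      have Q': "is_path S' (cl u) (cl v) (rev P')" by (rule is_path_rev[OF P'(2)])
      have anch: "anchored n cl par dep w d u" "anchored n cl par dep w d v"
        using other[OF uv cd False] other[OF uv(2,1) dc] False by auto
      obtain P where P: "cluster_route par dep X Y v (rev P') u P" "is_path S u v P"
        "length (rev P') \<le> length P"
        "path_weight w P \<le> path_weight w' (rev P') + 2 * (3 * t) * (d + d + 2 * path_weight w' (rev P'))"
        using cluster_route_exists[OF g forest depth anc S'E'[unfolded E'_def] XY[unfolded w'_def] uv(2) anch(2) d0
            Q' uv(1) refl anch(1) d0]
        unfolding S_def w'_def by blast
      have wP: "path_weight w P \<le> 100 * (\<alpha> * t) * d"
      proof -
        have "0 \<le> \<alpha> * d" using \<alpha> d0 by simp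
        have a: "d \<le> \<alpha> * d" using mult_right_mono[OF \<alpha> d0] by simp
        have "d + d + 2 * path_weight w' (rev P') \<le> 4 * (\<alpha> * d)" using wP' a by linarith
        then have "2 * (3 * t) * (d + d + 2 * path_weight w' (rev P')) \<le> 2 * (3 * t) * (4 * (\<alpha> * d))"
          using t by (intro mult_left_mono) auto
        moreover have "2 * (3 * t) * (4 * (\<alpha> * d)) = 24 * (t * (\<alpha> * d))" by simp
        ultimately have "path_weight w P \<le> \<alpha> * d + 24 * (t * (\<alpha> * d))" using P(4) wP' by linarith
        moreover have "1 * (\<alpha> * d) \<le> t * (\<alpha> * d)" by (rule mult_right_mono[OF t \<open>0 \<le> \<alpha> * d\<close>])
        moreover have "100 * (\<alpha> * t) * d = 100 * (t * (\<alpha> * d))" by simp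
        ultimately show ?thesis using \<open>0 \<le> \<alpha> * d\<close> by linarith
      qed
      have lenP': "length P' \<le> N"
      proof -
        have "set P' \<subseteq> {..<N}"
          by (rule path_vertices[OF g']) (use P'(2) S'E' cluv in \<open>auto simp: is_path_def\<close>)
        then have "card (set P') \<le> N" using card_mono[OF finite_lessThan] by fastforce
        then show ?thesis using P'(2) distinct_card[of P'] by (simp add: is_path_def)
      qed
      \<comment> \<open>The exponent exceeds \<open>b0\<close> by one because the initial registers
        \<open>N\<close>, \<open>cl v\<close> and \<open>cl u\<close> of the given program must lie
        below this bound too, even for \<open>b0 = 0\<close>.\<close>
      let ?B = "(N + 2) ^ (b0 + 1)"
      have WB: "word_bound b0 N \<le> ?B" unfolding word_bound_def by (rule power_increasing) simp_all
      have NB: "N + 2 \<le> ?B" by (rule self_le_power) simp_all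
      have "runs (word_bound b n) D (query_prog p) (query_state n u v)
         (\<lambda>k s. reported s = P \<and> k \<le> 100 * length P + 2 * k' + 100)"
      proof (rule query_other_cluster[OF uv M_def False s' _ _ _ P(1)])
        show "P' \<noteq> []" "last P' = cl u" "set (path_edges (rev P')) \<subseteq> S'"
          using P'(2) by (auto simp: is_path_def path_edges_rev)
        show "word_bound b0 N \<le> ?B" by (rule WB)
        show "\<forall>x\<in>set D'. x < ?B" using D'words WB by (meson less_le_trans)
        show "N < ?B" "cl u < ?B" "cl v < ?B" using NB cluv by linarith+
        show "2 * length P' + 1 + 2 * M < word_bound b n" using bounds(3) lenP' Nn by linarith
      qed (use bounds off in auto)
      then have r: "runs (word_bound b n) D (query_prog p) (query_state n u v)
         (\<lambda>k s. reported s = P \<and> k \<le> 100 * length P + (2 * k' + 100))" by (simp add: add.assoc)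
      \<comment> \<open>The answer of the given oracle is no longer than the new one, so its time
        may be charged to the latter.\<close>
      have "real (length P' - 1) \<le> real (length P - 1)" using P(3) by simp
      then have "c * (q + real (length P' - 1)) \<le> c * (q + real (length P - 1))"
        using c by (intro mult_left_mono) auto
      then have "real (2 * k' + 100) \<le> 100 + 2 * c * (q + real (length P - 1))"
        using P'(4) by simp
      then show ?thesis by (rule ans[OF r _ P(2) wP])
    qed
  qed
  have "interactive_spanner (query_prog p) b (202 * c + 100) n E w (100 * (\<alpha> * t)) (q + t) S D"
    unfolding interactive_spanner_def using SE words query by blast
  then show ?thesis using size unfolding N_def by blast
qed

text \<open>The new program and its word length are chosen before \<open>t\<close>, because
  \<open>t\<close> affects only the stored data; the time constant depends on \<open>c\<close>
  alone.\<close>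

theorem theorem9:
  shows "\<exists>(A::real)>0. \<forall>(c::real)>0. \<exists>(K::real)>0. \<forall>(\<alpha>::real) (q::real) (h :: nat \<Rightarrow> real).
    (\<exists>p b. \<forall>n E w. weighted_graph n E w \<longrightarrow>
       (\<exists>S D. interactive_spanner p b c n E w \<alpha> q S D \<and> real (spanner_size S D) \<le> h n)) \<longrightarrow>
    (\<exists>p b. \<forall>(t::real)\<ge>1. \<forall>n E w. weighted_graph n E w \<longrightarrow>
       (\<exists>S D. interactive_spanner p b K n E w (A * (\<alpha> * t)) (q + t) S D \<and>
          real (spanner_size S D) \<le> real n + A * h (nat \<lfloor>real n / t\<rfloor>)))"
proof (rule exI[of _ 100], intro conjI allI impI)
  fix c :: real assume c: "0 < c"
  show "\<exists>K>0. \<forall>(\<alpha>::real) (q::real) (h :: nat \<Rightarrow> real).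
    (\<exists>p b. \<forall>n E w. weighted_graph n E w \<longrightarrow>
       (\<exists>S D. interactive_spanner p b c n E w \<alpha> q S D \<and> real (spanner_size S D) \<le> h n)) \<longrightarrow>
    (\<exists>p b. \<forall>(t::real)\<ge>1. \<forall>n E w. weighted_graph n E w \<longrightarrow>
       (\<exists>S D. interactive_spanner p b K n E w (100 * (\<alpha> * t)) (q + t) S D \<and>
          real (spanner_size S D) \<le> real n + 100 * h (nat \<lfloor>real n / t\<rfloor>)))"
  proof (rule exI[of _ "202 * c + 100"], intro conjI allI impI, goal_cases)
    case 1
    then show ?case using c by simp
  next
    case (2 \<alpha> q h)
    then obtain p b where sp: "\<forall>n E w. weighted_graph n E w \<longrightarrow>
       (\<exists>S D. interactive_spanner p b c n E w \<alpha> q S D \<and> real (spanner_size S D) \<le> h n)" by blast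
    note par = oracle_parameters[OF c sp]
    show ?case
      by (rule exI[of _ "query_prog p"], rule exI[of _ "b + 113"], intro allI impI)
        (rule spanner_from_clusters[OF c par _ sp _ refl])
  qed
qed simp

end
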